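(* Let $2\le n<\infty$ and let $\mathcal{E}_n=\operatorname{span}\{E_{00},\sum_{i=1}^nE_{ii},E_{i0},E_{0i}:1\le i\le n\}\subseteq M_{n+1}$. Then $\mathcal{E}_n\otimes_{\min}\mathcal{A}=\mathcal{E}_n\otimes_{\max}\mathcal{A}$ for every unital $C^*$-algebra $\mathcal{A}$.
   Context: $E_{ij}$, $0\le i,j\le n$, are the matrix units of $M_{n+1}$, and $\mathcal{E}_n$ has the operator system structure inherited from $M_{n+1}$. For operator systems $\mathcal{S},\mathcal{T}$, the tensor products $\mathcal{S}\otimes_{\min}\mathcal{T}$ and $\mathcal{S}\otimes_{\max}\mathcal{T}$ are the algebraic tensor product with order unit $1_{\mathcal S}\otimes 1_{\mathcal T}$ and the following matrix cones. Min: $u\in M_p(\mathcal{S}\otimes_{\min}\mathcal{T})^+$ iff $(\varphi\otimes\psi)^{(p)}(u)\ge 0$ for all unital completely positive $\varphi:\mathcal{S}\to M_k$, $\psi:\mathcal{T}\to M_m$, all $k,m$. Max: $u\in M_p(\mathcal{S}\otimes_{\max}\mathcal{T})^+$ iff for every $\epsilon>0$ there are $k,m$, $P\in M_k(\mathcal{S})^+$, $Q\in M_m(\mathcal{T})^+$ and a scalar $p\times km$ matrix $X$ with $\epsilon\, (I_p\otimes 1_{\mathcal{S}}\otimes 1_{\mathcal{T}})+u=X(P\otimes Q)X^*$. Equality of the two means that the identity map is a complete order isomorphism. *)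

theory Defs
  imports Complex_Main "HOL-Library.Function_Algebras" "HOL-Library.Nonpos_Ints"
begin

section \<open>Complex vector spaces and C*-algebras\<close>

class complex_vector = ab_group_add +
  fixes scaleC :: "complex \<Rightarrow> 'a \<Rightarrow> 'a"  (infixr \<open>*\<^sub>C\<close> 75)
  assumes scaleC_add_right: "c *\<^sub>C (x + y) = c *\<^sub>C x + c *\<^sub>C y"
    and scaleC_add_left: "(c + d) *\<^sub>C x = c *\<^sub>C x + d *\<^sub>C x"
    and scaleC_scaleC: "c *\<^sub>C (d *\<^sub>C x) = (c * d) *\<^sub>C x"
    and scaleC_one: "1 *\<^sub>C x = x"

global_interpretation cvec: vector_space "scaleC :: complex \<Rightarrow> 'a \<Rightarrow> 'a::complex_vector"
  defines cspan = cvec.span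
    and csubspace = cvec.subspace
  by unfold_locales (simp_all add: scaleC_add_right scaleC_add_left scaleC_scaleC scaleC_one)

text \<open>The norm and completeness come from the real Banach algebra classes; \<open>scaleC_of_real\<close> ties
  the real to the complex scalar multiplication. As usual for Isabelle's unital rings,
  \<open>0 \<noteq> 1\<close> is part of the class.\<close>

class cstar_algebra = real_normed_algebra_1 + banach + complex_vector +
  fixes star :: "'a \<Rightarrow> 'a"
  assumes scaleC_of_real: "complex_of_real r *\<^sub>C x = r *\<^sub>R x"
    and norm_scaleC: "norm (c *\<^sub>C x) = cmod c * norm x"
    and scaleC_mult_left: "(c *\<^sub>C x) * y = c *\<^sub>C (x * y)"
    and scaleC_mult_right: "x * (c *\<^sub>C y) = c *\<^sub>C (x * y)"
    and star_star: "star (star x) = x"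
    and star_add: "star (x + y) = star x + star y"
    and star_scaleC: "star (c *\<^sub>C x) = cnj c *\<^sub>C star x"
    and star_mult: "star (x * y) = star y * star x"
    and norm_star_mult_self: "norm (star x * x) = (norm x)\<^sup>2"

instantiation complex :: cstar_algebra
begin

definition scaleC_complex :: "complex \<Rightarrow> complex \<Rightarrow> complex" where
  "scaleC_complex c x = c * x"

definition star_complex :: "complex \<Rightarrow> complex" where
  "star_complex x = cnj x"

instance
  by standard
    (simp_all add: scaleC_complex_def star_complex_def algebra_simps norm_mult
      scaleR_conv_of_real power2_eq_square)

end

instantiation "fun" :: (type, complex_vector) complex_vector
begin

definition scaleC_fun :: "complex \<Rightarrow> ('a \<Rightarrow> 'b) \<Rightarrow> 'a \<Rightarrow> 'b" where
  "scaleC_fun c f = (\<lambda>x. c *\<^sub>C f x)"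

instance
  by standard (auto simp: scaleC_fun_def fun_eq_iff scaleC_add_right scaleC_add_left
      scaleC_scaleC scaleC_one)

end

definition linear_on :: "'a::complex_vector set \<Rightarrow> ('a \<Rightarrow> 'b::complex_vector) \<Rightarrow> bool" where
  "linear_on V f \<longleftrightarrow>
     (\<forall>x\<in>V. \<forall>y\<in>V. f (x + y) = f x + f y) \<and> (\<forall>c. \<forall>x\<in>V. f (c *\<^sub>C x) = c *\<^sub>C f x)"


section \<open>Matrices\<close>

text \<open>\<open>mats p V\<close> is the space of p-by-p matrices over \<open>V\<close>, with indices starting at 0 and entries
  outside the p-by-p block set to 0 so that equality of matrices is equality of functions.\<close>

type_synonym 'v matrix = "nat \<Rightarrow> nat \<Rightarrow> 'v"

definition mats :: "nat \<Rightarrow> 'v::zero set \<Rightarrow> 'v matrix set" where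
  "mats p V = {A. (\<forall>i<p. \<forall>j<p. A i j \<in> V) \<and> (\<forall>i j. \<not> (i < p \<and> j < p) \<longrightarrow> A i j = 0)}"

definition unit_mat :: "nat \<Rightarrow> complex matrix" where
  "unit_mat k = (\<lambda>i j. if i = j \<and> i < k then 1 else 0)"

definition matrix_unit :: "nat \<Rightarrow> nat \<Rightarrow> complex matrix" where
  "matrix_unit i j = (\<lambda>a b. if a = i \<and> b = j then 1 else 0)"

text \<open>Positive semidefiniteness of a scalar matrix whose rows and columns are indexed by a finite
  set. Index sets of pairs and triples serve for matrices over matrix algebras and for
  tensor products of matrix algebras.\<close>

definition psd :: "'i set \<Rightarrow> ('i \<Rightarrow> 'i \<Rightarrow> complex) \<Rightarrow> bool" where
  "psd I A \<longleftrightarrow> (\<forall>x. (\<Sum>i\<in>I. \<Sum>j\<in>I. cnj (x i) * A i j * x j) \<in> \<real>\<^sub>\<ge>\<^sub>0)"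


section \<open>Operator systems\<close>

text \<open>The data of an operator system: underlying space, order unit, matrix cones. The involution
  enters neither complete positivity nor the tensor cones and is not recorded.
  Here and below matrix size 0 is allowed; it imposes no condition.\<close>

record 'v opsys =
  carrier :: "'v set"
  ounit :: 'v
  mcone :: "nat \<Rightarrow> 'v matrix set"

definition matrix_opsys :: "nat \<Rightarrow> complex matrix opsys" where
  "matrix_opsys q = \<lparr>
     carrier = mats q UNIV,
     ounit = unit_mat q,
     mcone = (\<lambda>p. {P \<in> mats p (mats q UNIV).
       psd ({..<p} \<times> {..<q}) (\<lambda>(i, a) (j, b). P i j a b)})\<rparr>"

text \<open>Positive elements of the C*-algebra of p-by-p matrices over a C*-algebra are those of the
  form \<open>B\<^sup>* B\<close>.\<close>

definition cstar_opsys :: "'a::cstar_algebra opsys" where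
  "cstar_opsys = \<lparr>
     carrier = UNIV,
     ounit = 1,
     mcone = (\<lambda>p. {P. \<exists>B\<in>mats p UNIV. P = (\<lambda>i j. \<Sum>l<p. star (B l i) * B l j)})\<rparr>"

definition sub_opsys :: "'v::zero opsys \<Rightarrow> 'v set \<Rightarrow> 'v opsys" where
  "sub_opsys R V = \<lparr>carrier = V, ounit = ounit R, mcone = (\<lambda>p. mcone R p \<inter> mats p V)\<rparr>"

definition E_opsys :: "nat \<Rightarrow> complex matrix opsys" where
  "E_opsys n = sub_opsys (matrix_opsys (n + 1)) (cspan
     ({matrix_unit 0 0, \<Sum>i=1..n. matrix_unit i i}
      \<union> {matrix_unit i 0 | i. 1 \<le> i \<and> i \<le> n} \<union> {matrix_unit 0 i | i. 1 \<le> i \<and> i \<le> n}))"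

definition ucp :: "'a::complex_vector opsys \<Rightarrow> 'b::complex_vector opsys \<Rightarrow> ('a \<Rightarrow> 'b) \<Rightarrow> bool" where
  "ucp S T \<phi> \<longleftrightarrow>
     linear_on (carrier S) \<phi> \<and> \<phi> ` carrier S \<subseteq> carrier T \<and> \<phi> (ounit S) = ounit T \<and>
     (\<forall>p. \<forall>P\<in>mcone S p. (\<lambda>i j. \<phi> (P i j)) \<in> mcone T p)"

definition complete_order_iso ::
  "'a::complex_vector opsys \<Rightarrow> 'b::complex_vector opsys \<Rightarrow> ('a \<Rightarrow> 'b) \<Rightarrow> bool" where
  "complete_order_iso S T f \<longleftrightarrow>
     linear_on (carrier S) f \<and> bij_betw f (carrier S) (carrier T) \<and> f (ounit S) = ounit T \<and>
     (\<forall>p. \<forall>P\<in>mats p (carrier S). P \<in> mcone S p \<longleftrightarrow> (\<lambda>i j. f (P i j)) \<in> mcone T p)"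


section \<open>The algebraic tensor product\<close>

text \<open>The algebraic tensor product of the vector spaces \<open>V\<close> and \<open>W\<close> is realized as a space of
  functionals on the bilinear forms on \<open>V \<times> W\<close>, the pure tensor of \<open>v\<close> and \<open>w\<close> being evaluation
  at \<open>(v, w)\<close>. Lemma \<open>tensor_universal\<close> shows that this has the universal property.\<close>

type_synonym ('a, 'b) tensor = "('a \<Rightarrow> 'b \<Rightarrow> complex) \<Rightarrow> complex"

definition bilinear_on ::
  "'a::complex_vector set \<Rightarrow> 'b::complex_vector set \<Rightarrow> ('a \<Rightarrow> 'b \<Rightarrow> 'c::complex_vector) \<Rightarrow> bool" where
  "bilinear_on V W f \<longleftrightarrow>
     (\<forall>v\<in>V. linear_on W (f v)) \<and> (\<forall>w\<in>W. linear_on V (\<lambda>v. f v w))"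

definition pure_tensor ::
  "'a::complex_vector set \<Rightarrow> 'b::complex_vector set \<Rightarrow> 'a \<Rightarrow> 'b \<Rightarrow> ('a, 'b) tensor" where
  "pure_tensor V W v w = (\<lambda>\<beta>. if bilinear_on V W \<beta> then \<beta> v w else 0)"

definition tensor_space ::
  "'a::complex_vector set \<Rightarrow> 'b::complex_vector set \<Rightarrow> ('a, 'b) tensor set" where
  "tensor_space V W = cspan {pure_tensor V W v w | v w. v \<in> V \<and> w \<in> W}"

lemma bilinear_on_pure_tensor: "bilinear_on V W (pure_tensor V W)"
  unfolding bilinear_on_def[of V W "pure_tensor V W"] linear_on_def
  by (auto simp: pure_tensor_def fun_eq_iff scaleC_fun_def scaleC_complex_def)
    (auto simp: bilinear_on_def linear_on_def scaleC_complex_def)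

lemma tensor_space_linear_unique:
  fixes F G :: "('a::complex_vector, 'b::complex_vector) tensor \<Rightarrow> 'c::complex_vector"
  assumes F: "linear_on (tensor_space V W) F" and G: "linear_on (tensor_space V W) G"
    and eq: "\<And>v w. v \<in> V \<Longrightarrow> w \<in> W \<Longrightarrow> F (pure_tensor V W v w) = G (pure_tensor V W v w)"
    and u: "u \<in> tensor_space V W"
  shows "F u = G u"
proof -
  let ?D = "{pure_tensor V W v w | v w. v \<in> V \<and> w \<in> W}"
  have "F (0 *\<^sub>C u) = 0 *\<^sub>C F u" "G (0 *\<^sub>C u) = 0 *\<^sub>C G u"
    using F G u unfolding linear_on_def by blast+
  then have z: "F 0 = 0" "G 0 = 0" by simp_all
  have "u \<in> cspan ?D" using u by (simp add: tensor_space_def)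
  then have "u \<in> cspan ?D \<and> F u = G u"
  proof (induction rule: cvec.span_induct_alt)
    case base
    then show ?case using z by (simp only: cvec.span_zero simp_thms)
  next
    case (step c x y)
    have x: "x \<in> cspan ?D" "F x = G x" using step(1) eq by (auto intro: cvec.span_base)
    have cx: "c *\<^sub>C x \<in> cspan ?D" using x(1) by (rule cvec.span_scale)
    have y: "y \<in> cspan ?D" "F y = G y" using step(2) by (rule conjunct1, rule conjunct2)
    have "H (c *\<^sub>C x + y) = c *\<^sub>C H x + H y" if "linear_on (cspan ?D) H" for H :: "_ \<Rightarrow> 'c"
    proof -
      have "H (c *\<^sub>C x + y) = H (c *\<^sub>C x) + H y"
        using that cx y(1) unfolding linear_on_def by blast
      moreover have "H (c *\<^sub>C x) = c *\<^sub>C H x"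
        using that x(1) unfolding linear_on_def by blast
      ultimately show ?thesis by (simp only:)
    qed
    from this[OF F[unfolded tensor_space_def]] this[OF G[unfolded tensor_space_def]]
    have "F (c *\<^sub>C x + y) = G (c *\<^sub>C x + y)" by (simp only: x(2) y(2))
    then show ?case using cvec.span_add[OF cx y(1)] by (rule conjI[rotated])
  qed
  then show ?thesis by simp
qed

lemma tensor_universal:
  fixes f :: "'a::complex_vector \<Rightarrow> 'b::complex_vector \<Rightarrow> 'c::complex_vector"
  assumes f: "bilinear_on V W f"
  shows "\<exists>F. linear_on (tensor_space V W) F \<and>
           (\<forall>v\<in>V. \<forall>w\<in>W. F (pure_tensor V W v w) = f v w)"
proof -
  interpret tc: vector_space_pair "scaleC :: _ \<Rightarrow> ('a, 'b) tensor \<Rightarrow> _" "scaleC :: _ \<Rightarrow> 'c \<Rightarrow> _"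
    by unfold_locales
  interpret cc: vector_space_pair "scaleC :: _ \<Rightarrow> 'c \<Rightarrow> _" "scaleC :: _ \<Rightarrow> complex \<Rightarrow> _"
    by unfold_locales
  let ?D = "{pure_tensor V W v w | v w. v \<in> V \<and> w \<in> W}"
  obtain B where B: "B \<subseteq> ?D" "cvec.independent B" "?D \<subseteq> cspan B"
    using cvec.maximal_independent_subset[of ?D] by blast
  have "\<forall>b\<in>B. \<exists>v w. v \<in> V \<and> w \<in> W \<and> b = pure_tensor V W v w" using B(1) by blast
  then obtain p q where
    pq: "\<And>b. b \<in> B \<Longrightarrow> p b \<in> V \<and> q b \<in> W \<and> b = pure_tensor V W (p b) (q b)"
    by metis
  obtain F where F: "Vector_Spaces.linear scaleC scaleC F" "\<And>b. b \<in> B \<Longrightarrow> F b = f (p b) (q b)"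
    using tc.linear_independent_extend[OF B(2), of "\<lambda>b. f (p b) (q b)"] by auto
  interpret F: Vector_Spaces.linear scaleC scaleC F by (rule F(1))
  have "F (pure_tensor V W v w) = f v w" if vw: "v \<in> V" "w \<in> W" for v w
  proof (rule ccontr)
    let ?x = "F (pure_tensor V W v w) - f v w"
    assume "F (pure_tensor V W v w) \<noteq> f v w"
    then have "cvec.independent {?x}" by (simp add: cvec.dependent_single)
    then obtain h :: "'c \<Rightarrow> complex" where
      h: "Vector_Spaces.linear scaleC scaleC h" "h ?x = 1"
      using cc.linear_independent_extend[of "{?x}" "\<lambda>_. 1"] by auto
    interpret h: Vector_Spaces.linear scaleC scaleC h by (rule h(1))
    let ?\<beta> = "\<lambda>v w. h (f v w)"
    have \<beta>: "bilinear_on V W ?\<beta>"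
      using f by (auto simp: bilinear_on_def linear_on_def h.add h.scale)
    have "pure_tensor V W v w \<in> cspan B" using B(3) vw by blast
    then have "h (F (pure_tensor V W v w)) = pure_tensor V W v w ?\<beta>"
    proof (induction rule: cvec.span_induct_alt)
      case base
      then show ?case by (simp only: F.zero h.zero) simp
    next
      case (step c b y)
      have "h (F b) = h (f (p b) (q b))" using F(2) step(1) by simp
      also have "\<dots> = pure_tensor V W (p b) (q b) ?\<beta>" using \<beta> by (simp add: pure_tensor_def)
      also have "\<dots> = b ?\<beta>" using pq[OF step(1)] by simp
      finally show ?case
        using step(2) by (simp only: F.add F.scale h.add h.scale) (simp add: scaleC_fun_def)
    qed
    then have "h ?x = 0" using \<beta> by (simp add: pure_tensor_def h.diff)
    with h(2) show False by simp
  qed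
  moreover have "linear_on (tensor_space V W) F"
    by (simp add: linear_on_def F.add F.scale)
  ultimately show ?thesis by (intro exI[of _ F] conjI ballI) simp_all
qed


section \<open>Minimal and maximal tensor products of operator systems\<close>

abbreviation opsys_tensor ::
  "'a::complex_vector opsys \<Rightarrow> 'b::complex_vector opsys \<Rightarrow> ('a, 'b) tensor set" where
  "opsys_tensor S T \<equiv> tensor_space (carrier S) (carrier T)"

abbreviation opsys_pure ::
  "'a::complex_vector opsys \<Rightarrow> 'b::complex_vector opsys \<Rightarrow> 'a \<Rightarrow> 'b \<Rightarrow> ('a, 'b) tensor" where
  "opsys_pure S T \<equiv> pure_tensor (carrier S) (carrier T)"

text \<open>The matrix \<open>(\<phi> \<otimes> \<psi>)(u)\<close>, for linear maps \<open>\<phi>\<close> and \<open>\<psi>\<close> into matrix algebras, with rows and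
  columns indexed by pairs. A tensor is a functional on bilinear forms, so the entry at
  \<open>(a, b), (c, d)\<close> of the linear extension of \<open>s \<otimes> t \<mapsto> \<phi> s \<otimes> \<psi> t\<close> is the value of \<open>u\<close> at the
  bilinear form \<open>(s, t) \<mapsto> (\<phi> s) a c * (\<psi> t) b d\<close>.\<close>

definition tensor_map ::
  "('a \<Rightarrow> complex matrix) \<Rightarrow> ('b \<Rightarrow> complex matrix) \<Rightarrow> ('a, 'b) tensor \<Rightarrow>
   nat \<times> nat \<Rightarrow> nat \<times> nat \<Rightarrow> complex" where
  "tensor_map \<phi> \<psi> u = (\<lambda>(a, b) (c, d). u (\<lambda>s t. \<phi> s a c * \<psi> t b d))"

lemma tensor_map_pure_tensor:
  assumes "linear_on V \<phi>" "linear_on W \<psi>"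
  shows "tensor_map \<phi> \<psi> (pure_tensor V W s t) (a, b) (c, d) = \<phi> s a c * \<psi> t b d"
proof -
  have "bilinear_on V W (\<lambda>s t. \<phi> s a c * \<psi> t b d)"
    using assms unfolding bilinear_on_def linear_on_def
    by (auto simp: scaleC_fun_def scaleC_complex_def algebra_simps)
  then show ?thesis by (simp add: tensor_map_def pure_tensor_def)
qed

definition min_tensor ::
  "'a::complex_vector opsys \<Rightarrow> 'b::complex_vector opsys \<Rightarrow> ('a, 'b) tensor opsys" where
  "min_tensor S T = \<lparr>
     carrier = opsys_tensor S T,
     ounit = opsys_pure S T (ounit S) (ounit T),
     mcone = (\<lambda>p. {u \<in> mats p (opsys_tensor S T).
       \<forall>k m \<phi> \<psi>. ucp S (matrix_opsys k) \<phi> \<longrightarrow> ucp T (matrix_opsys m) \<psi> \<longrightarrow>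
         psd ({..<p} \<times> ({..<k} \<times> {..<m}))
           (\<lambda>(i, a) (j, b). tensor_map \<phi> \<psi> (u i j) a b)})\<rparr>"

text \<open>The km columns of the scalar matrix \<open>X\<close> are indexed by pairs, \<open>X i a b\<close> being the entry in
  row \<open>i\<close> and column \<open>(a, b)\<close>; the entry of \<open>P \<otimes> Q\<close> at \<open>(a, b), (c, d)\<close> is \<open>P a c \<otimes> Q b d\<close>.\<close>

definition max_tensor ::
  "'a::complex_vector opsys \<Rightarrow> 'b::complex_vector opsys \<Rightarrow> ('a, 'b) tensor opsys" where
  "max_tensor S T = \<lparr>
     carrier = opsys_tensor S T,
     ounit = opsys_pure S T (ounit S) (ounit T),
     mcone = (\<lambda>p. {u \<in> mats p (opsys_tensor S T).
       \<forall>\<epsilon>>0. \<exists>k m. \<exists>P\<in>mcone S k. \<exists>Q\<in>mcone T m. \<exists>X :: nat \<Rightarrow> nat \<Rightarrow> nat \<Rightarrow> complex.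
         \<forall>i<p. \<forall>j<p.
           (complex_of_real \<epsilon> * unit_mat p i j) *\<^sub>C opsys_pure S T (ounit S) (ounit T) + u i j =
           (\<Sum>a<k. \<Sum>b<m. \<Sum>c<k. \<Sum>d<m.
             (X i a b * cnj (X j c d)) *\<^sub>C opsys_pure S T (P a c) (Q b d))})\<rparr>"

end

theory Submission
  imports Defs
begin

text \<open>Write \<open>u\<close> in \<open>M\<^sub>p(\<E>\<^sub>n \<otimes> A)\<close> as the block matrix with corner \<open>a\<close>, diagonal blocks
  \<open>c, \<dots>, c\<close>, first column \<open>x\<^sub>1, \<dots>, x\<^sub>n\<close> and first row \<open>x\<^sub>1\<^sup>*, \<dots>, x\<^sub>n\<^sup>*\<close>, all with entries in
  \<open>M\<^sub>p(A)\<close>. If it is positive and \<open>c\<close> is invertible, the Schur complement \<open>a - \<Sum> x\<^sub>i\<^sup>* c\<^sup>-\<^sup>1 x\<^sub>i\<close> is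
  positive, and \<open>u\<close> is \<open>E\<^sub>0\<^sub>0\<close> tensored with it plus \<open>\<Sum> P\<^sub>a\<^sub>b \<otimes> Q\<^sub>a\<^sub>b\<close>, where
  \<open>Q\<^sub>a\<^sub>b = y\<^sub>a\<^sup>* c\<^sup>-\<^sup>1 y\<^sub>b\<close> with \<open>y\<^sub>0 = c\<close>, \<open>y\<^sub>i = x\<^sub>i\<close>, and \<open>P\<close> is the matrix over \<open>\<E>\<^sub>n\<close> with
  \<open>P\<^sub>0\<^sub>0 = \<Sum> E\<^sub>i\<^sub>i\<close>, \<open>P\<^sub>0\<^sub>i = E\<^sub>i\<^sub>0\<close>, \<open>P\<^sub>i\<^sub>0 = E\<^sub>0\<^sub>i\<close>, \<open>P\<^sub>i\<^sub>j = \<delta>\<^sub>i\<^sub>j E\<^sub>0\<^sub>0\<close>, which is positive.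

  Square roots in \<open>M\<^sub>p(A)\<close> are not needed, since the size of \<open>Q\<close> in the maximal cone is free and
  sums of squares therefore suffice. Up to \<open>\<epsilon>\<close>, an element that is positive under all unital
  completely positive maps \<open>A \<rightarrow> M\<^sub>m\<close> is such a sum, by separation of convex cones. The inverse of
  \<open>c\<close> is replaced by a Neumann sum whose error is controlled in the order of sums of squares, so
  no norm on \<open>M\<^sub>p(A)\<close> is needed either. The one analytic input is that \<open>b\<^sup>* b\<close> is positive in \<open>A\<close>
  (Kaplansky), which makes the unital completely positive maps separate the points of \<open>A\<close>.\<close>

section \<open>Positive elements of C*-algebras\<close>

text \<open>The maximal cone tolerates no error except a multiple of the order unit: once
  \<open>\<epsilon>\<close> is added, the factorization must be an identity. A truncated inverse
  \<open>q\<close> of \<open>c\<close> would change the off-diagonal blocks to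
  \<open>c q x_i\<close>. What is factored instead is the matrix with rows
  \<open>(c + 2 \<nu>, 1)\<close> and \<open>(1, g)\<close>, where \<open>g = 2 q - q c q\<close>:
  its off-diagonal entry is exactly 1, and the whole error is the multiple \<open>2 \<nu>\<close> of
  the unit. The value of \<open>g\<close> is dictated by the Schur complement. Write
  \<open>'\<close> for the adjoint and let \<open>R_0, ..., R_n\<close> be the columns of a
  factorization of \<open>u\<close>. The shape of \<open>\<E>_n\<close> gives
  \<open>R_i' R_j = 0\<close> for distinct \<open>i\<close>, \<open>j\<close> in \<open>1..n\<close>
  and \<open>R_i' R_i = c\<close>, so \<open>S = 1 - \<Sum> R_i q R_i'\<close> satisfies
  \<open>S S = 1 - \<Sum> R_i g R_i'\<close>. Hence \<open>a - \<Sum> x_i' g x_i\<close> is the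
  square of \<open>S R_0\<close> for every selfadjoint \<open>q\<close>. As
  \<open>P_ii = E_00\<close> for all \<open>i \<ge> 1\<close>, only the sum of these
  \<open>Q_ii\<close> matters, and the square is added to one of them instead of forming a summand
  of its own.\<close>

lemma star_zero [simp]: "star (0::'a::cstar_algebra) = 0"
  using star_add[of "0::'a" 0] by simp

lemma star_one [simp]: "star (1::'a::cstar_algebra) = 1"
  by (metis mult.right_neutral mult.left_neutral star_mult star_star)

lemma star_minus: "star (- x :: 'a::cstar_algebra) = - star x"
  using star_add[of x "- x"] by (simp add: eq_neg_iff_add_eq_0 add.commute)

lemma star_diff: "star (x - y :: 'a::cstar_algebra) = star x - star y"
  using star_add[of x "- y"] by (simp add: star_minus)

lemma star_scaleR: "star (r *\<^sub>R x :: 'a::cstar_algebra) = r *\<^sub>R star x"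
  by (metis scaleC_of_real star_scaleC complex_cnj_complex_of_real)

lemma star_of_real [simp]: "star (of_real r :: 'a::cstar_algebra) = of_real r"
  by (simp add: of_real_def star_scaleR)

lemma star_sum: "star (\<Sum>i\<in>I. f i :: 'a::cstar_algebra) = (\<Sum>i\<in>I. star (f i))"
  by (induction I rule: infinite_finite_induct) (auto simp: star_add)

lemma norm_star [simp]: "norm (star x) = norm (x::'a::cstar_algebra)"
proof -
  have le: "norm y \<le> norm (star y)" for y :: 'a
  proof (cases "y = 0")
    case False
    have "(norm y)\<^sup>2 \<le> norm (star y) * norm y"
      using norm_mult_ineq[of "star y" y] by (simp add: norm_star_mult_self)
    then show ?thesis using False by (simp add: power2_eq_square)
  qed simp
  from le[of x] le[of "star x"] show ?thesis by (simp add: star_star)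
qed

lemma bounded_linear_star: "bounded_linear (star :: 'a \<Rightarrow> 'a::cstar_algebra)"
  by (rule bounded_linear_intro[where K = 1]) (simp_all add: star_add star_scaleR)

lemma of_real_commute: "of_real r * x = x * (of_real r :: 'a::real_algebra_1)"
  by (simp add: of_real_def)

section \<open>Hermitian elements and their square roots\<close>

definition hermitian :: "'a::cstar_algebra \<Rightarrow> bool" where
  "hermitian x \<longleftrightarrow> star x = x"

lemma hermitian_simps [simp]:
  "hermitian (0::'a::cstar_algebra)" "hermitian (1::'a)" "hermitian (of_real r :: 'a)"
  by (simp_all add: hermitian_def)

lemma hermitian_intros:
  fixes x y :: "'a::cstar_algebra"
  shows "hermitian x \<Longrightarrow> hermitian y \<Longrightarrow> hermitian (x + y)"
    and "hermitian x \<Longrightarrow> hermitian y \<Longrightarrow> hermitian (x - y)"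
    and "hermitian x \<Longrightarrow> hermitian (- x)"
    and "hermitian x \<Longrightarrow> hermitian (r *\<^sub>R x)"
    and "hermitian x \<Longrightarrow> hermitian y \<Longrightarrow> x * y = y * x \<Longrightarrow> hermitian (x * y)"
    and "hermitian (star z * z)"
  by (simp_all add: hermitian_def star_add star_diff star_minus star_scaleR star_mult star_star)

lemma norm_hermitian_square: "hermitian (x::'a::cstar_algebra) \<Longrightarrow> norm (x * x) = (norm x)\<^sup>2"
  using norm_star_mult_self[of x] by (simp add: hermitian_def)

text \<open>The square root of \<open>1 - y\<close> is \<open>1 - w\<close> where \<open>w\<close> solves \<open>w = (y + w\<^sup>2) / 2\<close>. Iterating from 0
  converges even when \<open>\<parallel>y\<parallel> = 1\<close>, because the increments are dominated by those of the same
  iteration for the scalar \<open>y = 1\<close>.\<close>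

lemma sqrt_one_minus:
  fixes y :: "'a::cstar_algebra"
  assumes y: "hermitian y" "norm y \<le> 1"
  obtains z where "hermitian z" "z * z = 1 - y" "norm (1 - z) \<le> 1"
    "\<And>x. x * y = y * x \<Longrightarrow> x * z = z * x"
proof -
  define w :: "nat \<Rightarrow> 'a" where "w = rec_nat 0 (\<lambda>_ v. (1/2) *\<^sub>R (y + v * v))"
  define s :: "nat \<Rightarrow> real" where "s = rec_nat 0 (\<lambda>_ v. (1/2) * (1 + v * v))"
  have w0: "w 0 = 0" and wS: "\<And>k. w (Suc k) = (1/2) *\<^sub>R (y + w k * w k)"
    by (simp_all add: w_def)
  have s0: "s 0 = 0" and sS: "\<And>k. s (Suc k) = (1/2) * (1 + s k * s k)"
    by (simp_all add: s_def)
  have s01: "0 \<le> s k \<and> s k \<le> 1" for k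
  proof (induction k)
    case (Suc k)
    then have "s k * s k \<le> 1" by (simp add: mult_le_one)
    then show ?case by (simp add: sS)
  qed (simp add: s0)
  have s_mono: "incseq s"
  proof (rule incseq_SucI)
    fix k
    have "0 \<le> (1 - s k)\<^sup>2" by simp
    then show "s k \<le> s (Suc k)" by (simp add: sS power2_eq_square algebra_simps)
  qed
  have nw: "norm (w k) \<le> s k" for k
  proof (induction k)
    case (Suc k)
    have "norm (w k * w k) \<le> s k * s k"
      using norm_mult_ineq[of "w k" "w k"] mult_mono[OF Suc Suc] s01[of k] by fastforce
    then have "norm (y + w k * w k) \<le> 1 + s k * s k"
      using norm_triangle_ineq[of y "w k * w k"] y(2) by linarith
    then show ?case by (simp add: wS sS)
  qed (simp add: w0 s0)
  have inc: "norm (w (Suc k) - w k) \<le> s (Suc k) - s k" for k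
  proof (induction k)
    case 0
    show ?case using y(2) by (simp add: w0 wS s0 sS)
  next
    case (Suc k)
    let ?d = "w (Suc k) - w k" and ?e = "s (Suc k) - s k"
    have "w (Suc (Suc k)) - w (Suc k) = (1/2) *\<^sub>R (w (Suc k) * w (Suc k) - w k * w k)"
      unfolding wS[of "Suc k"] by (subst (3) wS) (simp add: algebra_simps)
    \<comment> \<open>The splitting needs no commutativity, and the scalar sequence satisfies it
      too, so the bound passes to the next increment.\<close>
    also have "w (Suc k) * w (Suc k) - w k * w k = w (Suc k) * ?d + ?d * w k"
      by (simp add: algebra_simps)
    finally have eq: "w (Suc (Suc k)) - w (Suc k) = (1/2) *\<^sub>R (w (Suc k) * ?d + ?d * w k)" .
    have "norm (w (Suc k) * ?d) \<le> s (Suc k) * ?e"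
      by (rule order_trans[OF norm_mult_ineq mult_mono]) (use nw s01 Suc in auto)
    moreover have "norm (?d * w k) \<le> ?e * s k"
      by (rule order_trans[OF norm_mult_ineq mult_mono])
        (use nw[of k] s01[of k] Suc incseq_SucD[OF s_mono, of k] in auto)
    ultimately have "norm (w (Suc k) * ?d + ?d * w k) \<le> s (Suc k) * ?e + ?e * s k"
      using norm_triangle_ineq[of "w (Suc k) * ?d" "?d * w k"] by linarith
    also have "\<dots> = 2 * (s (Suc (Suc k)) - s (Suc k))"
      unfolding sS[of "Suc k"] by (subst (6) sS) (simp add: algebra_simps)
    finally show ?case by (simp add: eq)
  qed
  have inc': "norm (w (k + j) - w k) \<le> s (k + j) - s k" for k j
  proof (induction j)
    case (Suc j)
    have "norm (w (k + Suc j) - w k) \<le> norm (w (Suc (k + j)) - w (k + j)) + norm (w (k + j) - w k)"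
      using norm_triangle_ineq[of "w (Suc (k + j)) - w (k + j)" "w (k + j) - w k"] by simp
    then show ?case using inc[of "k + j"] Suc by simp
  qed simp
  have "convergent s"
    using s_mono s01 by (intro Bseq_mono_convergent BseqI'[of _ 1]) (auto simp: incseq_def)
  then have "Cauchy s" by (rule convergent_Cauchy)
  have "Cauchy w"
  proof (rule CauchyI')
    fix e :: real assume "0 < e"
    then obtain M where M: "\<forall>m\<ge>M. \<forall>n\<ge>M. norm (s m - s n) < e"
      using \<open>Cauchy s\<close> unfolding Cauchy_iff by blast
    show "\<exists>M. \<forall>m\<ge>M. \<forall>n>m. dist (w m) (w n) < e"
    proof (intro exI allI impI)
      fix m n assume "M \<le> m" "m < n"
      then obtain j where j: "n = m + j" using less_imp_add_positive by blast
      have "norm (s n - s m) < e" using M \<open>M \<le> m\<close> \<open>m < n\<close> by auto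
      then show "dist (w m) (w n) < e" using inc'[of m j]
        by (simp add: j dist_norm norm_minus_commute)
    qed
  qed
  then obtain v where v: "w \<longlonglongrightarrow> v" using Cauchy_convergent convergent_def by blast
  have "(\<lambda>k. w (Suc k)) \<longlonglongrightarrow> (1/2) *\<^sub>R (y + v * v)"
    unfolding wS by (intro tendsto_intros v)
  then have veq: "v = (1/2) *\<^sub>R (y + v * v)" using LIMSEQ_unique[OF LIMSEQ_Suc[OF v]] by blast
  have "star (w k) = w k" for k
    using y(1) by (induction k) (simp_all add: w0 wS star_add star_scaleR star_mult hermitian_def)
  then have "w \<longlonglongrightarrow> star v" using bounded_linear.tendsto[OF bounded_linear_star v] by simp
  from LIMSEQ_unique[OF v this] have "hermitian v" by (simp add: hermitian_def)
  have "norm v \<le> 1"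
    by (rule LIMSEQ_le_const2[OF tendsto_norm[OF v]]) (intro exI[of _ 0] allI impI order_trans[OF nw], use s01 in blast)
  \<comment> \<open>What commutes with \<open>y\<close> commutes with every iterate and so with the
    limit. This clause does the work of a functional calculus wherever roots of commuting elements
    have to commute.\<close>
  have com: "x * v = v * x" if x: "x * y = y * x" for x
  proof -
    have wc: "x * w k = w k * x" for k
    proof (induction k)
      case (Suc k)
      have "x * (w k * w k) = (w k * w k) * x" by (metis Suc mult.assoc)
      then show ?case using x by (simp add: wS algebra_simps)
    qed (simp add: w0)
    have "(\<lambda>k. x * w k) \<longlonglongrightarrow> x * v" "(\<lambda>k. w k * x) \<longlonglongrightarrow> v * x"
      by (intro tendsto_intros v)+
    then show ?thesis using LIMSEQ_unique unfolding wc by blast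
  qed
  show ?thesis
  proof (rule that[of "1 - v"])
    show "hermitian (1 - v)" using \<open>hermitian v\<close> by (intro hermitian_intros) auto
    have "2 *\<^sub>R v = 2 *\<^sub>R ((1/2) *\<^sub>R (y + v * v))" using veq by (rule arg_cong)
    then have "v + v = y + v * v" by (simp add: scaleR_2)
    then show "(1 - v) * (1 - v) = 1 - y" by (simp add: algebra_simps)
    show "norm (1 - (1 - v)) \<le> 1" using \<open>norm v \<le> 1\<close> by simp
    show "x * (1 - v) = (1 - v) * x" if "x * y = y * x" for x
      using com[OF that] by (simp add: algebra_simps)
  qed
qed


text \<open>For hermitian \<open>x\<close> such a \<open>t\<close> exists iff the spectrum is
  nonnegative. In this form closure under addition is the triangle inequality.\<close>

definition pos :: "'a::cstar_algebra \<Rightarrow> bool" where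
  "pos x \<longleftrightarrow> hermitian x \<and> (\<exists>t. norm (of_real t - x) \<le> t)"

lemma pos_hermitian: "pos x \<Longrightarrow> hermitian x"
  by (simp add: pos_def)

lemma pos_add:
  assumes "pos x" "pos y" shows "pos (x + y)"
proof -
  obtain s t where "norm (of_real s - x) \<le> s" "norm (of_real t - y) \<le> t"
    using assms by (auto simp: pos_def)
  then have "norm ((of_real s - x) + (of_real t - y)) \<le> s + t"
    using norm_triangle_ineq[of "of_real s - x" "of_real t - y"] by linarith
  then have "norm (of_real (s + t) - (x + y)) \<le> s + t" by (simp add: algebra_simps)
  then show ?thesis using assms hermitian_intros(1) unfolding pos_def by blast
qed

lemma pos_scaleR:
  assumes "pos x" "0 \<le> r" shows "pos (r *\<^sub>R x)"
proof -
  obtain t where t: "norm (of_real t - x) \<le> t" using assms by (auto simp: pos_def)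
  have "of_real (r * t) - r *\<^sub>R x = r *\<^sub>R (of_real t - x)"
    by (simp add: of_real_def algebra_simps)
  then have "norm (of_real (r * t) - r *\<^sub>R x) \<le> r * t"
    using t \<open>0 \<le> r\<close> by (simp add: mult_left_mono)
  then show ?thesis using assms hermitian_intros(4) unfolding pos_def by blast
qed

lemma pos_of_real_diff: "hermitian x \<Longrightarrow> norm x \<le> t \<Longrightarrow> pos (of_real t - x)"
  unfolding pos_def by (auto intro!: hermitian_intros exI[of _ t])

text \<open>With \<open>y = (t - x) / t\<close>, of norm at most 1, one has
  \<open>x = t (1 - y)\<close>, so the root of \<open>1 - y\<close> is rescaled; that its distance
  from 1 is at most 1 makes it \<open>pos\<close>.\<close>

lemma pos_sqrt:
  assumes "pos x"
  obtains z where "pos z" "z * z = x" "\<And>y. y * x = x * y \<Longrightarrow> y * z = z * y"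
proof -
  obtain t where t: "norm (of_real t - x) \<le> t" and x: "hermitian x"
    using assms by (auto simp: pos_def)
  show ?thesis
  proof (cases "t = 0")
    case True
    then have "x = 0" using t by simp
    then show ?thesis using that[of 0] by (auto simp: pos_def intro: exI[of _ 0])
  next
    case False
    then have "t > 0" using t norm_ge_zero[of "of_real t - x"] by linarith
    define y where "y = (1/t) *\<^sub>R (of_real t - x)"
    have "norm y \<le> 1" using t \<open>t > 0\<close> by (simp add: y_def)
    have "hermitian y" unfolding y_def
      by (intro hermitian_intros(2,4) hermitian_simps(3) x)
    from sqrt_one_minus[OF this \<open>norm y \<le> 1\<close>] obtain z where
      z: "hermitian z" "z * z = 1 - y" "norm (1 - z) \<le> 1" "\<And>x. x * y = y * x \<Longrightarrow> x * z = z * x"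
      by blast
    have xy: "t *\<^sub>R (1 - y) = x" using \<open>t > 0\<close>
      by (simp add: y_def algebra_simps of_real_def)
    show ?thesis
    proof (rule that[of "sqrt t *\<^sub>R z"])
      have "pos z" using z(1,3) unfolding pos_def by (auto intro: exI[of _ 1])
      then show "pos (sqrt t *\<^sub>R z)" using \<open>t > 0\<close> by (simp add: pos_scaleR)
      show "sqrt t *\<^sub>R z * sqrt t *\<^sub>R z = x" using \<open>t > 0\<close> z(2) xy by simp
      fix a assume "a * x = x * a"
      then have "a * y = y * a" by (simp add: y_def algebra_simps of_real_def)
      from z(4)[OF this] show "a * sqrt t *\<^sub>R z = sqrt t *\<^sub>R z * a" by simp
    qed
  qed
qed

section \<open>Norm inequalities from commuting squares, and positivity of
  \<open>star b * b\<close>\<close>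

text \<open>The element \<open>u = v + \<i> w\<close> satisfies
  \<open>star u * u = v * v + w * w\<close>, and \<open>v\<close> is its real part, so
  \<open>norm v \<le> norm u\<close>. Together with square roots this replaces spectral estimates
  below.\<close>

lemma norm_square_le_sum:
  fixes v w :: "'a::cstar_algebra"
  assumes v: "hermitian v" and w: "hermitian w" and com: "v * w = w * v"
  shows "(norm v)\<^sup>2 \<le> norm (v * v + w * w)"
proof -
  define u where "u = v + \<i> *\<^sub>C w"
  have su: "star u = v - \<i> *\<^sub>C w"
    using v w by (simp add: u_def star_add star_scaleC hermitian_def)
  have "star u * u = (v - \<i> *\<^sub>C w) * (v + \<i> *\<^sub>C w)" by (simp only: su) (simp only: u_def)
  also have "\<dots> = v * v + w * w"
    using com
    by (simp add: algebra_simps scaleC_mult_left scaleC_mult_right scaleC_scaleC scaleC_one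
        scaleC_add_right)
  finally have nu: "norm (v * v + w * w) = (norm u)\<^sup>2" by (metis norm_star_mult_self)
  have "u + star u = 2 *\<^sub>R v" unfolding su by (simp add: u_def scaleR_2)
  then have "2 * norm v \<le> norm u + norm (star u)"
    using norm_triangle_ineq[of u "star u"] by simp
  then have "norm v \<le> norm u" by simp
  then show ?thesis unfolding nu by (simp add: power_mono)
qed

text \<open>After scaling to norm 1, \<open>1 - v * v\<close> has a root \<open>w\<close> commuting
  with \<open>v\<close>; then \<open>w * w + v * v = 1\<close> bounds \<open>norm (w * w)\<close>,
  that is \<open>norm (1 - v * v)\<close>, by 1.\<close>

lemma pos_square:
  assumes z: "hermitian z" shows "pos (z * z)"
proof (cases "z = 0")
  case True
  then show ?thesis by (auto simp: pos_def intro: exI[of _ 0])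
next
  case False
  define t where "t = norm z"
  have "t > 0" using False by (simp add: t_def)
  define v where "v = (1/t) *\<^sub>R z"
  have v: "hermitian v" "norm v = 1"
    using z \<open>t > 0\<close> by (auto simp: v_def t_def intro: hermitian_intros)
  have vv: "hermitian (v * v)" "norm (v * v) \<le> 1"
    using v by (auto intro: hermitian_intros simp: norm_hermitian_square)
  obtain w where w: "hermitian w" "w * w = 1 - v * v"
    "\<And>x. x * (v * v) = (v * v) * x \<Longrightarrow> x * w = w * x"
    using sqrt_one_minus[OF vv] by metis
  have "w * v = v * w" using w(3)[of v] by (simp add: mult.assoc)
  from norm_square_le_sum[OF w(1) v(1) this] have "norm (1 - v * v) \<le> 1"
    by (simp add: w(2)[symmetric] norm_hermitian_square[OF w(1)]) (simp add: w(2))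
  then have "pos (v * v)" using vv(1) unfolding pos_def by (auto intro: exI[of _ 1])
  then have "pos ((t * t) *\<^sub>R (v * v))" by (rule pos_scaleR) simp
  then show ?thesis using \<open>t > 0\<close> by (simp add: v_def)
qed

lemma pos_mult:
  assumes x: "pos x" and y: "pos y" and com: "x * y = y * x"
  shows "pos (x * y)"
proof -
  obtain v where v: "pos v" "v * v = x" "\<And>a. a * x = x * a \<Longrightarrow> a * v = v * a"
    using pos_sqrt[OF x] by blast
  obtain w where w: "pos w" "w * w = y" "\<And>a. a * y = y * a \<Longrightarrow> a * w = w * a"
    using pos_sqrt[OF y] by blast
  have "y * v = v * y" by (rule v(3)) (simp add: com)
  then have vw: "v * w = w * v" by (intro w(3)) (rule sym)
  have "hermitian (v * w)" using vw by (intro hermitian_intros pos_hermitian v(1) w(1))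
  then have "pos ((v * w) * (v * w))" by (rule pos_square)
  also have "(v * w) * (v * w) = v * (w * v) * w" by (simp add: mult.assoc)
  also have "\<dots> = (v * v) * (w * w)" by (simp only: vw[symmetric] mult.assoc)
  also have "\<dots> = x * y" by (simp only: v(2) w(2))
  finally show ?thesis .
qed

text \<open>The roots of \<open>e - x\<close> and \<open>e + x\<close> commute and their squares add
  up to \<open>2 e\<close>, so \<open>norm (e - x) \<le> 2 e\<close>. The constant 3 is what the
  triangle inequality leaves; any fixed multiple of \<open>e\<close> serves the limit argument for
  which this is made.\<close>

lemma norm_le_of_pos_bounds:
  assumes x: "hermitian x" and e: "0 \<le> e" and m: "pos (of_real e - x)" and p: "pos (of_real e + x)"
  shows "norm x \<le> 3 * e"
proof -
  obtain v where v: "pos v" "v * v = of_real e - x"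
      "\<And>a. a * (of_real e - x) = (of_real e - x) * a \<Longrightarrow> a * v = v * a"
    using pos_sqrt[OF m] by blast
  obtain w where w: "pos w" "w * w = of_real e + x"
      "\<And>a. a * (of_real e + x) = (of_real e + x) * a \<Longrightarrow> a * w = w * a"
    using pos_sqrt[OF p] by blast
  have "x * v = v * x"
    by (rule v(3)) (simp add: left_diff_distrib right_diff_distrib of_real_commute)
  then have "(of_real e + x) * v = v * (of_real e + x)"
    by (simp add: distrib_left distrib_right of_real_commute)
  then have "v * w = w * v" by (intro w(3)) (rule sym)
  from norm_square_le_sum[OF v(1)[THEN pos_hermitian] w(1)[THEN pos_hermitian] this]
  moreover have "v * v + w * w = of_real (2 * e)" by (simp add: v(2) w(2) flip: mult_2)
  ultimately have "(norm v)\<^sup>2 \<le> norm (of_real (2 * e) :: 'a)" by simp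
  then have "norm (of_real e - x) \<le> 2 * e"
    using norm_hermitian_square[OF v(1)[THEN pos_hermitian]] e v(2) by (simp only: norm_of_real)
  moreover have "norm x \<le> norm (of_real e :: 'a) + norm (of_real e - x)"
    using norm_triangle_ineq4[of "of_real e" "of_real e - x"] by simp
  ultimately show ?thesis using e by simp
qed

text \<open>The norm of a positive element is the top of its spectrum; this is the part of that fact
  used below. With \<open>r = norm (k + s)\<close>, both \<open>k\<close> and
  \<open>r - s - k\<close> are squares of commuting elements, and they add up to
  \<open>r - s\<close>.\<close>

lemma norm_pos_add_of_real:
  assumes k: "pos k" and s: "0 \<le> s"
  shows "norm k + s \<le> norm (k + of_real s)"
proof -
  define r where "r = norm (k + of_real s)"
  obtain v where v: "pos v" "v * v = k" "\<And>a. a * k = k * a \<Longrightarrow> a * v = v * a"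
    using pos_sqrt[OF k] by blast
  note vh = v(1)[THEN pos_hermitian]
  have "s \<le> r"
    using norm_square_le_sum[OF hermitian_simps(3)[of "sqrt s"] vh of_real_commute] s
    by (simp add: v(2) r_def add.commute flip: of_real_mult)
  have "pos (of_real r - (k + of_real s))"
    by (rule pos_of_real_diff) (simp_all add: r_def hermitian_intros pos_hermitian k)
  then have "pos (of_real (r - s) - k)" by (simp add: algebra_simps)
  from pos_sqrt[OF this] obtain w where w: "pos w" "w * w = of_real (r - s) - k"
      "\<And>a. a * (of_real (r - s) - k) = (of_real (r - s) - k) * a \<Longrightarrow> a * w = w * a"
    by blast
  have "k * v = v * k" by (rule v(3)) simp
  then have "(of_real (r - s) - k) * v = v * (of_real (r - s) - k)"
    by (simp only: left_diff_distrib[of _ k] right_diff_distrib[of _ _ k] of_real_commute)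
  then have "v * w = w * v" by (intro w(3)) (rule sym)
  from norm_square_le_sum[OF vh w(1)[THEN pos_hermitian] this]
  have "norm k \<le> norm (of_real (r - s) :: 'a)"
    by (simp add: v(2) w(2) norm_hermitian_square[OF vh, symmetric] del: of_real_diff)
  then show ?thesis using \<open>s \<le> r\<close> by (simp only: norm_of_real r_def)
qed

text \<open>With \<open>k = - c\<^sup>* c\<close> and \<open>\<parallel>t - c c\<^sup>*\<parallel> \<le> t\<close> one gets
  \<open>\<parallel>k (t + k)\<parallel> = \<parallel>c\<^sup>* (t - c c\<^sup>*) c\<parallel> \<le> t \<parallel>k\<parallel>\<close>, which positivity of \<open>k\<close> permits only for \<open>k = 0\<close>.\<close>

lemma pos_minus_star_mult_self:
  fixes c :: "'a::cstar_algebra"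
  assumes "pos (- (star c * c))"
  shows "c = 0"
proof -
  define k where "k = - (star c * c)"
  have k: "pos k" using assms by (simp add: k_def)
  \<comment> \<open>Up to sign, \<open>x\<close> and \<open>y\<close> are twice the real and
    imaginary parts of \<open>c\<close>. As \<open>x * x + y * y\<close> is twice
    \<open>c * star c + star c * c\<close>, positivity of \<open>- (star c * c)\<close> passes to
    \<open>c * star c\<close>.\<close>
  define x where "x = c + star c"
  define y where "y = \<i> *\<^sub>C (c - star c)"
  have "hermitian x" "hermitian y"
    by (simp_all add: hermitian_def x_def y_def star_add star_diff star_star star_scaleC
        add.commute cvec.scale_right_diff_distrib)
  have "y * y = - ((c - star c) * (c - star c))"
    by (simp add: y_def scaleC_mult_left scaleC_mult_right scaleC_scaleC scaleC_one)
  then have "x * x + y * y = 2 *\<^sub>R (c * star c + star c * c)"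
    by (simp add: x_def algebra_simps scaleR_2)
  then have "c * star c = (1/2) *\<^sub>R (x * x + y * y) + k" by (simp add: k_def)
  also have "pos \<dots>"
    by (intro pos_add pos_scaleR pos_square \<open>hermitian x\<close> \<open>hermitian y\<close> k) simp
  finally obtain t where t: "norm (of_real t - c * star c) \<le> t" by (auto simp: pos_def)
  then have "t \<ge> 0" using norm_ge_zero order_trans by blast
  have nk: "norm k = (norm c)\<^sup>2" by (simp add: k_def norm_star_mult_self)
  have "norm (star c * (of_real t - c * star c) * c) \<le> norm c * t * norm c"
    by (intro order_trans[OF norm_mult_ineq] mult_mono)
       (use t \<open>t \<ge> 0\<close> in auto)
  moreover have "star c * (of_real t - c * star c) * c = - (k * k + t *\<^sub>R k)"
    by (simp add: k_def algebra_simps of_real_def)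
  ultimately have "norm (k * k + t *\<^sub>R k) \<le> t * norm k"
    by (metis nk norm_minus_cancel mult.commute mult.assoc power2_eq_square)
  \<comment> \<open>Completing the square turns the bound on \<open>k * k + t k\<close> into one on
    the hermitian \<open>k + t/2\<close>, whose norm is at least
    \<open>norm k + t/2\<close>.\<close>
  moreover have "(k + of_real (t/2)) * (k + of_real (t/2)) = (k * k + t *\<^sub>R k) + of_real ((t/2)\<^sup>2)"
    by (simp add: of_real_def algebra_simps power2_eq_square flip: scaleR_left.add)
  ultimately have "norm ((k + of_real (t/2)) * (k + of_real (t/2))) \<le> t * norm k + (t/2)\<^sup>2"
    using norm_triangle_ineq[of "k * k + t *\<^sub>R k" "of_real ((t/2)\<^sup>2)"]
    by (simp only: norm_of_real) simp
  then have "(norm (k + of_real (t/2)))\<^sup>2 \<le> t * norm k + (t/2)\<^sup>2"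
    by (subst norm_hermitian_square[symmetric])
      (intro hermitian_intros(1) hermitian_simps(3) pos_hermitian[OF k])
  moreover have "(norm k + t/2)\<^sup>2 \<le> (norm (k + of_real (t/2)))\<^sup>2"
    using norm_pos_add_of_real[OF k, of "t/2"] \<open>t \<ge> 0\<close> by (intro power_mono) auto
  ultimately have "(norm k)\<^sup>2 \<le> 0" by (simp add: power2_eq_square algebra_simps)
  then show ?thesis using nk by simp
qed

text \<open>Let \<open>m\<close> be the absolute value and \<open>n\<close> the negative part of
  \<open>h = star b * b\<close>. Then \<open>h * n = - (m * n)\<close> and
  \<open>n * n = m * n\<close>, so \<open>star (b * n) * (b * n)\<close> is the negative element
  \<open>- (m * n * n)\<close>. This forces \<open>b * n = 0\<close>, then \<open>n ^ 4 = 0\<close>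
  and \<open>n = 0\<close>, that is \<open>h = m\<close>.\<close>

lemma pos_star_mult_self: "pos (star b * b)"
proof -
  define h where "h = star b * b"
  have h: "hermitian h" by (simp add: h_def hermitian_intros)
  obtain m where m: "pos m" "m * m = h * h" "\<And>a. a * (h * h) = (h * h) * a \<Longrightarrow> a * m = m * a"
    using pos_sqrt[OF pos_square[OF h]] by blast
  have hm: "h * m = m * h" using m(3)[of h] by (simp add: mult.assoc)
  define n where "n = (1/2) *\<^sub>R (m - h)"
  have n: "hermitian n" unfolding n_def by (intro hermitian_intros(2,4) pos_hermitian[OF m(1)] h)
  have mn: "m * n = n * m" by (simp add: n_def algebra_simps hm)
  have hn: "h * n = - (m * n)" by (simp add: n_def algebra_simps hm m(2))
  have "(m - h) * (m - h) = 2 *\<^sub>R (m * (m - h))"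
    by (simp add: algebra_simps hm m(2) scaleR_2)
  then have nn: "n * n = m * n" by (simp add: n_def)
  have "star (b * n) * (b * n) = n * (h * n)"
    using n by (simp add: h_def star_mult hermitian_def mult.assoc)
  also have "\<dots> = - (m * (n * n))" by (simp add: hn mn[symmetric] mult.assoc)
     (metis mn mult.assoc)
  finally have eq: "star (b * n) * (b * n) = - (m * (n * n))" .
  have "pos (m * (n * n))"
    by (rule pos_mult) (use m(1) n mn in \<open>auto intro: pos_square simp: mult.assoc\<close>, metis mn mult.assoc)
  then have "b * n = 0" by (intro pos_minus_star_mult_self) (simp add: eq)
  then have mnn: "m * (n * n) = 0" using eq by simp
  have "(n * n) * (n * n) = (m * (n * n)) * n" using nn by (metis mult.assoc)
  then have "(n * n) * (n * n) = 0" using mnn by simp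
  then have "norm ((n * n) * (n * n)) = 0" by simp
  then have "n = 0"
    using n by (simp add: norm_hermitian_square hermitian_intros)
  then have "h = m" by (simp add: n_def)
  then show ?thesis using m(1) by (simp add: h_def)
qed

section \<open>Gram matrices and positive functionals\<close>

text \<open>The sums of squares in the matrix algebra over \<open>A\<close>, each \<open>b\<close>
  being a single row. The list has no prescribed length, so addition is concatenation.\<close>

definition gram :: "'i set \<Rightarrow> ('i \<Rightarrow> 'i \<Rightarrow> 'a::cstar_algebra) \<Rightarrow> bool" where
  "gram I x \<longleftrightarrow> (\<exists>bs. \<forall>i\<in>I. \<forall>j\<in>I. x i j = (\<Sum>b\<leftarrow>bs. star (b i) * b j))"

lemma gram_cong:
  "(\<And>i j. i \<in> I \<Longrightarrow> j \<in> I \<Longrightarrow> x i j = y i j) \<Longrightarrow> gram I x \<longleftrightarrow> gram I y"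
  by (simp add: gram_def)

lemma gram_row: "gram I (\<lambda>i j. star (b i) * b j)"
  unfolding gram_def by (intro exI[of _ "[b]"]) simp

lemma gram_zero: "gram I (\<lambda>i j. 0)"
  unfolding gram_def by (intro exI[of _ "[]"]) simp

lemma gram_add:
  assumes "gram I x" "gram I y"
  shows "gram I (\<lambda>i j. x i j + y i j)"
proof -
  obtain bs cs where "\<forall>i\<in>I. \<forall>j\<in>I. x i j = (\<Sum>b\<leftarrow>bs. star (b i) * b j)"
    "\<forall>i\<in>I. \<forall>j\<in>I. y i j = (\<Sum>b\<leftarrow>cs. star (b i) * b j)"
    using assms unfolding gram_def by blast
  then show ?thesis unfolding gram_def by (intro exI[of _ "bs @ cs"]) simp
qed

lemma gram_sum:
  "(\<And>s. s \<in> S \<Longrightarrow> gram I (x s)) \<Longrightarrow> gram I (\<lambda>i j. \<Sum>s\<in>S. x s i j)"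
  by (induction S rule: infinite_finite_induct) (simp_all add: gram_zero gram_add)

lemma gram_scaleR:
  assumes "gram I x" "0 \<le> r"
  shows "gram I (\<lambda>i j. r *\<^sub>R x i j)"
proof -
  obtain bs where bs: "\<And>i j. i \<in> I \<Longrightarrow> j \<in> I \<Longrightarrow> x i j = (\<Sum>b\<leftarrow>bs. star (b i) * b j)"
    using assms unfolding gram_def by blast
  have "r *\<^sub>R (\<Sum>b\<leftarrow>bs. star (b i) * b j)
      = (\<Sum>b\<leftarrow>bs. star (sqrt r *\<^sub>R b i) * sqrt r *\<^sub>R b j)" for i j
    using \<open>0 \<le> r\<close> by (induction bs) (simp_all add: star_scaleR scaleR_add_right)
  then show ?thesis unfolding gram_def
    by (intro exI[of _ "map (\<lambda>b i. sqrt r *\<^sub>R b i) bs"]) (simp add: bs comp_def)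
qed

lemma gram_single:
  assumes "pos x"
  shows "gram I (\<lambda>i j. if i = k \<and> j = k then x else 0)"
proof -
  obtain z where "pos z" "z * z = x" using pos_sqrt[OF assms] by blast
  then have z: "x = star z * z" using pos_hermitian[of z] by (simp add: hermitian_def)
  show ?thesis
    using gram_row[of I "\<lambda>i. if i = k then z else 0"]
    by (rule gram_cong[THEN iffD1, rotated]) (auto simp: z)
qed

lemma gram_diagonal:
  assumes "finite I" and d: "\<And>k. k \<in> I \<Longrightarrow> pos (d k)"
  shows "gram I (\<lambda>i j. if i = j then d i else 0)"
proof -
  have "gram I (\<lambda>i j. \<Sum>k\<in>I. if i = k \<and> j = k then d k else 0)"
    by (intro gram_sum gram_single d)
  moreover have "(\<Sum>k\<in>I. if i = k \<and> j = k then d k else 0) = (if i = j then d i else 0)"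
    if "i \<in> I" for i j
  proof -
    have "(\<Sum>k\<in>I. if i = k \<and> j = k then d k else 0)
        = (\<Sum>k\<in>I. if i = k then (if j = k then d k else 0) else 0)"
      by (intro sum.cong) auto
    then show ?thesis using that \<open>finite I\<close> by (simp add: sum.delta)
  qed
  ultimately show ?thesis by (subst gram_cong) auto
qed

text \<open>This is where \<open>pos_star_mult_self\<close> enters: it ties sums of squares to the
  order defined through the norm.\<close>

lemma gram_pos:
  fixes x :: "'i \<Rightarrow> 'i \<Rightarrow> 'a::cstar_algebra"
  assumes "gram I x" "i \<in> I"
  shows "pos (x i i)"
proof -
  have "pos (0::'a)" by (auto simp: pos_def intro: exI[of _ 0])
  then have "pos (\<Sum>b\<leftarrow>bs. star (b i) * b i)" for bs :: "('i \<Rightarrow> 'a) list"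
    by (induction bs) (auto intro: pos_add pos_star_mult_self)
  then show ?thesis using assms by (auto simp: gram_def)
qed

text \<open>The off-diagonal entry \<open>y = x k l\<close> and its adjoint are dominated by the row with entry 1
  at \<open>k\<close> and entry \<open>y\<close> at \<open>l\<close>, whose diagonal terms \<open>1\<close> and \<open>y\<^sup>* y\<close> are bounded.\<close>

lemma gram_archimedean:
  fixes x :: "'i \<Rightarrow> 'i \<Rightarrow> 'a::cstar_algebra"
  assumes fin: "finite I"
  shows "\<exists>t\<ge>0. gram I (\<lambda>i j. (if i = j then of_real t else 0) + (x i j + star (x j i)))"
proof -
  define s where "s k l = norm (star (x k l) * x k l)" for k l
  \<comment> \<open>Written as a sum so that for \<open>k = l\<close> the row has the entry
    \<open>1 + x k k\<close> and no case distinction arises.\<close>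
  define b where "b k l i = (if i = k then 1 else 0) + (if i = l then x k l else 0)" for k l i
  define T where "T k l = (\<lambda>i j. star (b k l i) * b k l j
      + (if i = l \<and> j = l then of_real (s k l) - star (x k l) * x k l else 0))" for k l
  \<comment> \<open>In the sum of all \<open>T k l\<close> the diagonal entry at \<open>i\<close>
    collects \<open>card I\<close> ones, from \<open>k = i\<close>, and the terms
    \<open>s k i\<close>; \<open>t\<close> dominates every \<open>u i\<close>.\<close>
  define u where "u i = real (card I) + (\<Sum>k\<in>I. s k i)" for i
  define t where "t = (\<Sum>i\<in>I. u i)"
  have "s k l \<ge> 0" for k l by (simp add: s_def)
  then have u0: "u i \<ge> 0" for i by (simp add: u_def sum_nonneg)
  have "gram I (T k l)" for k l unfolding T_def
    by (rule gram_add[OF gram_row gram_single[OF pos_of_real_diff]])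
      (simp_all add: s_def hermitian_intros)
  then have "gram I (\<lambda>i j. \<Sum>k\<in>I. \<Sum>l\<in>I. T k l i j)"
    by (intro gram_sum)
  moreover have "gram I (\<lambda>i j. if i = j then of_real t - of_real (u i) else (0::'a))"
  proof (rule gram_diagonal[OF fin])
    fix k assume "k \<in> I"
    then have "u k \<le> t" unfolding t_def using fin u0 by (intro member_le_sum) auto
    then show "pos (of_real t - of_real (u k) :: 'a)"
      using u0[of k] by (intro pos_of_real_diff) auto
  qed
  ultimately have g: "gram I (\<lambda>i j. (\<Sum>k\<in>I. \<Sum>l\<in>I. T k l i j)
      + (if i = j then of_real t - of_real (u i) else 0))" (is "gram I ?L") by (rule gram_add)
  have T: "T k l i j = (if i = k then (if j = k then 1 else 0) else 0)
      + (if i = k then (if j = l then x k l else 0) else 0)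
      + (if j = k then (if i = l then star (x k l) else 0) else 0)
      + (if i = l then (if j = l then of_real (s k l) else 0) else 0)" for k l i j
    unfolding T_def b_def by (simp add: star_add star_star algebra_simps)
  have "(\<Sum>k\<in>I. \<Sum>l\<in>I. T k l i j) = (if i = j then of_real (u i) else 0)
      + (x i j + star (x j i))" if I: "i \<in> I" "j \<in> I" for i j
  proof -
    have 1: "(\<Sum>k\<in>I. \<Sum>l\<in>I. if i = k then (if j = k then 1 else 0) else (0::'a))
        = (if i = j then of_nat (card I) else 0)"
      using fin I by (subst sum.swap) simp
    have 2: "(\<Sum>k\<in>I. \<Sum>l\<in>I. if i = k then (if j = l then x k l else 0) else 0) = x i j"
      using fin I by (subst sum.swap) simp
    have 3: "(\<Sum>k\<in>I. \<Sum>l\<in>I. if j = k then (if i = l then star (x k l) else 0) else 0)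
        = star (x j i)"
      using fin I by (subst sum.swap) simp
    have 4: "(\<Sum>k\<in>I. \<Sum>l\<in>I. if i = l then (if j = l then of_real (s k l) else 0) else (0::'a))
        = (if i = j then of_real (\<Sum>k\<in>I. s k i) else 0)"
      using fin I by simp
    show ?thesis unfolding T sum.distrib 1 2 3 4 by (simp add: u_def)
  qed
  then have "?L i j = (if i = j then of_real t else 0) + (x i j + star (x j i))"
    if "i \<in> I" "j \<in> I" for i j using that by simp
  then have "gram I (\<lambda>i j. (if i = j then of_real t else 0) + (x i j + star (x j i)))"
    using g by (subst gram_cong[where y = ?L]) auto
  moreover have "t \<ge> 0" using u0 by (simp add: t_def sum_nonneg)
  ultimately show ?thesis by blast
qed


text \<open>A cone containing \<open>K\<close> and \<open>- h\<close> that is maximal among those avoiding \<open>- e\<close> contains \<open>v\<close>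
  or \<open>- v\<close> for every \<open>v\<close>, so it determines a linear functional by a Dedekind cut along \<open>e\<close>.\<close>

lemma cone_separation:
  fixes K :: "'v::complex_vector set" and e h :: 'v
  assumes add: "\<And>x y. x \<in> K \<Longrightarrow> y \<in> K \<Longrightarrow> x + y \<in> K"
    and scale: "\<And>x r. x \<in> K \<Longrightarrow> 0 \<le> r \<Longrightarrow> complex_of_real r *\<^sub>C x \<in> K"
    and unit: "\<And>x. \<exists>t\<ge>0. complex_of_real t *\<^sub>C e + x \<in> K"
    and h: "h \<notin> K"
  obtains f :: "'v \<Rightarrow> real"
  where "\<And>x y. f (x + y) = f x + f y" "\<And>r x. f (complex_of_real r *\<^sub>C x) = r * f x"
    "\<And>x. x \<in> K \<Longrightarrow> 0 \<le> f x" "f e = 1" "f h \<le> 0"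
proof -
  define s where "s r x = complex_of_real r *\<^sub>C x" for r and x :: 'v
  have s_add: "s r (x + y) = s r x + s r y" "s (a + b) x = s a x + s b x"
    and s_s: "s a (s b x) = s (a * b) x" and s_1: "s 1 x = x" and s_0: "s 0 x = 0"
    and s_m: "s r (- x) = - s r x" "s (- r) x = - s r x" and s_d: "s (a - b) x = s a x - s b x"
    and s_d': "s r (x - y) = s r x - s r y"
    for r a b and x y :: 'v
    by (simp_all add: s_def scaleC_add_right scaleC_add_left scaleC_scaleC scaleC_one
        cvec.scale_left_diff_distrib cvec.scale_right_diff_distrib)
  define cone where "cone C \<longleftrightarrow> (\<forall>x\<in>C. \<forall>y\<in>C. x + y \<in> C) \<and> (\<forall>r\<ge>0. \<forall>x\<in>C. s r x \<in> C)" for C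
  have coneK: "cone K" using add scale by (auto simp: cone_def s_def)
  define adjoin where "adjoin M v = {m + s r v | m r. m \<in> M \<and> 0 \<le> r}" for M v
  have adj: "cone (adjoin M v)" if "cone M" for M v
    unfolding cone_def
  proof (intro conjI ballI allI impI)
    fix x y assume "x \<in> adjoin M v" "y \<in> adjoin M v"
    then obtain m r m' r' where "x = m + s r v" "y = m' + s r' v" "m \<in> M" "m' \<in> M" "0 \<le> r" "0 \<le> r'"
      by (auto simp: adjoin_def)
    then show "x + y \<in> adjoin M v"
      unfolding adjoin_def using that by (intro CollectI exI[of _ "m + m'"] exI[of _ "r + r'"]) (auto simp: cone_def s_add)
  next
    fix a :: real and x assume "0 \<le> a" "x \<in> adjoin M v"
    then obtain m r where "x = m + s r v" "m \<in> M" "0 \<le> r" by (auto simp: adjoin_def)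
    then show "s a x \<in> adjoin M v"
      unfolding adjoin_def using that \<open>0 \<le> a\<close> by (intro CollectI exI[of _ "s a m"] exI[of _ "a * r"]) (auto simp: cone_def s_add s_s)
  qed
  obtain t0 where "0 \<le> t0" "s t0 e + e \<in> K" using unit[of e] by (auto simp: s_def)
  then have "s (t0 + 1) e \<in> K" by (simp add: s_add s_1)
  from scale[OF this, of "1 / (t0 + 1)"] \<open>0 \<le> t0\<close> have "s (1 / (t0 + 1)) (s (t0 + 1) e) \<in> K"
    by (simp only: s_def) simp
  then have eK: "e \<in> K" using \<open>0 \<le> t0\<close> by (simp add: s_s s_1)
  then have zK: "0 \<in> K" using coneK s_0[of e] unfolding cone_def by (metis order_refl)
  \<comment> \<open>As \<open>e\<close> is an order unit, \<open>- e\<close> in \<open>K\<close>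
    would put every vector into \<open>K\<close>, in particular \<open>h\<close>.\<close>
  have "- e \<notin> K"
  proof
    assume "- e \<in> K"
    obtain t where "0 \<le> t" "s t e + h \<in> K" using unit[of h] by (auto simp: s_def)
    moreover have "s t (- e) \<in> K" using \<open>- e \<in> K\<close> \<open>0 \<le> t\<close> coneK by (simp add: cone_def)
    ultimately have "(s t e + h) + s t (- e) \<in> K" using add by blast
    then show False using h by (simp add: s_m)
  qed
  define K0 where "K0 = adjoin K (- h)"
  define \<C> where "\<C> = {C. K0 \<subseteq> C \<and> cone C \<and> - e \<notin> C}"
  have "- e \<notin> K0"
  proof
    assume "- e \<in> K0"
    then obtain k r where k: "- e = k + s r (- h)" "k \<in> K" "0 \<le> r" by (auto simp: K0_def adjoin_def)
    show False
    proof (cases "r = 0")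
      case True
      then show False using k \<open>- e \<notin> K\<close> by (simp add: s_0)
    next
      case False
      have "s r h = k + e" using k(1) by (simp add: s_m algebra_simps)
      then have "s (1/r) (s r h) \<in> K" using k eK coneK by (simp add: cone_def)
      then show False using False h by (simp add: s_s s_1)
    qed
  qed
  moreover have "cone K0" unfolding K0_def by (rule adj[OF coneK])
  ultimately have K0: "K0 \<in> \<C>" by (simp add: \<C>_def)
  have "\<exists>M\<in>\<C>. \<forall>X\<in>\<C>. M \<subseteq> X \<longrightarrow> X = M"
  proof (rule subset_Zorn_nonempty)
    show "\<C> \<noteq> {}" using K0 by blast
    fix S assume S: "S \<noteq> {}" "subset.chain \<C> S"
    have sub: "S \<subseteq> \<C>" and ch: "\<And>A B. A \<in> S \<Longrightarrow> B \<in> S \<Longrightarrow> A \<subseteq> B \<or> B \<subseteq> A"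
      using S(2) by (auto simp: subset.chain_def)
    have "cone (\<Union>S)"
      unfolding cone_def
    proof (intro conjI ballI allI impI)
      fix x y assume "x \<in> \<Union>S" "y \<in> \<Union>S"
      then obtain A B where AB: "A \<in> S" "B \<in> S" "x \<in> A" "y \<in> B" by blast
      then obtain C where "C \<in> S" "x \<in> C" "y \<in> C" using ch[of A B] by blast
      then have "x + y \<in> C" using sub by (auto simp: \<C>_def cone_def)
      then show "x + y \<in> \<Union>S" using \<open>C \<in> S\<close> by blast
    next
      fix r :: real and x assume "0 \<le> r" "x \<in> \<Union>S"
      then obtain C where "C \<in> S" "x \<in> C" by blast
      then have "s r x \<in> C" using sub \<open>0 \<le> r\<close> by (auto simp: \<C>_def cone_def)
      then show "s r x \<in> \<Union>S" using \<open>C \<in> S\<close> by blast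
    qed
    then show "\<Union>S \<in> \<C>" using S(1) sub by (fastforce simp: \<C>_def)
  qed
  then obtain M where M: "K0 \<subseteq> M" "cone M" "- e \<notin> M" and max: "\<And>X. X \<in> \<C> \<Longrightarrow> M \<subseteq> X \<Longrightarrow> X = M"
    by (auto simp: \<C>_def)
  have M_add: "x + y \<in> M" if "x \<in> M" "y \<in> M" for x y using M(2) that by (simp add: cone_def)
  have M_s: "s r x \<in> M" if "x \<in> M" "0 \<le> r" for x r using M(2) that by (simp add: cone_def)
  have KM: "K \<subseteq> M"
  proof
    fix x assume "x \<in> K"
    then have "x + s 0 (- h) \<in> K0" unfolding K0_def adjoin_def by blast
    then show "x \<in> M" using M(1) by (auto simp: s_0)
  qed
  have "0 + s 1 (- h) \<in> K0" unfolding K0_def adjoin_def using zK by (intro CollectI exI[of _ 0] exI[of _ 1]) auto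
  then have hM: "- h \<in> M" using M(1) by (auto simp: s_1)
  \<comment> \<open>By maximality, adjoining \<open>v\<close> to \<open>M\<close> produces
    \<open>- e = m + r v\<close> with \<open>r > 0\<close>, so \<open>- v\<close> is a positive
    multiple of \<open>m + e\<close>.\<close>
  have dich: "- v \<in> M" if "v \<notin> M" for v
  proof -
    define X where "X = adjoin M v"
    have "M \<subseteq> X"
    proof
      fix m assume "m \<in> M"
      then have "m + s 0 v \<in> X" unfolding X_def adjoin_def by blast
      then show "m \<in> X" by (simp add: s_0)
    qed
    have "0 + s 1 v \<in> X" unfolding X_def adjoin_def using zK KM by (intro CollectI exI[of _ 0] exI[of _ 1]) auto
    then have "X \<noteq> M" using that by (auto simp: s_1)
    then have "X \<notin> \<C>" using max \<open>M \<subseteq> X\<close> by blast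
    then have "- e \<in> X" using \<open>M \<subseteq> X\<close> M(1) adj[OF M(2)] by (auto simp: \<C>_def X_def)
    then obtain m r where mr: "- e = m + s r v" "m \<in> M" "0 \<le> r" by (auto simp: X_def adjoin_def)
    then have "r \<noteq> 0" using M(3) by (auto simp: s_0)
    have "s r (- v) = m + e" using mr(1) by (simp add: s_m eq_neg_iff_add_eq_0 algebra_simps neg_eq_iff_add_eq_0)
    moreover have "m + e \<in> M" using mr eK KM by (auto intro: M_add)
    ultimately have "s (1/r) (s r (- v)) \<in> M" using mr(3) by (simp add: M_s)
    then show ?thesis using \<open>r \<noteq> 0\<close> by (simp add: s_s s_1)
  qed
  have neg: "\<not> (r < 0 \<and> s r e \<in> M)" for r
  proof
    assume r: "r < 0 \<and> s r e \<in> M"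
    then have "s (1 / (- r)) (s r e) \<in> M" using M_s[of "s r e" "1 / (- r)"] by simp
    then show False using r M(3) by (simp add: s_s s_m s_1)
  qed
  define L where "L v = {t. v - s t e \<in> M}" for v
  define f where "f v = Sup (L v)" for v
  have ub: "\<exists>B. \<forall>t\<in>L v. t \<le> B" for v
  proof -
    obtain B where B: "s B e + (- v) \<in> K" using unit[of "- v"] by (auto simp: s_def)
    have "t \<le> B" if "t \<in> L v" for t
    proof (rule ccontr)
      assume "\<not> t \<le> B"
      have "(s B e + (- v)) + (v - s t e) \<in> M" using B KM that by (intro M_add[of "s B e + (- v)"]) (auto simp: L_def)
      then have "s (B - t) e \<in> M" by (simp add: s_d algebra_simps)
      then show False using neg[of "B - t"] \<open>\<not> t \<le> B\<close> by simp
    qed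
    then show ?thesis by blast
  qed
  have ne: "L v \<noteq> {}" for v
  proof -
    obtain B where B: "s B e + v \<in> K" using unit[of v] by (auto simp: s_def)
    then have "- B \<in> L v" using KM by (auto simp: L_def s_m add.commute)
    then show ?thesis by blast
  qed
  have bdd: "bdd_above (L v)" for v using ub by (auto simp: bdd_above_def)
  have lo: "v - s t e \<in> M" if t: "t < f v" for t v
  proof -
    obtain t' where t': "t' \<in> L v" "t < t'"
      using t less_cSup_iff[OF ne bdd, of t v] unfolding f_def by blast
    have "s (t' - t) e \<in> M" by (rule M_s) (use t' eK KM in auto)
    with t' have "(v - s t' e) + s (t' - t) e \<in> M" by (intro M_add) (simp_all add: L_def)
    then show ?thesis by (simp add: s_d)
  qed
  have hi: "s t e - v \<in> M" if "f v < t" for t v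
  proof -
    have "t \<notin> L v" using that cSup_upper[OF _ bdd, of t v] unfolding f_def by auto
    then have "- (v - s t e) \<in> M" by (intro dich) (simp add: L_def)
    then show ?thesis by simp
  qed
  \<comment> \<open>A gap between \<open>f v\<close> and \<open>t\<close> would put a negative
    multiple of \<open>e\<close> into \<open>M\<close>. Additivity and homogeneity are then checked
    on the two sides of the cut.\<close>
  have uniq: "f v = t"
    if l: "\<And>t'. t' < t \<Longrightarrow> v - s t' e \<in> M" and u: "\<And>t'. t < t' \<Longrightarrow> s t' e - v \<in> M" for v t
  proof (rule ccontr)
    assume "f v \<noteq> t"
    then consider "f v < t" | "t < f v" by linarith
    then show False
    proof cases
      case 1
      then obtain a b where ab: "f v < a" "a < b" "b < t" by (meson dense)
      have "(s a e - v) + (v - s b e) \<in> M" using hi[OF ab(1)] l[OF ab(3)] by (rule M_add)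
      then have "s (a - b) e \<in> M" by (simp add: s_d)
      then show False using neg[of "a - b"] ab by simp
    next
      case 2
      then obtain a b where ab: "t < a" "a < b" "b < f v" by (meson dense)
      have "(s a e - v) + (v - s b e) \<in> M" using u[OF ab(1)] lo[OF ab(3)] by (rule M_add)
      then have "s (a - b) e \<in> M" by (simp add: s_d)
      then show False using neg[of "a - b"] ab by simp
    qed
  qed
  have f_add: "f (v + w) = f v + f w" for v w
  proof (rule uniq)
    fix t' assume t': "t' < f v + f w"
    define d where "d = (f v + f w - t') / 2"
    have d: "d > 0" "t' = (f v - d) + (f w - d)" using t' by (simp_all add: d_def field_simps)
    have "(v - s (f v - d) e) + (w - s (f w - d) e) \<in> M" using d by (intro M_add lo) auto
    moreover have "(v - s (f v - d) e) + (w - s (f w - d) e) = v + w - s t' e"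
      unfolding d(2) s_add(2) by (simp add: algebra_simps)
    ultimately show "v + w - s t' e \<in> M" by simp
  next
    fix t' assume t': "f v + f w < t'"
    define d where "d = (t' - f v - f w) / 2"
    have d: "d > 0" "t' = (f v + d) + (f w + d)" using t' by (simp_all add: d_def field_simps)
    have "(s (f v + d) e - v) + (s (f w + d) e - w) \<in> M" using d by (intro M_add hi) auto
    moreover have "(s (f v + d) e - v) + (s (f w + d) e - w) = s t' e - (v + w)"
      unfolding d(2) s_add(2) by (simp add: algebra_simps)
    ultimately show "s t' e - (v + w) \<in> M" by simp
  qed
  have f_0: "f 0 = 0" using f_add[of 0 0] by simp
  have f_neg: "f (- v) = - f v" for v using f_add[of v "- v"] f_0 by simp
  have f_pos_scale: "f (s r v) = r * f v" if "r > 0" for r v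
  proof (rule uniq)
    fix t' assume "t' < r * f v"
    then have "t' / r < f v" using that by (simp add: field_simps)
    from M_s[OF lo[OF this], of r] that show "s r v - s t' e \<in> M" by (simp add: s_d' s_s)
  next
    fix t' assume "r * f v < t'"
    then have "f v < t' / r" using that by (simp add: field_simps)
    from M_s[OF hi[OF this], of r] that show "s t' e - s r v \<in> M" by (simp add: s_d' s_s)
  qed
  have f_scale: "f (s r v) = r * f v" for r v
  proof -
    consider "r > 0" | "r = 0" | "r < 0" by linarith
    then show ?thesis
    proof cases
      case 3
      then have "f (s (- r) v) = - r * f v" by (intro f_pos_scale) simp
      then show ?thesis by (simp add: s_m f_neg)
    qed (simp_all add: f_pos_scale s_0 f_0)
  qed
  have f_nonneg: "0 \<le> f v" if "v \<in> M" for v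
    unfolding f_def by (rule cSup_upper[OF _ bdd]) (simp add: L_def s_0 that)
  show ?thesis
  proof (rule that[of f])
    show "f (complex_of_real r *\<^sub>C x) = r * f x" for r x using f_scale by (simp add: s_def)
    show "f e = 1"
    proof (rule uniq)
      fix t' :: real assume "t' < 1"
      then have "s (1 - t') e \<in> M" using eK KM by (intro M_s) auto
      then show "e - s t' e \<in> M" by (simp add: s_d s_1)
    next
      fix t' :: real assume "1 < t'"
      then have "s (t' - 1) e \<in> M" using eK KM by (intro M_s) auto
      then show "s t' e - e \<in> M" by (simp add: s_d s_1)
    qed
    \<comment> \<open>The inequality is weak because \<open>K\<close> may fail to be closed; a later
      shift by a multiple of \<open>e\<close> makes it strict.\<close>
    show "f h \<le> 0" using f_nonneg[OF hM] f_neg[of h] by simp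
  qed (use f_add f_nonneg KM in auto)
qed


section \<open>From separation of cones to positive functionals on matrices\<close>

lemma fun_sum_apply: "(\<Sum>s\<in>S. f s) x = (\<Sum>s\<in>S. f s x)"
  by (induction S rule: infinite_finite_induct) simp_all

lemma cmat_apply:
  fixes x y :: "'i \<Rightarrow> 'i \<Rightarrow> 'a::cstar_algebra"
  shows "(x + y) i j = x i j + y i j" "(c *\<^sub>C x) i j = c *\<^sub>C x i j"
    "(- x) i j = - x i j" "(x - y) i j = x i j - y i j" "(0 :: 'i \<Rightarrow> 'i \<Rightarrow> 'a) i j = 0"
  by (simp_all add: scaleC_fun_def)

text \<open>Membership in \<open>K\<close> depends only on \<open>x + adj x\<close> over
  \<open>I\<close>, so the separating real functional \<open>f\<close> vanishes on anti-hermitian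
  matrices and off \<open>I\<close>. Its complexification \<open>F x = f x - \<i> f (\<i> x)\<close>
  is therefore hermitian and supported on \<open>I\<close>.\<close>

lemma positive_functional_exists:
  fixes h :: "'i \<Rightarrow> 'i \<Rightarrow> 'a::cstar_algebra"
  assumes fin: "finite I" and h: "\<not> gram I (\<lambda>i j. h i j + star (h j i))"
  obtains F :: "('i \<Rightarrow> 'i \<Rightarrow> 'a) \<Rightarrow> complex"
  where "\<And>x y. F (x + y) = F x + F y" "\<And>c x. F (c *\<^sub>C x) = c * F x"
    "\<And>b. F (\<lambda>i j. star (b i) * b j) \<in> \<real>\<^sub>\<ge>\<^sub>0"
    "\<And>x. F (\<lambda>i j. star (x j i)) = cnj (F x)"
    "\<And>x. (\<And>i j. i \<in> I \<Longrightarrow> j \<in> I \<Longrightarrow> x i j = 0) \<Longrightarrow> F x = 0"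
    "F (\<lambda>i j. if i = j then 1 else 0) = 1" "Re (F h) \<le> 0"
proof -
  define adj where "adj x = (\<lambda>i j. star (x j i))" for x :: "'i \<Rightarrow> 'i \<Rightarrow> 'a"
  define K where "K = {x. gram I (\<lambda>i j. x i j + adj x i j)}"
  define e where "e = (\<lambda>i j :: 'i. if i = j then 1 else 0 :: 'a)"
  have "\<exists>f :: _ \<Rightarrow> real. (\<forall>x y. f (x + y) = f x + f y) \<and> (\<forall>r x. f (complex_of_real r *\<^sub>C x) = r * f x)
      \<and> (\<forall>x\<in>K. 0 \<le> f x) \<and> f e = 1 \<and> f h \<le> 0"
  proof (rule cone_separation[of K e h])
    fix x y assume "x \<in> K" "y \<in> K"
    then show "x + y \<in> K" unfolding K_def mem_Collect_eq
      by (rule gram_cong[THEN iffD1, OF _ gram_add, rotated]) (simp add: adj_def star_add)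
  next
    fix x :: "'i \<Rightarrow> 'i \<Rightarrow> 'a" and r :: real assume "x \<in> K" "0 \<le> r"
    then show "complex_of_real r *\<^sub>C x \<in> K" unfolding K_def mem_Collect_eq
      by (rule gram_cong[THEN iffD1, OF _ gram_scaleR, rotated])
        (simp add: adj_def scaleC_fun_def scaleC_of_real star_scaleR scaleR_add_right)
  next
    fix x :: "'i \<Rightarrow> 'i \<Rightarrow> 'a"
    obtain t where t: "0 \<le> t"
      "gram I (\<lambda>i j. (if i = j then of_real t else 0) + (x i j + star (x j i)))"
      using gram_archimedean[OF fin, of x] by blast
    have half: "complex_of_real (t/2) *\<^sub>C 1 = (of_real (t/2) :: 'a)"
      by (subst scaleC_of_real) (rule of_real_def[symmetric])
    have tt: "of_real t = of_real (t/2) + (of_real (t/2) :: 'a)"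
      by (simp only: of_real_add[symmetric]) simp
    have "complex_of_real (t/2) *\<^sub>C e + x \<in> K" unfolding K_def mem_Collect_eq
      by (rule gram_cong[THEN iffD1, OF _ t(2)])
        (auto simp: adj_def scaleC_fun_def star_add e_def half tt simp del: of_real_divide)
    then show "\<exists>t\<ge>0. complex_of_real t *\<^sub>C e + x \<in> K"
      using \<open>0 \<le> t\<close> by (intro exI[of _ "t/2"]) simp
  next
    show "h \<notin> K" using h by (simp add: K_def adj_def)
  qed blast
  then obtain f :: "_ \<Rightarrow> real" where
    f_add: "\<And>x y. f (x + y) = f x + f y" and f_scale: "\<And>r x. f (complex_of_real r *\<^sub>C x) = r * f x"
    and fK: "\<And>x. x \<in> K \<Longrightarrow> 0 \<le> f x" and fe: "f e = 1" and fh: "f h \<le> 0" by blast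
  have f_neg: "f (- x) = - f x" for x
    using f_scale[of "-1" x] by (simp add: scaleC_one)
  have f_diff: "f (x - y) = f x - f y" for x y
    using f_add[of x "- y"] by (simp add: f_neg)
  have f_anti: "f x = 0" if "\<And>i j. i \<in> I \<Longrightarrow> j \<in> I \<Longrightarrow> x i j + adj x i j = 0" for x
  proof -
    have "x \<in> K" unfolding K_def mem_Collect_eq
      by (rule gram_cong[THEN iffD1, OF _ gram_zero]) (simp add: that)
    moreover have "- x \<in> K" unfolding K_def mem_Collect_eq
    proof (rule gram_cong[THEN iffD1, OF _ gram_zero])
      fix i j assume "i \<in> I" "j \<in> I"
      from that[OF this] have "- (x i j + adj x i j) = 0" by simp
      then show "0 = (- x) i j + adj (- x) i j" by (simp add: adj_def star_minus)
    qed
    ultimately show ?thesis using fK[of x] fK[of "- x"] by (simp add: f_neg)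
  qed
  define F where "F x = Complex (f x) (- f (\<i> *\<^sub>C x))" for x
  have f_adj: "f (adj x) = f x" for x
    using f_anti[of "x - adj x"] by (simp add: f_diff adj_def star_diff star_star)
  have f_iadj: "f (\<i> *\<^sub>C adj x) = - f (\<i> *\<^sub>C x)" for x
    using f_anti[of "\<i> *\<^sub>C adj x + \<i> *\<^sub>C x"]
    by (simp add: f_add adj_def star_add star_star star_scaleC scaleC_fun_def)
  have f_c: "f (c *\<^sub>C x) = Re c * f x + Im c * f (\<i> *\<^sub>C x)" for c x
  proof -
    have "c *\<^sub>C x = complex_of_real (Re c) *\<^sub>C x + complex_of_real (Im c) *\<^sub>C (\<i> *\<^sub>C x)"
      by (simp add: scaleC_scaleC complex_eq mult.commute flip: scaleC_add_left)
    then show ?thesis by (simp only: f_add f_scale)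
  qed
  have f_ii: "f (\<i> *\<^sub>C (\<i> *\<^sub>C x)) = - f x" for x
    by (simp add: f_neg)
  show ?thesis
  proof (rule that[of F])
    show "F (x + y) = F x + F y" for x y
      by (simp add: F_def f_add scaleC_add_right complex_eq_iff)
    show "F (c *\<^sub>C x) = c * F x" for c x
    proof -
      have "f (\<i> *\<^sub>C c *\<^sub>C x) = Re c * f (\<i> *\<^sub>C x) - Im c * f x"
        using f_c[of "\<i> * c" x] by (simp add: scaleC_scaleC)
      then show ?thesis by (simp add: F_def complex_eq_iff f_c[of c x])
    qed
    show "F (\<lambda>i j. star (b i) * b j) \<in> \<real>\<^sub>\<ge>\<^sub>0" for b
    proof -
      let ?x = "\<lambda>i j. star (b i) * b j"
      have "?x \<in> K" unfolding K_def mem_Collect_eq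
        by (rule gram_cong[THEN iffD1, OF _ gram_scaleR[OF gram_row, of 2]])
          (simp_all add: adj_def star_mult star_star scaleR_2)
      moreover have "f (\<i> *\<^sub>C ?x) = 0"
        by (rule f_anti) (simp add: adj_def scaleC_fun_def star_scaleC star_mult star_star)
      ultimately show ?thesis using fK by (auto simp: F_def complex_nonneg_Reals_iff)
    qed
    show "F (\<lambda>i j. star (x j i)) = cnj (F x)" for x
      using f_adj[of x] f_iadj[of x] by (simp add: F_def complex_eq_iff adj_def)
    show "F x = 0" if "\<And>i j. i \<in> I \<Longrightarrow> j \<in> I \<Longrightarrow> x i j = 0" for x
      using that f_anti[of x] f_anti[of "\<i> *\<^sub>C x"]
      by (simp add: F_def complex_eq_iff adj_def scaleC_fun_def star_scaleC)
    have "f (\<i> *\<^sub>C e) = 0"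
      by (rule f_anti) (simp add: adj_def scaleC_fun_def star_scaleC e_def)
    then show "F (\<lambda>i j. if i = j then 1 else 0) = 1"
      using fe by (simp add: F_def complex_eq_iff e_def)
    show "Re (F h) \<le> 0" using fh by (simp add: F_def)
  qed
qed

section \<open>Detecting positivity by unital completely positive maps\<close>

lemma nonneg_Reals_sum: "(\<And>s. s \<in> S \<Longrightarrow> f s \<in> \<real>\<^sub>\<ge>\<^sub>0) \<Longrightarrow> sum f S \<in> (\<real>\<^sub>\<ge>\<^sub>0 :: complex set)"
  by (induction S rule: infinite_finite_induct) auto

text \<open>\<open>S\<close> is conjugate linear in the first argument. The \<open>v k\<close> are
  orthonormal for it, and \<open>G k i\<close> is the coefficient of \<open>v k\<close> in the
  standard basis vector at \<open>i\<close>. This serves both the form induced by a functional and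
  that of a definite scalar matrix.\<close>

lemma gram_schmidt:
  fixes S :: "('i \<Rightarrow> complex) \<Rightarrow> ('i \<Rightarrow> complex) \<Rightarrow> complex"
  assumes fin: "finite I"
    and add: "\<And>x y z. S (\<lambda>i. x i + y i) z = S x z + S y z"
    and scale: "\<And>c x z. S (\<lambda>i. c * x i) z = cnj c * S x z"
    and herm: "\<And>x y. S y x = cnj (S x y)"
    and pos: "\<And>x. x \<noteq> (\<lambda>_. 0) \<Longrightarrow> (\<And>i. i \<notin> I \<Longrightarrow> x i = 0) \<Longrightarrow> 0 < Re (S x x)"
  obtains N :: nat and v G
  where "\<And>k l. k < N \<Longrightarrow> l < N \<Longrightarrow> S (v k) (v l) = (if k = l then 1 else 0)"
    "\<And>i j. i \<in> I \<Longrightarrow> (\<Sum>k<N. G k i * v k j) = (if i = j then 1 else 0)"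
proof -
  have sum: "S (\<lambda>i. \<Sum>k<(N::nat). c k * v k i) z = (\<Sum>k<N. cnj (c k) * S (v k) z)" for N c v z
  proof (induction N)
    case 0
    show ?case using scale[of 0 "\<lambda>_. 0" z] by simp
  next
    case (Suc N)
    have "S (\<lambda>i. (\<Sum>k<N. c k * v k i) + c N * v N i) z = (\<Sum>k<N. cnj (c k) * S (v k) z) + cnj (c N) * S (v N) z"
      by (simp only: add scale Suc)
    then show ?case by simp
  qed
  have diff: "S (\<lambda>i. x i - y i) z = S x z - S y z" for x y z
    using add[of x "\<lambda>i. (-1) * y i" z] scale[of "-1" y z] by simp
  have "\<exists>(N::nat) v G. (\<forall>k<N. \<forall>l<N. S (v k) (v l) = (if k = l then 1 else 0))
      \<and> (\<forall>k<N. \<forall>i. i \<notin> I \<longrightarrow> v k i = 0)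
      \<and> (\<forall>i\<in>I. \<forall>j. (\<Sum>k<N. G k i * v k j) = (if i = j then 1 else 0))"
    using fin pos
  proof (induction I rule: finite_induct)
    case empty
    show ?case by (intro exI[of _ 0]) simp
  next
    case (insert z I)
    have "\<exists>(N::nat) v G. (\<forall>k<N. \<forall>l<N. S (v k) (v l) = (if k = l then 1 else 0))
      \<and> (\<forall>k<N. \<forall>i. i \<notin> I \<longrightarrow> v k i = 0)
      \<and> (\<forall>i\<in>I. \<forall>j. (\<Sum>k<N. G k i * v k j) = (if i = j then 1 else 0))"
    proof (rule insert.IH)
      show "0 < Re (S x x)" if "x \<noteq> (\<lambda>_. 0)" "\<And>i. i \<notin> I \<Longrightarrow> x i = 0" for x
        by (rule insert.prems[OF that(1)], rule that(2)) simp
    qed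
    then obtain N :: nat and v G where
      orth: "\<And>k l. k < N \<Longrightarrow> l < N \<Longrightarrow> S (v k) (v l) = (if k = l then 1 else 0)"
      and supp: "\<And>k i. k < N \<Longrightarrow> i \<notin> I \<Longrightarrow> v k i = 0"
      and G: "\<And>i j. i \<in> I \<Longrightarrow> (\<Sum>k<N. G k i * v k j) = (if i = j then 1 else 0)"
      by blast
    define ez :: "'i \<Rightarrow> complex" where "ez i = (if i = z then 1 else 0)" for i
    define c where "c k = S (v k) ez" for k
    \<comment> \<open>The part of the basis vector at \<open>z\<close> orthogonal to the earlier
      \<open>v k\<close>. These vanish at \<open>z\<close>, so \<open>w z = 1\<close> and
      \<open>w\<close> is nonzero.\<close>
    define w where "w = (\<lambda>i. ez i - (\<Sum>k<N. c k * v k i))"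
    have orth_w: "S w (v j) = 0" if "j < N" for j
    proof -
      have "S w (v j) = S ez (v j) - (\<Sum>k<N. cnj (c k) * S (v k) (v j))"
        unfolding w_def by (simp only: diff sum)
      also have "(\<Sum>k<N. cnj (c k) * S (v k) (v j)) = (\<Sum>k<N. if k = j then cnj (c k) else 0)"
        using that by (intro sum.cong) (auto simp: orth)
      also have "\<dots> = cnj (c j)" using that by simp
      finally show ?thesis using herm[of ez "v j"] by (simp add: c_def)
    qed
    have wz: "w z = 1" using supp insert.hyps by (simp add: w_def ez_def)
    define s where "s = Re (S w w)"
    have "s > 0" unfolding s_def
    proof (rule insert.prems)
      show "w \<noteq> (\<lambda>_. 0)" using wz by force
      show "w i = 0" if "i \<notin> insert z I" for i using that supp by (simp add: w_def ez_def)
    qed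
    have ww: "S w w = of_real s" using herm[of w w] by (simp add: s_def complex_eq_iff)
    define r where "r = complex_of_real (sqrt s)"
    have r: "r \<noteq> 0" "cnj r = r" "r * r = of_real s"
      using \<open>s > 0\<close> by (simp_all add: r_def flip: of_real_mult)
    define v' where "v' k = (if k < N then v k else (\<lambda>i. inverse r * w i))" for k
    define G' where "G' k i = (if i = z then (if k < N then c k else r) else (if k < N then G k i else 0))" for k i
    have scale': "S x (\<lambda>i. a * y i) = a * S x y" for a x y
    proof -
      have "S x (\<lambda>i. a * y i) = cnj (S (\<lambda>i. a * y i) x)" by (rule herm)
      also have "\<dots> = a * cnj (S y x)" by (simp add: scale)
      also have "cnj (S y x) = S x y" by (rule herm[symmetric])
      finally show ?thesis .
    qed
    have orth_w': "S (v j) w = 0" if "j < N" for j using orth_w[OF that] herm[of "v j" w] by simp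
    show ?case
    proof (intro exI conjI allI impI ballI)
      fix k l assume kl: "k < Suc N" "l < Suc N"
      have last: "v' N = (\<lambda>i. inverse r * w i)" by (simp add: v'_def)
      have "S (v' N) (v' N) = inverse r * (inverse r * (r * r))"
        unfolding last scale scale' ww r(3) by (simp add: r(2))
      also have "\<dots> = 1" using r(1) by (simp add: field_simps)
      finally have NN: "S (v' N) (v' N) = 1" .
      have Nk: "S (v' N) (v' j) = 0" "S (v' j) (v' N) = 0" if "j < N" for j
        unfolding last scale scale' using that by (simp_all add: v'_def orth_w orth_w')
      from kl consider "k < N" "l < N" | "k = N" "l < N" | "k < N" "l = N" | "k = N" "l = N"
        by linarith
      then show "S (v' k) (v' l) = (if k = l then 1 else 0)"
        by cases (simp_all add: NN Nk, simp add: v'_def orth)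
    next
      fix k i assume "k < Suc N" "i \<notin> insert z I"
      then show "v' k i = 0" using supp by (auto simp: v'_def w_def ez_def)
    next
      fix i j assume "i \<in> insert z I"
      then show "(\<Sum>k<Suc N. G' k i * v' k j) = (if i = j then 1 else 0)"
        using G[of i j] r(1) insert.hyps by (auto simp: G'_def v'_def w_def ez_def simp flip: mult.assoc)
    qed
  qed
  then obtain N :: nat and v G where
    "\<forall>k<N. \<forall>l<N. S (v k) (v l) = (if k = l then 1 else 0)"
    "\<forall>i\<in>I. \<forall>j. (\<Sum>k<N. G k i * v k j) = (if i = j then 1 else 0)"
    by blast
  then show thesis by (intro that[of N v G]) simp_all
qed

text \<open>This is \<open>F\<close>, viewed as a functional on \<open>M\<^sub>I(A)\<close>, compressed to the vectors \<open>v 0, \<dots>, v (N-1)\<close>,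
  which are orthonormal for the form that \<open>F\<close> induces on scalar vectors.\<close>

lemma compression_ucp:
  fixes F :: "('i \<Rightarrow> 'i \<Rightarrow> 'a::cstar_algebra) \<Rightarrow> complex" and v :: "nat \<Rightarrow> 'i \<Rightarrow> complex"
  assumes F_add: "\<And>x y. F (x + y) = F x + F y" and F_scale: "\<And>c x. F (c *\<^sub>C x) = c * F x"
    and F_pos: "\<And>b. F (\<lambda>\<alpha> \<beta>. star (b \<alpha>) * b \<beta>) \<in> \<real>\<^sub>\<ge>\<^sub>0"
    and orth: "\<And>k l. k < N \<Longrightarrow> l < N \<Longrightarrow>
      F (\<lambda>\<alpha> \<beta>. (cnj (v k \<alpha>) * v l \<beta>) *\<^sub>C 1) = (if k = l then 1 else 0)"
  shows "ucp cstar_opsys (matrix_opsys N)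
    (\<lambda>a k l. if k < N \<and> l < N then F (\<lambda>\<alpha> \<beta>. (cnj (v k \<alpha>) * v l \<beta>) *\<^sub>C a) else 0)"
    (is "ucp _ _ ?\<psi>")
proof -
  have F_sum: "F (\<lambda>\<alpha> \<beta>. \<Sum>s\<in>A. x s \<alpha> \<beta>) = (\<Sum>s\<in>A. F (x s))" for A :: "'s set" and x
  proof -
    have "(\<lambda>\<alpha> \<beta>. \<Sum>s\<in>A. x s \<alpha> \<beta>) = (\<Sum>s\<in>A. x s)" by (simp add: fun_eq_iff fun_sum_apply)
    then show ?thesis using additive.sum[OF additive.intro[of F, OF F_add]] by (simp only:)
  qed
  have F_add': "F (\<lambda>\<alpha> \<beta>. g \<alpha> \<beta> *\<^sub>C (a + b)) = F (\<lambda>\<alpha> \<beta>. g \<alpha> \<beta> *\<^sub>C a) + F (\<lambda>\<alpha> \<beta>. g \<alpha> \<beta> *\<^sub>C b)" for g a b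
  proof -
    have "(\<lambda>\<alpha> \<beta>. g \<alpha> \<beta> *\<^sub>C (a + b)) = (\<lambda>\<alpha> \<beta>. g \<alpha> \<beta> *\<^sub>C a) + (\<lambda>\<alpha> \<beta>. g \<alpha> \<beta> *\<^sub>C b)"
      by (simp add: fun_eq_iff scaleC_add_right)
    then show ?thesis by (simp only: F_add)
  qed
  have F_scale': "F (\<lambda>\<alpha> \<beta>. g \<alpha> \<beta> *\<^sub>C c *\<^sub>C a) = c * F (\<lambda>\<alpha> \<beta>. g \<alpha> \<beta> *\<^sub>C a)" for g c a
  proof -
    have "(\<lambda>\<alpha> \<beta>. g \<alpha> \<beta> *\<^sub>C c *\<^sub>C a) = c *\<^sub>C (\<lambda>\<alpha> \<beta>. g \<alpha> \<beta> *\<^sub>C a)"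
      by (simp add: fun_eq_iff scaleC_fun_def scaleC_scaleC mult.commute)
    then show ?thesis by (simp only: F_scale)
  qed
  have \<psi>_add: "?\<psi> (a + b) = ?\<psi> a + ?\<psi> b" for a b
    by (simp only: F_add') (simp add: fun_eq_iff)
  have \<psi>_scale: "?\<psi> (c *\<^sub>C a) = c *\<^sub>C ?\<psi> a" for c a
    by (simp only: F_scale') (simp add: fun_eq_iff scaleC_fun_def scaleC_complex_def)
  have \<psi>_0: "?\<psi> 0 = 0" using \<psi>_scale[of 0 0] by (simp only: cvec.scale_zero_left)
  have cp: "(\<lambda>i j. ?\<psi> (P i j)) \<in> mcone (matrix_opsys N) p" if P: "P \<in> mcone (cstar_opsys :: 'a opsys) p" for p P
  proof -
    obtain B where B: "B \<in> mats p UNIV" and P: "\<And>i j. P i j = (\<Sum>l<p. star (B l i) * B l j)"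
      using P by (auto simp: cstar_opsys_def)
    have Pz: "P i j = 0" if "\<not> (i < p \<and> j < p)" for i j
      using B that by (auto simp: P mats_def intro!: sum.neutral)
    have "?\<psi> (P i j) = 0" if "\<not> (i < p \<and> j < p)" for i j
      using \<psi>_0 by (simp only: Pz[OF that])
    then have mats: "(\<lambda>i j. ?\<psi> (P i j)) \<in> mats p (mats N UNIV)"
      unfolding mats_def[of p] by (simp add: mats_def)
    have "psd ({..<p} \<times> {..<N}) (\<lambda>(i, a) (j, b). ?\<psi> (P i j) a b)"
      unfolding psd_def
    proof
      fix \<xi> :: "nat \<times> nat \<Rightarrow> complex"
      let ?S = "{..<p} \<times> {..<N}"
      let ?c = "\<lambda>x y \<alpha> \<beta>. cnj (\<xi> x) * \<xi> y * cnj (v (snd x) \<alpha>) * v (snd y) \<beta>"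
      let ?t = "\<lambda>x y. cnj (\<xi> x) * (case x of (i, a) \<Rightarrow> \<lambda>(j, b). ?\<psi> (P i j) a b) y * \<xi> y"
      let ?M = "\<lambda>x y \<alpha> \<beta>. (cnj (v (snd x) \<alpha>) * v (snd y) \<beta>) *\<^sub>C P (fst x) (fst y)"
      let ?N = "\<lambda>x y \<alpha> \<beta>. ?c x y \<alpha> \<beta> *\<^sub>C P (fst x) (fst y)"
      \<comment> \<open>Since \<open>P\<close> is the Gram matrix of \<open>B\<close>, the quadratic
        form at \<open>\<xi>\<close> is \<open>F\<close> of the sum of the Gram matrices of the rows
        \<open>b l\<close>.\<close>
      define b where "b l \<beta> = (\<Sum>y\<in>?S. (\<xi> y * v (snd y) \<beta>) *\<^sub>C B l (fst y))" for l \<beta>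
      have "(\<Sum>x\<in>?S. \<Sum>y\<in>?S. ?t x y)
          = (\<Sum>x\<in>?S. \<Sum>y\<in>?S. F (?N x y))"
      proof (intro sum.cong refl)
        fix x y assume "x \<in> ?S" "y \<in> ?S"
        then have "?t x y
            = (cnj (\<xi> x) * \<xi> y) * F (?M x y)"
          by auto
        also have "\<dots> = F ((cnj (\<xi> x) * \<xi> y) *\<^sub>C (?M x y))"
          by (simp only: F_scale)
        also have "(cnj (\<xi> x) * \<xi> y) *\<^sub>C (?M x y)
            = ?N x y"
          by (simp add: fun_eq_iff scaleC_fun_def scaleC_scaleC mult.assoc)
        finally show "?t x y
            = F (?N x y)" .
      qed
      also have "\<dots> = F (\<lambda>\<alpha> \<beta>. \<Sum>x\<in>?S. \<Sum>y\<in>?S. ?c x y \<alpha> \<beta> *\<^sub>C P (fst x) (fst y))"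
        by (simp only: F_sum)
      also have "(\<lambda>\<alpha> \<beta>. \<Sum>x\<in>?S. \<Sum>y\<in>?S. ?c x y \<alpha> \<beta> *\<^sub>C P (fst x) (fst y))
          = (\<lambda>\<alpha> \<beta>. \<Sum>l<p. star (b l \<alpha>) * b l \<beta>)"
      proof (intro ext)
        fix \<alpha> \<beta>
        have "(\<Sum>l<p. star (b l \<alpha>) * b l \<beta>)
            = (\<Sum>l<p. \<Sum>x\<in>?S. \<Sum>y\<in>?S. ?c x y \<alpha> \<beta>
                *\<^sub>C (star (B l (fst x)) * B l (fst y)))"
          unfolding b_def star_sum sum_product
          by (intro sum.cong refl)
            (simp add: star_scaleC scaleC_mult_left scaleC_mult_right scaleC_scaleC mult_ac)
        also have "\<dots> = (\<Sum>x\<in>?S. \<Sum>y\<in>?S. \<Sum>l<p. ?c x y \<alpha> \<beta>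
                *\<^sub>C (star (B l (fst x)) * B l (fst y)))"
          by (subst sum.swap, intro sum.cong refl, subst sum.swap) (rule refl)
        finally show "(\<Sum>x\<in>?S. \<Sum>y\<in>?S. ?c x y \<alpha> \<beta> *\<^sub>C P (fst x) (fst y))
            = (\<Sum>l<p. star (b l \<alpha>) * b l \<beta>)"
          by (simp add: P cvec.scale_sum_right)
      qed
      also have "F \<dots> = (\<Sum>l<p. F (\<lambda>\<alpha> \<beta>. star (b l \<alpha>) * b l \<beta>))" by (simp only: F_sum)
      also have "\<dots> \<in> \<real>\<^sub>\<ge>\<^sub>0" using F_pos by (intro nonneg_Reals_sum) simp
      finally show "(\<Sum>x\<in>?S. \<Sum>y\<in>?S. ?t x y) \<in> \<real>\<^sub>\<ge>\<^sub>0" .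
    qed
    with mats show ?thesis by (simp add: matrix_opsys_def)
  qed
  have "?\<psi> 1 = unit_mat N"
    using orth by (simp add: fun_eq_iff unit_mat_def)
  moreover have "linear_on UNIV ?\<psi>" unfolding linear_on_def using \<psi>_add \<psi>_scale by blast
  moreover have "?\<psi> a \<in> mats N UNIV" for a by (simp add: mats_def)
  moreover have ou: "ounit (cstar_opsys :: 'a opsys) = 1" by (simp add: cstar_opsys_def)
  ultimately show ?thesis unfolding ucp_def ou using cp
    by (simp add: cstar_opsys_def[where 'a = 'a] matrix_opsys_def image_subset_iff)
qed


text \<open>A positive functional \<open>F\<close> on matrices over \<open>A\<close> corresponds to
  a completely positive map from \<open>A\<close> to scalar matrices, which becomes unital after a
  compression. The scalar form of \<open>F\<close> may be degenerate, so \<open>F\<close> is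
  perturbed by \<open>\<delta> * H\<close>, with \<open>H\<close> definite on scalar vectors.
  Vectors orthonormal for the new form give the unital \<open>\<psi>\<close>, and \<open>G\<close>
  recovers \<open>F' h\<close> from the \<open>\<psi> (h i j)\<close>.\<close>

lemma ucp_separation:
  fixes h :: "'i \<Rightarrow> 'i \<Rightarrow> 'a::cstar_algebra"
  assumes fin: "finite I" and \<epsilon>: "0 < \<epsilon>"
    and h: "\<not> gram I (\<lambda>i j. (if i = j then of_real \<epsilon> else 0) + (h i j + star (h j i)))"
  obtains N and \<psi> :: "'a \<Rightarrow> complex matrix" and G
  where "ucp cstar_opsys (matrix_opsys N) \<psi>"
    "Re (\<Sum>i\<in>I. \<Sum>j\<in>I. \<Sum>k<N. \<Sum>l<N. cnj (G k i) * \<psi> (h i j) k l * G l j) < 0"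
proof -
  define e where "e = (\<lambda>i j :: 'i. if i = j then 1 else 0 :: 'a)"
  have "complex_of_real (\<epsilon>/2) *\<^sub>C 1 = (of_real (\<epsilon>/2) :: 'a)"
    by (subst scaleC_of_real) (rule of_real_def[symmetric])
  moreover have "of_real \<epsilon> = of_real (\<epsilon>/2) + (of_real (\<epsilon>/2) :: 'a)"
    by (simp only: of_real_add[symmetric]) simp
  ultimately have eq: "(if i = j then of_real \<epsilon> else 0) + (h i j + star (h j i))
      = (h + complex_of_real (\<epsilon>/2) *\<^sub>C e) i j + star ((h + complex_of_real (\<epsilon>/2) *\<^sub>C e) j i)" for i j
    by (simp add: cmat_apply e_def star_add del: of_real_divide)
  have "\<not> gram I (\<lambda>i j. (h + complex_of_real (\<epsilon>/2) *\<^sub>C e) i j + star ((h + complex_of_real (\<epsilon>/2) *\<^sub>C e) j i))"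
    using h unfolding eq .
  note not_gram = this
  obtain F :: "('i \<Rightarrow> 'i \<Rightarrow> 'a) \<Rightarrow> complex" where
    F_add: "\<And>x y. F (x + y) = F x + F y" and F_scale: "\<And>c x. F (c *\<^sub>C x) = c * F x"
    and F_pos: "\<And>b. F (\<lambda>i j. star (b i) * b j) \<in> \<real>\<^sub>\<ge>\<^sub>0"
    and F_adj: "\<And>x. F (\<lambda>i j. star (x j i)) = cnj (F x)"
    and F_supp: "\<And>x. (\<And>i j. i \<in> I \<Longrightarrow> j \<in> I \<Longrightarrow> x i j = 0) \<Longrightarrow> F x = 0"
    and F_e: "F e = 1" and F_h: "Re (F (h + complex_of_real (\<epsilon>/2) *\<^sub>C e)) \<le> 0"
  proof (rule positive_functional_exists[OF fin not_gram], goal_cases)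
    case (1 F)
    show ?case by (rule 1(1)[OF 1(2-6) 1(7)[folded e_def] 1(8)])
  qed
  have F_sum: "F (\<Sum>s\<in>A. x s) = (\<Sum>s\<in>A. F (x s))" for A :: "'s set" and x
    by (rule additive.sum[OF additive.intro[of F, OF F_add]])
  have F_cong: "F x = F y" if "\<And>i j. i \<in> I \<Longrightarrow> j \<in> I \<Longrightarrow> x i j = y i j" for x y
  proof -
    have "F (x - y) = 0" by (rule F_supp) (simp add: that)
    then show ?thesis using F_add[of "x - y" y] by simp
  qed
  \<comment> \<open>The separation was applied to \<open>h\<close> shifted by
    \<open>\<epsilon>/2\<close> times the unit, and \<open>F e = 1\<close>.\<close>
  have Fh: "Re (F h) < 0" using F_h \<epsilon> by (simp add: F_add F_scale F_e)
  define D where "D a = (\<lambda>i j :: 'i. if i = j then a else 0 :: 'a)" for a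
  have D_pos: "F (D (star a * a)) \<in> \<real>\<^sub>\<ge>\<^sub>0" for a
  proof -
    let ?r = "\<lambda>\<gamma> i j. star (if i = \<gamma> then a else 0) * (if j = \<gamma> then a else 0)"
    have "F (D (star a * a)) = F (\<Sum>\<gamma>\<in>I. ?r \<gamma>)"
    proof (rule F_cong)
      fix i j assume "i \<in> I" "j \<in> I"
      have "(\<Sum>\<gamma>\<in>I. ?r \<gamma>) i j = (\<Sum>\<gamma>\<in>I. ?r \<gamma> i j)"
        by (simp only: fun_sum_apply)
      also have "\<dots> = (\<Sum>\<gamma>\<in>I. if i = \<gamma> then (if i = j then star a * a else 0) else 0)"
        by (intro sum.cong) auto
      also have "\<dots> = D (star a * a) i j" using \<open>i \<in> I\<close> fin by (simp add: D_def)
      finally show "D (star a * a) i j = (\<Sum>\<gamma>\<in>I. ?r \<gamma>) i j" by simp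
    qed
    also have "\<dots> = (\<Sum>\<gamma>\<in>I. F (?r \<gamma>))" by (rule F_sum)
    also have "\<dots> \<in> \<real>\<^sub>\<ge>\<^sub>0" by (intro nonneg_Reals_sum F_pos)
    finally show ?thesis .
  qed
  \<comment> \<open>The trace combined with the functional that \<open>F\<close> induces on
    \<open>A\<close> through constant diagonal matrices; on the scalar matrix of a vector it is the
    sum of the squared moduli over \<open>I\<close>.\<close>
  define H where "H x = (\<Sum>\<gamma>\<in>I. F (D (x \<gamma> \<gamma>)))" for x
  have D_add: "D (a + b) = D a + D b" and D_scale: "D (c *\<^sub>C a) = c *\<^sub>C D a" for a b c
    by (simp_all add: D_def fun_eq_iff scaleC_fun_def)
  have H_add: "H (x + y) = H x + H y" and H_scale: "H (c *\<^sub>C x) = c * H x" for x y c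
    by (simp_all add: H_def cmat_apply D_add D_scale F_add F_scale sum.distrib sum_distrib_left)
  have D_adj: "F (D (star a)) = cnj (F (D a))" for a
  proof -
    have "D (star a) = (\<lambda>i j. star (D a j i))" by (auto simp: D_def fun_eq_iff)
    then show ?thesis using F_adj[of "D a"] by simp
  qed
  \<comment> \<open>The perturbation changes \<open>Re (F h)\<close> by at most half its modulus;
    the summand 1 keeps the denominator positive.\<close>
  define \<delta> where "\<delta> = - Re (F h) / (2 * (\<bar>Re (H h)\<bar> + 1))"
  have "\<delta> > 0" using Fh unfolding \<delta>_def by (intro divide_pos_pos) auto
  define F' where "F' x = F x + complex_of_real \<delta> * H x" for x
  have F'_add: "F' (x + y) = F' x + F' y" and F'_scale: "F' (c *\<^sub>C x) = c * F' x" for x y c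
    by (simp_all add: F'_def F_add F_scale H_add H_scale algebra_simps)
  have F'_pos: "F' (\<lambda>i j. star (b i) * b j) \<in> \<real>\<^sub>\<ge>\<^sub>0" for b
    unfolding F'_def H_def using F_pos[of b] D_pos \<open>\<delta> > 0\<close>
    by (intro nonneg_Reals_add_I nonneg_Reals_mult_I nonneg_Reals_sum) auto
  have F'_cong: "F' x = F' y" if "\<And>i j. i \<in> I \<Longrightarrow> j \<in> I \<Longrightarrow> x i j = y i j" for x y
    unfolding F'_def H_def using F_cong[of x y] that by simp
  have "\<bar>\<delta> * Re (H h)\<bar> \<le> \<delta> * (\<bar>Re (H h)\<bar> + 1)"
    using \<open>\<delta> > 0\<close> by (simp add: abs_mult)
  also have "\<dots> = - Re (F h) / 2" by (simp add: \<delta>_def field_simps)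
  finally have F'h: "Re (F' h) < 0" using Fh by (simp add: F'_def)
  define S where "S x y = F' (\<lambda>i j. (cnj (x i) * y j) *\<^sub>C 1)" for x y
  have "\<exists>(N::nat) v G. (\<forall>k<N. \<forall>l<N. S (v k) (v l) = (if k = l then 1 else 0))
      \<and> (\<forall>i\<in>I. \<forall>j. (\<Sum>k<N. G k i * v k j) = (if i = j then 1 else 0))"
  proof (rule gram_schmidt[of I S, OF fin])
    show "S (\<lambda>i. x i + y i) z = S x z + S y z" for x y z
    proof -
      have "(\<lambda>i j. (cnj (x i + y i) * z j) *\<^sub>C 1) = (\<lambda>i j. (cnj (x i) * z j) *\<^sub>C 1) + (\<lambda>i j. (cnj (y i) * z j) *\<^sub>C (1::'a))"
        by (simp add: fun_eq_iff algebra_simps scaleC_add_left)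
      then show ?thesis by (simp only: S_def F'_add)
    qed
    show "S (\<lambda>i. c * x i) z = cnj c * S x z" for c x z
    proof -
      have "(\<lambda>i j. (cnj (c * x i) * z j) *\<^sub>C 1) = cnj c *\<^sub>C (\<lambda>i j. (cnj (x i) * z j) *\<^sub>C (1::'a))"
        by (simp add: fun_eq_iff scaleC_fun_def scaleC_scaleC mult.assoc)
      then show ?thesis by (simp only: S_def F'_scale)
    qed
    show "S y x = cnj (S x y)" for x y
    proof -
      have eq: "(\<lambda>i j. (cnj (y i) * x j) *\<^sub>C 1) = (\<lambda>i j. star ((cnj (x j) * y i) *\<^sub>C (1::'a)))"
        by (simp add: fun_eq_iff star_scaleC mult.commute)
      show ?thesis unfolding S_def F'_def H_def eq D_adj
        using F_adj[of "\<lambda>i j. (cnj (x i) * y j) *\<^sub>C 1"] by simp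
    qed
    show "0 < Re (S x x)" if "x \<noteq> (\<lambda>_. 0)" "\<And>i. i \<notin> I \<Longrightarrow> x i = 0" for x
    proof -
      obtain \<gamma> where \<gamma>: "x \<gamma> \<noteq> 0" using \<open>x \<noteq> (\<lambda>_. 0)\<close> by auto
      have "D 1 = e" by (simp add: D_def e_def)
      have "(\<lambda>i j. star (x i *\<^sub>C 1) * x j *\<^sub>C 1) = (\<lambda>i j. (cnj (x i) * x j) *\<^sub>C (1::'a))"
        by (simp add: fun_eq_iff star_scaleC scaleC_mult_left scaleC_mult_right scaleC_scaleC mult.commute)
      then have "0 \<le> Re (F (\<lambda>i j. (cnj (x i) * x j) *\<^sub>C 1))"
        using F_pos[of "\<lambda>i. x i *\<^sub>C 1"] by (simp add: complex_nonneg_Reals_iff)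
      moreover have "Re (H (\<lambda>i j. (cnj (x i) * x j) *\<^sub>C 1)) = (\<Sum>i\<in>I. (cmod (x i))\<^sup>2)"
        unfolding H_def D_scale F_scale \<open>D 1 = e\<close> F_e
        by (simp add: cmod_power2) (simp add: power2_eq_square)
      moreover have "(\<Sum>i\<in>I. (cmod (x i))\<^sup>2) > 0"
        using \<gamma> that(2) fin by (intro sum_pos2[of I \<gamma>]) auto
      ultimately show ?thesis using \<open>\<delta> > 0\<close> by (simp add: S_def F'_def add_nonneg_pos)
    qed
  qed blast
  then obtain N :: nat and v G where
    orth: "\<And>k l. k < N \<Longrightarrow> l < N \<Longrightarrow> S (v k) (v l) = (if k = l then 1 else 0)"
    and G: "\<And>i j. i \<in> I \<Longrightarrow> (\<Sum>k<N. G k i * v k j) = (if i = j then 1 else 0)"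
    by blast
  define \<psi> where "\<psi> = (\<lambda>a k l. if k < N \<and> l < N then F' (\<lambda>i j. (cnj (v k i) * v l j) *\<^sub>C a) else 0)"
  have ucp: "ucp cstar_opsys (matrix_opsys N) \<psi>"
    unfolding \<psi>_def
    by (rule compression_ucp[OF F'_add F'_scale F'_pos orth[unfolded S_def]])
  have F'_sum: "F' (\<Sum>s\<in>A. x s) = (\<Sum>s\<in>A. F' (x s))" for A :: "'s set" and x
    by (rule additive.sum[OF additive.intro[of F', OF F'_add]])
  define E where "E a b = (\<lambda>i j. if i = a \<and> j = b then h a b else 0)" for a b
  have inner: "(\<Sum>k<N. \<Sum>l<N. cnj (G k a) * \<psi> (h a b) k l * G l b) = F' (E a b)"
    if "a \<in> I" "b \<in> I" for a b
  proof -
    let ?X = "\<lambda>k l. (\<lambda>i j. (cnj (v k i) * v l j) *\<^sub>C h a b)"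
    have "(\<Sum>k<N. \<Sum>l<N. cnj (G k a) * \<psi> (h a b) k l * G l b)
        = (\<Sum>k<N. \<Sum>l<N. (cnj (G k a) * G l b) * F' (?X k l))"
      by (intro sum.cong refl) (simp add: \<psi>_def)
    also have "\<dots> = F' (\<Sum>k<N. \<Sum>l<N. (cnj (G k a) * G l b) *\<^sub>C ?X k l)"
      by (simp only: F'_sum F'_scale)
    also have "(\<Sum>k<N. \<Sum>l<N. (cnj (G k a) * G l b) *\<^sub>C ?X k l) = E a b"
    proof (intro ext)
      fix i j
      have "(\<Sum>k<N. \<Sum>l<N. (cnj (G k a) * G l b) *\<^sub>C ?X k l) i j
          = (\<Sum>k<N. \<Sum>l<N. (cnj (G k a * v k i) * (G l b * v l j)) *\<^sub>C h a b)"
        by (simp add: fun_sum_apply scaleC_fun_def scaleC_scaleC mult_ac)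
      also have "\<dots> = (cnj (\<Sum>k<N. G k a * v k i) * (\<Sum>l<N. G l b * v l j)) *\<^sub>C h a b"
        by (simp only: cnj_sum sum_product cvec.scale_sum_left)
      also have "\<dots> = E a b i j" using that by (simp add: G E_def scaleC_one)
      finally show "(\<Sum>k<N. \<Sum>l<N. (cnj (G k a) * G l b) *\<^sub>C ?X k l) i j = E a b i j" .
    qed
    finally show ?thesis .
  qed
  have "(\<Sum>i\<in>I. \<Sum>j\<in>I. \<Sum>k<N. \<Sum>l<N. cnj (G k i) * \<psi> (h i j) k l * G l j)
      = (\<Sum>i\<in>I. \<Sum>j\<in>I. F' (E i j))"
    by (intro sum.cong refl inner)
  also have "\<dots> = F' (\<Sum>i\<in>I. \<Sum>j\<in>I. E i j)" by (simp only: F'_sum)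
  also have "\<dots> = F' h"
  proof (rule F'_cong)
    fix i j assume "i \<in> I" "j \<in> I"
    have "(\<Sum>a\<in>I. \<Sum>b\<in>I. E a b) i j = (\<Sum>a\<in>I. \<Sum>b\<in>I. if i = a then (if j = b then h a b else 0) else 0)"
      unfolding fun_sum_apply E_def by (intro sum.cong refl) auto
    also have "\<dots> = h i j" using \<open>i \<in> I\<close> \<open>j \<in> I\<close> fin by (subst sum.swap) simp
    finally show "(\<Sum>a\<in>I. \<Sum>b\<in>I. E a b) i j = h i j" .
  qed
  finally show thesis using that[OF ucp, of G] F'h by simp
qed

section \<open>Selfadjointness and separation of points by unital completely positive maps\<close>

text \<open>Polarization: \<open>psd\<close> only asserts nonnegative real values of the quadratic
  form, and the vectors \<open>e_i + c e_j\<close> with \<open>c\<close> among 1, -1, \<i>, -\<i>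
  recover the symmetry.\<close>

lemma psd_hermitian:
  assumes fin: "finite I" and A: "psd I A" and I: "i \<in> I" "j \<in> I"
  shows "A j i = cnj (A i j)"
proof -
  have quad: "(\<Sum>k\<in>I. \<Sum>l\<in>I. cnj (x k) * A k l * x l) = A i i + c * A i j + cnj c * A j i + cnj c * c * A j j"
    if x: "x = (\<lambda>k. (if k = i then 1 else 0) + (if k = j then c else 0))" for x c
  proof -
    have inner: "(\<Sum>l\<in>I. cnj (x k) * A k l * x l) = cnj (x k) * (A k i + A k j * c)" for k
      using fin I by (simp add: x distrib_left sum.distrib if_distrib[of "\<lambda>u. _ * u"] cong: if_cong)
    have "(\<Sum>k\<in>I. cnj (x k) * (A k i + A k j * c))
        = (\<Sum>k\<in>I. (if k = i then A k i + A k j * c else 0) + (if k = j then cnj c * (A k i + A k j * c) else 0))"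
      by (intro sum.cong refl) (auto simp: x distrib_right)
    also have "\<dots> = (A i i + A i j * c) + cnj c * (A j i + A j j * c)"
      using fin I by (simp add: sum.distrib)
    finally have eq: "(\<Sum>k\<in>I. cnj (x k) * (A k i + A k j * c)) = \<dots>" .
    show ?thesis unfolding inner eq by (simp add: algebra_simps)
  qed
  have q: "A i i + c * A i j + cnj c * A j i + cnj c * c * A j j \<in> \<real>\<^sub>\<ge>\<^sub>0" for c
    using A[unfolded psd_def, rule_format, of "\<lambda>k. (if k = i then 1 else 0) + (if k = j then c else 0)"]
    by (simp only: quad[OF refl])
  from q[of 1] q[of "-1"] q[of \<i>] q[of "- \<i>"] show ?thesis
    by (simp add: complex_nonneg_Reals_iff complex_eq_iff)
qed

lemma ucp_linear:
  assumes "ucp (cstar_opsys :: 'a::cstar_algebra opsys) T \<psi>"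
  shows "\<psi> (a + b) = \<psi> a + \<psi> b" "\<psi> (c *\<^sub>C a) = c *\<^sub>C \<psi> a" "\<psi> (a - b) = \<psi> a - \<psi> b"
proof -
  have lin: "\<psi> (a + b) = \<psi> a + \<psi> b" "\<psi> (c *\<^sub>C a) = c *\<^sub>C \<psi> a" for a b c
    using assms by (auto simp: ucp_def linear_on_def cstar_opsys_def)
  then show "\<psi> (a + b) = \<psi> a + \<psi> b" "\<psi> (c *\<^sub>C a) = c *\<^sub>C \<psi> a" by auto
  show "\<psi> (a - b) = \<psi> a - \<psi> b" using lin(1)[of "a - b" b] by simp
qed

text \<open>Adjoints are no part of \<open>opsys\<close>, so compatibility with them is derived:
  squares go to hermitian matrices, hermitian elements are differences of positive ones, and every
  \<open>a\<close> is \<open>x - \<i> y\<close> with hermitian \<open>x\<close>,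
  \<open>y\<close>.\<close>

lemma ucp_star:
  fixes \<psi> :: "'a::cstar_algebra \<Rightarrow> complex matrix"
  assumes ucp: "ucp cstar_opsys (matrix_opsys N) \<psi>" and kl: "k < N" "l < N"
  shows "\<psi> (star a) k l = cnj (\<psi> a l k)"
proof -
  have square: "\<psi> (star z * z) k l = cnj (\<psi> (star z * z) l k)" if kl: "k < N" "l < N" for z k l
  proof -
    define B :: "'a matrix" where "B = (\<lambda>i j. if i = 0 \<and> j = 0 then z else 0)"
    define P where "P = (\<lambda>i j. \<Sum>l<1::nat. star (B l i) * B l j)"
    have "B \<in> mats 1 UNIV" by (simp add: mats_def B_def)
    then have Pm: "P \<in> mcone cstar_opsys 1"
      unfolding cstar_opsys_def opsys.select_convs mem_Collect_eq P_def by (intro bexI[of _ B] refl)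
    have "\<forall>p. \<forall>P\<in>mcone cstar_opsys p. (\<lambda>i j. \<psi> (P i j)) \<in> mcone (matrix_opsys N) p"
      using ucp unfolding ucp_def by (elim conjE)
    from this[THEN spec, THEN bspec, OF Pm] have "(\<lambda>i j. \<psi> (P i j)) \<in> mcone (matrix_opsys N) 1" .
    then have "psd ({..<1} \<times> {..<N}) (\<lambda>(i, a) (j, b). \<psi> (P i j) a b)"
      by (simp add: matrix_opsys_def)
    from psd_hermitian[OF _ this, of "(0, l)" "(0, k)"] kl show ?thesis by (simp add: P_def B_def)
  qed
  have pos: "\<psi> x k l = cnj (\<psi> x l k)" if "pos x" "k < N" "l < N" for x k l
  proof -
    obtain z where "pos z" "z * z = x" using pos_sqrt[OF \<open>pos x\<close>] by blast
    then have "x = star z * z" using pos_hermitian[of z] by (simp add: hermitian_def)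
    then show ?thesis using square[OF that(2,3), of z] by simp
  qed
  have herm: "\<psi> y k l = cnj (\<psi> y l k)" if y: "hermitian y" and kl: "k < N" "l < N" for y k l
  proof -
    have t: "pos (of_real (norm y) - y)" "pos (of_real (norm y) - 0 :: 'a)"
      by (rule pos_of_real_diff, simp_all only: y hermitian_simps norm_zero norm_ge_zero order_refl)+
    have "\<psi> y = \<psi> (of_real (norm y) - 0) - \<psi> (of_real (norm y) - y)"
      by (simp flip: ucp_linear(3)[OF ucp])
    then show ?thesis using pos[OF t(1) kl] pos[OF t(2) kl] by simp
  qed
  define x where "x = (1/2) *\<^sub>C (a + star a)"
  define y where "y = (1/2) *\<^sub>C (\<i> *\<^sub>C (a - star a))"
  have xy: "hermitian x" "hermitian y"
    by (simp_all add: hermitian_def x_def y_def star_scaleC star_add star_diff star_star add.commute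
        cvec.scale_right_diff_distrib)
  have half: "(1/2) *\<^sub>C b + (1/2) *\<^sub>C b = b" for b :: 'a
    by (simp flip: scaleC_add_left add: scaleC_one)
  have a: "a = x + (- \<i>) *\<^sub>C y" "star a = x + \<i> *\<^sub>C y"
    using half[of a] half[of "star a"]
    by (simp_all add: x_def y_def scaleC_scaleC scaleC_add_right cvec.scale_right_diff_distrib)
  show ?thesis
    using herm[OF xy(1) kl] herm[OF xy(2) kl]
    by (subst a(2), subst a(1)) (simp add: ucp_linear[OF ucp] scaleC_fun_def scaleC_complex_def)
qed

text \<open>If every \<open>\<psi>\<close> kills \<open>y\<close>, separation over a one-point index
  set yields no negative value, so \<open>\<epsilon> + y + star y\<close> is positive for all
  \<open>\<epsilon> > 0\<close>. Applied to \<open>y\<close> and \<open>- y\<close>, this makes a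
  hermitian \<open>y\<close> vanish in norm.\<close>

lemma ucp_separates_points:
  fixes x :: "'a::cstar_algebra"
  assumes zero: "\<And>N \<psi> k l. ucp cstar_opsys (matrix_opsys N) \<psi> \<Longrightarrow> k < N \<Longrightarrow> l < N \<Longrightarrow> \<psi> x k l = 0"
  shows "x = 0"
proof -
  have pos: "pos (of_real \<epsilon> + (y + star y))"
    if y: "\<And>N \<psi> k l. ucp cstar_opsys (matrix_opsys N) \<psi> \<Longrightarrow> k < N \<Longrightarrow> l < N \<Longrightarrow> \<psi> y k l = 0" and "0 < \<epsilon>"
    for y :: 'a and \<epsilon>
  proof (rule ccontr)
    assume np: "\<not> pos (of_real \<epsilon> + (y + star y))"
    have "\<not> gram {()} (\<lambda>\<alpha> \<beta>. (if \<alpha> = \<beta> then of_real \<epsilon> else 0) + (y + star y))"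
      using gram_pos[of "{()}" "\<lambda>\<alpha> \<beta>. (if \<alpha> = \<beta> then of_real \<epsilon> else 0) + (y + star y)" "()"] np by auto
    from ucp_separation[OF _ \<open>0 < \<epsilon>\<close> this] obtain N and \<psi> :: "'a \<Rightarrow> complex matrix" and G where
      u: "ucp cstar_opsys (matrix_opsys N) \<psi>"
      and n: "Re (\<Sum>\<alpha>\<in>{()}. \<Sum>\<beta>\<in>{()}. \<Sum>k<N. \<Sum>l<N. cnj (G k \<alpha>) * \<psi> y k l * G l \<beta>) < 0"
      by auto
    from n show False by (simp add: y[OF u])
  qed
  have herm: "y = 0" if y: "\<And>N \<psi> k l. ucp cstar_opsys (matrix_opsys N) \<psi> \<Longrightarrow> k < N \<Longrightarrow> l < N \<Longrightarrow> \<psi> y k l = 0"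
    and "hermitian y" for y :: 'a
  proof -
    have small: "norm (y + y) \<le> 0 + \<epsilon>" if "0 < \<epsilon>" for \<epsilon>
    proof -
      have "0 < \<epsilon>/3" using \<open>0 < \<epsilon>\<close> by simp
      have "pos (of_real (\<epsilon>/3) + (- y + star (- y)))"
      proof (rule pos[OF _ \<open>0 < \<epsilon>/3\<close>])
        fix N k l and \<psi> :: "'a \<Rightarrow> complex matrix"
        assume u: "ucp cstar_opsys (matrix_opsys N) \<psi>" "k < N" "l < N"
        show "\<psi> (- y) k l = 0"
          using y[OF u] ucp_linear(2)[OF u(1), of "-1" y]
          by (simp add: scaleC_one scaleC_fun_def scaleC_complex_def)
      qed
      moreover have "pos (of_real (\<epsilon>/3) + (y + star y))"
        by (rule pos[OF _ \<open>0 < \<epsilon>/3\<close>]) (rule y)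
      moreover have "of_real (\<epsilon>/3) + (- y + star (- y)) = of_real (\<epsilon>/3) - (y + y)" "y + star y = y + y"
        using \<open>hermitian y\<close> by (simp_all add: hermitian_def star_minus)
      ultimately have b: "pos (of_real (\<epsilon>/3) - (y + y))" "pos (of_real (\<epsilon>/3) + (y + y))"
        by (simp_all only:)
      have "norm (y + y) \<le> 3 * (\<epsilon>/3)"
        by (rule norm_le_of_pos_bounds[OF _ _ b])
          (use \<open>0 < \<epsilon>\<close> \<open>hermitian y\<close> in \<open>simp_all add: hermitian_intros\<close>)
      then show ?thesis by simp
    qed
    from field_le_epsilon[OF small] have "y + y = 0" by simp
    then have "2 *\<^sub>R y = 0" by (simp only: scaleR_2)
    then show ?thesis by simp
  qed
  have "x + star x = 0"
  proof (rule herm)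
    fix N k l and \<psi> :: "'a \<Rightarrow> complex matrix"
    assume u: "ucp cstar_opsys (matrix_opsys N) \<psi>" "k < N" "l < N"
    then show "\<psi> (x + star x) k l = 0"
      by (simp add: ucp_linear[OF u(1)] ucp_star[OF u] zero[OF u] zero[OF u(1,3,2)])
  qed (simp add: hermitian_def star_add star_star add.commute)
  moreover have "\<i> *\<^sub>C (x - star x) = 0"
  proof (rule herm)
    fix N k l and \<psi> :: "'a \<Rightarrow> complex matrix"
    assume u: "ucp cstar_opsys (matrix_opsys N) \<psi>" "k < N" "l < N"
    then show "\<psi> (\<i> *\<^sub>C (x - star x)) k l = 0"
      by (simp add: ucp_linear[OF u(1)] ucp_star[OF u] zero[OF u] zero[OF u(1,3,2)] scaleC_fun_def)
  qed (simp add: hermitian_def star_diff star_star star_scaleC cvec.scale_right_diff_distrib)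
  ultimately have "x + x = 0" by (simp add: cvec.scale_eq_0_iff)
  then have "2 *\<^sub>R x = 0" by (simp only: scaleR_2)
  then show ?thesis by simp
qed

text \<open>Separation sees only the sum of \<open>h\<close> and its adjoint. All images of
  \<open>h\<close> are hermitian matrices by hypothesis, and separation of points lifts this to
  \<open>h\<close> itself; the Gram family for \<open>2 h + 2 \<epsilon>\<close> is then
  halved.\<close>

lemma ucp_positive_imp_gram:
  fixes h :: "'i \<Rightarrow> 'i \<Rightarrow> 'a::cstar_algebra"
  assumes fin: "finite I"
    and pos: "\<And>N \<psi> \<xi>. ucp cstar_opsys (matrix_opsys N) \<psi> \<Longrightarrow>
      (\<Sum>\<alpha>\<in>I. \<Sum>\<beta>\<in>I. \<Sum>k<N. \<Sum>l<N. cnj (\<xi> k \<alpha>) * \<psi> (h \<alpha> \<beta>) k l * \<xi> l \<beta>) \<in> \<real>\<^sub>\<ge>\<^sub>0"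
    and \<epsilon>: "0 < \<epsilon>"
  shows "gram I (\<lambda>\<alpha> \<beta>. (if \<alpha> = \<beta> then of_real \<epsilon> else 0) + h \<alpha> \<beta>)"
proof -
  have herm: "star (h \<beta> \<alpha>) = h \<alpha> \<beta>" if I: "\<alpha> \<in> I" "\<beta> \<in> I" for \<alpha> \<beta>
  proof -
    have "h \<alpha> \<beta> - star (h \<beta> \<alpha>) = 0"
    proof (rule ucp_separates_points)
      fix N k l and \<psi> :: "'a \<Rightarrow> complex matrix"
      assume u: "ucp cstar_opsys (matrix_opsys N) \<psi>" and kl: "k < N" "l < N"
      have "psd (I \<times> {..<N}) (\<lambda>(\<alpha>, k) (\<beta>, l). \<psi> (h \<alpha> \<beta>) k l)"
        unfolding psd_def
      proof
        fix x :: "'i \<times> nat \<Rightarrow> complex"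
        have "(\<Sum>i\<in>I \<times> {..<N}. \<Sum>j\<in>I \<times> {..<N}. cnj (x i) * (case i of (\<alpha>, k) \<Rightarrow> \<lambda>(\<beta>, l). \<psi> (h \<alpha> \<beta>) k l) j * x j)
          = (\<Sum>\<alpha>\<in>I. \<Sum>k<N. \<Sum>\<beta>\<in>I. \<Sum>l<N. cnj (x (\<alpha>, k)) * \<psi> (h \<alpha> \<beta>) k l * x (\<beta>, l))"
          by (simp add: sum.cartesian_product')
        also have "\<dots> = (\<Sum>\<alpha>\<in>I. \<Sum>\<beta>\<in>I. \<Sum>k<N. \<Sum>l<N. cnj (x (\<alpha>, k)) * \<psi> (h \<alpha> \<beta>) k l * x (\<beta>, l))"
          by (intro sum.cong refl) (rule sum.swap)
        also have "\<dots> \<in> \<real>\<^sub>\<ge>\<^sub>0" using pos[OF u, of "\<lambda>k \<alpha>. x (\<alpha>, k)"] by simp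
        finally show "(\<Sum>i\<in>I \<times> {..<N}. \<Sum>j\<in>I \<times> {..<N}. cnj (x i) * (case i of (\<alpha>, k) \<Rightarrow> \<lambda>(\<beta>, l). \<psi> (h \<alpha> \<beta>) k l) j * x j) \<in> \<real>\<^sub>\<ge>\<^sub>0" .
      qed
      from psd_hermitian[OF _ this, of "(\<beta>, l)" "(\<alpha>, k)"] fin I kl
      show "\<psi> (h \<alpha> \<beta> - star (h \<beta> \<alpha>)) k l = 0"
        by (simp add: ucp_linear[OF u] ucp_star[OF u])
    qed
    then show ?thesis by simp
  qed
  have "gram I (\<lambda>\<alpha> \<beta>. (if \<alpha> = \<beta> then of_real (2 * \<epsilon>) else 0) + (h \<alpha> \<beta> + star (h \<beta> \<alpha>)))"
  proof (rule ccontr)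
    assume n: "\<not> gram I (\<lambda>\<alpha> \<beta>. (if \<alpha> = \<beta> then of_real (2 * \<epsilon>) else 0) + (h \<alpha> \<beta> + star (h \<beta> \<alpha>)))"
    have "2 * \<epsilon> > 0" using \<epsilon> by simp
    from ucp_separation[OF fin this n] obtain N and \<psi> :: "'a \<Rightarrow> complex matrix" and G where
      u: "ucp cstar_opsys (matrix_opsys N) \<psi>"
      and "Re (\<Sum>\<alpha>\<in>I. \<Sum>\<beta>\<in>I. \<Sum>k<N. \<Sum>l<N. cnj (G k \<alpha>) * \<psi> (h \<alpha> \<beta>) k l * G l \<beta>) < 0"
      by blast
    with pos[OF u, of G] show False by (simp add: complex_nonneg_Reals_iff)
  qed
  from gram_scaleR[OF this, of "1/2"] show ?thesis
    by (rule gram_cong[THEN iffD1, rotated -1])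
      (simp_all add: herm scaleR_add_right of_real_def flip: scaleR_2)
qed

section \<open>Approximate Schur complements\<close>

text \<open>Matrices over \<open>A\<close> are given no norm and so are no instance of
  \<open>cstar_algebra\<close>; the locale keeps what is needed to speak of sums of squares and
  their order.\<close>

locale star_ring =
  fixes adj :: "'m::real_algebra_1 \<Rightarrow> 'm"
  assumes adj_adj: "adj (adj x) = x"
    and adj_add: "adj (x + y) = adj x + adj y"
    and adj_mult: "adj (x * y) = adj y * adj x"
    and adj_scaleR: "adj (r *\<^sub>R x) = r *\<^sub>R adj x"
begin

section \<open>Sums of squares in a ring with involution\<close>

lemma adj_zero: "adj 0 = 0"
  using adj_scaleR[of 0 0] by simp

lemma adj_one: "adj 1 = 1"
  by (metis adj_adj adj_mult mult.left_neutral mult.right_neutral)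

lemma adj_of_real: "adj (of_real r) = of_real r"
  by (simp add: of_real_def adj_scaleR adj_one)

lemma adj_minus: "adj (- x) = - adj x"
  using adj_scaleR[of "-1" x] by simp

lemma adj_diff: "adj (x - y) = adj x - adj y"
  using adj_add[of x "- y"] by (simp add: adj_minus)

lemma adj_sum: "adj (\<Sum>i\<in>I. f i) = (\<Sum>i\<in>I. adj (f i))"
  by (induction I rule: infinite_finite_induct) (simp_all add: adj_add adj_zero)

definition sos :: "'m \<Rightarrow> bool" where
  "sos x \<longleftrightarrow> (\<exists>bs. x = (\<Sum>b\<leftarrow>bs. adj b * b))"

lemma sos_square: "sos (adj b * b)"
  unfolding sos_def by (rule exI[of _ "[b]"]) simp

lemma sos_zero: "sos 0"
  unfolding sos_def by (rule exI[of _ "[]"]) simp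

lemma sos_add:
  assumes "sos x" "sos y" shows "sos (x + y)"
proof -
  obtain bs cs where "x = (\<Sum>b\<leftarrow>bs. adj b * b)" "y = (\<Sum>b\<leftarrow>cs. adj b * b)"
    using assms unfolding sos_def by blast
  then show ?thesis unfolding sos_def by (intro exI[of _ "bs @ cs"]) simp
qed

lemma sos_sum: "(\<And>i. i \<in> I \<Longrightarrow> sos (f i)) \<Longrightarrow> sos (\<Sum>i\<in>I. f i)"
  by (induction I rule: infinite_finite_induct) (simp_all add: sos_zero sos_add)

lemma sos_conj:
  assumes "sos x" shows "sos (adj a * x * a)"
proof -
  obtain bs where bs: "x = (\<Sum>b\<leftarrow>bs. adj b * b)" using assms unfolding sos_def by blast
  have "adj a * (\<Sum>b\<leftarrow>bs. adj b * b) * a = (\<Sum>b\<leftarrow>bs. adj (b * a) * (b * a))"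
    by (induction bs) (simp_all add: adj_mult algebra_simps)
  then show ?thesis unfolding sos_def bs by (intro exI[of _ "map (\<lambda>b. b * a) bs"]) (simp add: comp_def)
qed

lemma sos_scaleR:
  assumes "sos x" "0 \<le> r" shows "sos (r *\<^sub>R x)"
proof -
  have "adj (of_real (sqrt r)) * x * of_real (sqrt r) = r *\<^sub>R x"
    using \<open>0 \<le> r\<close> by (simp add: of_real_def adj_scaleR adj_one)
  with sos_conj[OF assms(1), of "of_real (sqrt r)"] show ?thesis by simp
qed

lemma sos_of_real: "0 \<le> r \<Longrightarrow> sos (of_real r)"
  using sos_scaleR[OF sos_square[of 1]] by (simp add: of_real_def adj_one)

lemma sos_selfadjoint: "sos x \<Longrightarrow> adj x = x"
proof -
  have "adj (\<Sum>b\<leftarrow>bs. adj b * b) = (\<Sum>b\<leftarrow>bs. adj b * b)" for bs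
    by (induction bs) (simp_all add: adj_zero adj_add adj_mult adj_adj)
  then show "sos x \<Longrightarrow> adj x = x" by (auto simp: sos_def)
qed

text \<open>Conjugation by the selfadjoint \<open>d\<close> raises the exponent by two, which leaves
  the base cases \<open>1\<close> and \<open>d\<close>.\<close>

lemma sos_power:
  assumes d: "sos d" shows "sos (d ^ j)"
proof (induction j rule: less_induct)
  case (less j)
  consider "j = 0" | "j = 1" | i where "j = Suc (Suc i)" by (metis One_nat_def not0_implies_Suc)
  then show ?case
  proof cases
    case 1
    then show ?thesis using sos_square[of 1] by (simp add: adj_one)
  next
    case 3
    then have "sos (adj d * d ^ i * d)" by (intro sos_conj less) simp
    moreover have "adj d * d ^ i * d = d ^ j"
      using 3 by (simp add: sos_selfadjoint[OF d] power_commutes mult.assoc)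
    ultimately show ?thesis by simp
  qed (use d in simp)
qed

lemma adj_power: "adj d = d \<Longrightarrow> adj (d ^ k) = d ^ k"
  by (induction k) (simp_all add: adj_one adj_mult power_commutes)

text \<open>The identity \<open>d (\<rho> - d) d + (\<rho> - d) d (\<rho> - d) = \<rho> d (\<rho> -
  d)\<close> exhibits a product of commuting sums of squares as a sum of squares, without roots. It
  gives \<open>d d \<le> \<rho> \<rho>\<close>, and conjugation by \<open>d ^ k\<close> carries the
  bound to the next even exponent.\<close>

lemma sos_power_bound:
  assumes d: "sos d" and b: "sos (of_real \<rho> - d)" and \<rho>: "0 < \<rho>"
  shows "sos (of_real (\<rho> ^ (2 * k)) - d ^ (2 * k))"
proof (induction k)
  case 0
  show ?case by (simp add: sos_zero)
next
  case (Suc k)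
  note dh = sos_selfadjoint[OF d] and bh = sos_selfadjoint[OF b]
  have "sos (adj d * (of_real \<rho> - d) * d + adj (of_real \<rho> - d) * d * (of_real \<rho> - d))"
    by (intro sos_add sos_conj d b)
  then have "sos ((1/\<rho>) *\<^sub>R (adj d * (of_real \<rho> - d) * d + adj (of_real \<rho> - d) * d * (of_real \<rho> - d)))"
    by (rule sos_scaleR) (use \<rho> in simp)
  also have "adj d * (of_real \<rho> - d) * d + adj (of_real \<rho> - d) * d * (of_real \<rho> - d) = \<rho> *\<^sub>R (d * (of_real \<rho> - d))"
    unfolding dh bh by (simp add: of_real_def algebra_simps)
  finally have "sos (d * (of_real \<rho> - d))" using \<rho> by simp
  moreover have "sos (\<rho> *\<^sub>R (of_real \<rho> - d))" using sos_scaleR[OF b, of \<rho>] \<rho> by simp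
  ultimately have "sos (\<rho> *\<^sub>R (of_real \<rho> - d) + d * (of_real \<rho> - d))" by (intro sos_add)
  also have "\<rho> *\<^sub>R (of_real \<rho> - d) + d * (of_real \<rho> - d) = of_real (\<rho>\<^sup>2) - d * d"
    by (simp add: of_real_def algebra_simps power2_eq_square)
  finally have "sos (adj (d ^ k) * (of_real (\<rho>\<^sup>2) - d * d) * d ^ k)" by (rule sos_conj)
  moreover have "sos (\<rho>\<^sup>2 *\<^sub>R (of_real (\<rho> ^ (2 * k)) - d ^ (2 * k)))"
    using sos_scaleR[OF Suc, of "\<rho>\<^sup>2"] by simp
  ultimately have "sos (\<rho>\<^sup>2 *\<^sub>R (of_real (\<rho> ^ (2 * k)) - d ^ (2 * k)) + adj (d ^ k) * (of_real (\<rho>\<^sup>2) - d * d) * d ^ k)"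
    by (intro sos_add)
  also have "\<rho>\<^sup>2 *\<^sub>R (of_real (\<rho> ^ (2 * k)) - d ^ (2 * k)) + adj (d ^ k) * (of_real (\<rho>\<^sup>2) - d * d) * d ^ k
      = of_real (\<rho> ^ (2 * Suc k)) - d ^ (2 * Suc k)"
  proof -
    have 1: "d ^ k * d ^ k = d ^ (2 * k)" by (simp add: mult_2 power_add)
    have "d ^ k * (d * d) * d ^ k = d ^ (k + 2 + k)" by (simp only: power_add power2_eq_square)
    then have 2: "d ^ k * (d * d) * d ^ k = d ^ (2 * Suc k)" by (simp add: mult_2)
    have "adj (d ^ k) * (of_real (\<rho>\<^sup>2) - d * d) * d ^ k = \<rho>\<^sup>2 *\<^sub>R (d ^ k * d ^ k) - d ^ k * (d * d) * d ^ k"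
      by (simp add: adj_power[OF dh] of_real_def left_diff_distrib right_diff_distrib)
    moreover have "\<rho>\<^sup>2 *\<^sub>R of_real (\<rho> ^ (2 * k)) = (of_real (\<rho> ^ (2 * Suc k)) :: 'm)"
      by (simp add: of_real_def power2_eq_square mult.assoc)
    ultimately show ?thesis by (simp only: 1 2 scaleR_diff_right) simp
  qed
  finally show ?case .
qed

text \<open>An approximate version of the factorization of the positive matrix with rows
  \<open>(c, 1), (1, c\<^sup>-\<^sup>1)\<close>: the inverse of \<open>c + \<nu>\<close> is replaced by the partial sum \<open>q\<close> of a Neumann
  series with remainder \<open>r\<close>, and the error is absorbed into another \<open>\<nu>\<close>. The entry
  \<open>2 q - q c q\<close> is what \<open>approximate_schur_complement\<close> needs to be exact.\<close>

lemma approximate_inverse: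
  assumes c: "sos c" and t: "sos (of_real t - c)" "0 < t" and \<nu>: "0 < \<nu>"
  obtains q ps where "adj q = q"
    "(\<Sum>(a, b)\<leftarrow>ps. adj a * a) = c + of_real (2 * \<nu>)"
    "(\<Sum>(a, b)\<leftarrow>ps. adj a * b) = 1"
    "(\<Sum>(a, b)\<leftarrow>ps. adj b * b) = 2 *\<^sub>R q - q * c * q"
proof -
  \<comment> \<open>Normalized so that \<open>c + \<nu> = T (1 - d)\<close> with
    \<open>0 \<le> d \<le> \<rho> < 1\<close> in the order of sums of squares; the remainder
    \<open>d ^ k\<close> then decays geometrically.\<close>
  define T where "T = t + \<nu>"
  define \<rho> where "\<rho> = t / T"
  have T: "0 < T" and \<rho>: "0 < \<rho>" "\<rho> < 1" using t \<nu> by (simp_all add: T_def \<rho>_def)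
  define c' where "c' = c + of_real \<nu>"
  define d where "d = (1 / T) *\<^sub>R (of_real t - c)"
  have d: "sos d" unfolding d_def by (rule sos_scaleR[OF t(1)]) (use T in simp)
  have "of_real \<rho> - d = (1 / T) *\<^sub>R c"
    by (simp add: \<rho>_def d_def of_real_def scaleR_diff_right)
  then have \<rho>d: "sos (of_real \<rho> - d)" using sos_scaleR[OF c, of "1 / T"] T by simp
  note dh = sos_selfadjoint[OF d]
  have c'd: "c' = T *\<^sub>R (1 - d)"
    using T by (simp add: c'_def d_def scaleR_diff_right of_real_def) (simp add: T_def scaleR_left.add)
  \<comment> \<open>The aim is \<open>r r \<le> \<rho> ^ (2 k) \<le> (\<nu> / T)\<^sup>2 \<le>
    \<nu>\<^sup>2 q q\<close>, where the last step uses \<open>T q = 1 + y\<close> with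
    \<open>y\<close> a sum of squares. Taking \<open>k = Suc m\<close> guarantees the leading term
    1.\<close>
  obtain m where m: "\<rho> ^ m < (\<nu> / T)\<^sup>2" using real_arch_pow_inv[of "(\<nu> / T)\<^sup>2" \<rho>] \<rho> T \<nu> by auto
  define k where "k = Suc m"
  have "\<rho> ^ (2 * k) \<le> \<rho> ^ m" using \<rho> by (intro power_decreasing) (simp_all add: k_def)
  with m have k: "\<rho> ^ (2 * k) \<le> (\<nu> / T)\<^sup>2" by simp
  define y where "y = (\<Sum>j\<in>{1..<k}. d ^ j)"
  have y: "sos y" unfolding y_def by (intro sos_sum sos_power d)
  define p where "p = (\<Sum>j<k. d ^ j)"
  have py: "p = 1 + y"
    unfolding p_def y_def k_def by (subst sum.atLeast1_atMost_eq[symmetric] | simp add: lessThan_atLeast0 sum.atLeast_Suc_lessThan)+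
  define q where "q = (1 / T) *\<^sub>R p"
  define r where "r = d ^ k"
  have yh: "adj y = y" by (rule sos_selfadjoint[OF y])
  have qh: "adj q = q" by (simp add: q_def py adj_scaleR adj_add adj_one yh)
  have rh: "adj r = r" by (simp add: r_def adj_power[OF dh])
  have tele: "(1 - d) * (\<Sum>j<l. d ^ j) = 1 - d ^ l" for l
  proof (induction l)
    case (Suc l)
    have "(1 - d) * (\<Sum>j<Suc l. d ^ j) = (1 - d) * (\<Sum>j<l. d ^ j) + (1 - d) * d ^ l"
      by (simp add: distrib_left)
    also have "\<dots> = 1 - d ^ l + (d ^ l - d * d ^ l)" by (subst Suc) (simp only: left_diff_distrib mult_1)
    finally show ?case by simp
  qed simp
  have c'q: "c' * q = 1 - r" using T by (simp add: c'd q_def p_def tele r_def)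
  have ch: "adj c' = c'" by (simp add: c'_def adj_add adj_of_real sos_selfadjoint[OF c])
  have qc': "q * c' = 1 - r" using arg_cong[OF c'q, of adj] by (simp add: adj_mult adj_diff adj_one ch qh rh)
  have "sos (\<Sum>j<k. d ^ (j + k))" by (intro sos_sum sos_power d)
  then have qr: "sos (q * r)"
    using sos_scaleR[of _ "1 / T"] T by (simp add: q_def p_def r_def sum_distrib_right power_add)
  \<comment> \<open>What the last entry of the factorization still lacks to become
    \<open>2 q - q c q\<close>; by the choice of \<open>k\<close> the negative term is absorbed by
    \<open>\<nu> q q\<close>.\<close>
  define W where "W = \<nu> *\<^sub>R (q * q) + 2 *\<^sub>R (q * r) - (1 / \<nu>) *\<^sub>R (r * r)"
  let ?Z = "of_real ((\<nu> / T)\<^sup>2 - \<rho> ^ (2 * k)) + (of_real (\<rho> ^ (2 * k)) - d ^ (2 * k))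
      + (\<nu> / T)\<^sup>2 *\<^sub>R (2 *\<^sub>R y + adj y * y)"
  have W1: "sos ?Z"
    by (intro sos_add sos_of_real sos_power_bound d \<rho>d \<rho> sos_scaleR y sos_square) (use k in auto)
  have "sos ((1 / \<nu>) *\<^sub>R ?Z + 2 *\<^sub>R (q * r))"
    by (rule sos_add[OF sos_scaleR[OF W1] sos_scaleR[OF qr]]) (use \<nu> in auto)
  also have "(1 / \<nu>) *\<^sub>R ?Z + 2 *\<^sub>R (q * r) = W"
  proof -
    have rr: "r * r = d ^ (2 * k)" by (simp add: r_def mult_2 power_add)
    have "?Z = (\<nu> / T)\<^sup>2 *\<^sub>R (1 + (2 *\<^sub>R y + y * y)) - r * r"
      unfolding rr yh of_real_diff by (simp add: of_real_def scaleR_add_right)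
    also have "1 + (2 *\<^sub>R y + y * y) = p * p" unfolding py by (simp add: algebra_simps scaleR_2)
    also have "(\<nu> / T)\<^sup>2 *\<^sub>R (p * p) = \<nu>\<^sup>2 *\<^sub>R (q * q)" by (simp add: q_def power2_eq_square)
    finally show ?thesis using \<nu> by (simp add: W_def scaleR_diff_right power2_eq_square)
  qed
  finally obtain es where es: "W = (\<Sum>e\<leftarrow>es. adj e * e)" unfolding sos_def by blast
  have "sos c'" unfolding c'_def by (intro sos_add c sos_of_real) (use \<nu> in simp)
  then obtain bs where bs: "c' = (\<Sum>b\<leftarrow>bs. adj b * b)" unfolding sos_def by blast
  define s where "s = sqrt \<nu>"
  have s: "s * s = \<nu>" "s \<noteq> 0" using \<nu> by (simp_all add: s_def)
  \<comment> \<open>The pairs \<open>(b, b q)\<close> give the entries \<open>c'\<close>,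
    \<open>c' q = 1 - r\<close> and \<open>q c' q\<close>. The pair \<open>(s, r / s)\<close> adds
    \<open>\<nu>\<close>, \<open>r\<close> and \<open>r r / \<nu>\<close>, making the off-diagonal
    entry exactly 1; the pairs \<open>(0, e)\<close> add \<open>W\<close> to the last entry
    alone.\<close>
  define ps where "ps = map (\<lambda>b. (b, b * q)) bs @ [(of_real s, (1 / s) *\<^sub>R r)] @ map (Pair 0) es"
  have 1: "(\<Sum>b\<leftarrow>bs. adj b * (b * q)) = c' * q" "(\<Sum>b\<leftarrow>bs. adj (b * q) * (b * q)) = q * c' * q"
    unfolding bs by (induction bs) (simp_all add: algebra_simps adj_mult qh)
  show thesis
  proof (rule that[OF qh, of ps])
    show "(\<Sum>(a, b)\<leftarrow>ps. adj a * a) = c + of_real (2 * \<nu>)"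
    proof -
      have "of_real s * of_real s = (of_real \<nu> :: 'm)" by (simp add: s(1) flip: of_real_mult)
      moreover have "(\<Sum>(a, b)\<leftarrow>ps. adj a * a) = c' + of_real s * of_real s"
        by (simp add: ps_def comp_def adj_of_real adj_zero bs)
      ultimately show ?thesis by (simp only: c'_def mult_2 of_real_add add.assoc)
    qed
    show "(\<Sum>(a, b)\<leftarrow>ps. adj a * b) = 1"
    proof -
      have "(1 / s) *\<^sub>R (of_real s * r) = r" using s by (simp add: of_real_def)
      then show ?thesis by (simp add: ps_def comp_def adj_of_real adj_zero 1 c'q)
    qed
    have "(\<Sum>(a, b)\<leftarrow>ps. adj b * b) = q * c' * q + ((1 / \<nu>) *\<^sub>R (r * r) + W)"
      using s by (simp add: ps_def comp_def 1 es adj_scaleR rh)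
    also have "\<dots> = q * c' * q + \<nu> *\<^sub>R (q * q) + 2 *\<^sub>R (q * r)" by (simp add: W_def)
    also have "q * r = q - q * c' * q" by (simp add: mult.assoc c'q right_diff_distrib)
    also have "q * c' * q + \<nu> *\<^sub>R (q * q) + 2 *\<^sub>R (q - q * c' * q) = 2 *\<^sub>R q - q * c * q"
    proof -
      have "q * c' * q = q * c * q + \<nu> *\<^sub>R (q * q)"
        by (simp add: c'_def distrib_left distrib_right of_real_def)
      then show ?thesis by (simp only: scaleR_2) (simp add: algebra_simps)
    qed
    finally show "(\<Sum>(a, b)\<leftarrow>ps. adj b * b) = 2 *\<^sub>R q - q * c * q" .
  qed
qed

text \<open>The resulting rows are \<open>(a, b x_1, ..., b x_n)\<close>, with
  \<open>x_i = adj (R i) * R 0\<close> and \<open>(a, b)\<close> from the approximate factorization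
  of the 2 by 2 matrix, and one more row carrying the remainder \<open>S * R 0\<close>.\<close>

lemma approximate_schur_complement:
  fixes n :: nat
  assumes n: "1 \<le> n"
    and R: "\<And>i j. i \<in> {1..n} \<Longrightarrow> j \<in> {1..n} \<Longrightarrow> adj (R i) * R j = (if i = j then c else 0)"
    and t: "sos (of_real t - c)" "0 < t" and \<nu>: "0 < \<nu>"
  obtains bs :: "(nat \<Rightarrow> 'm) list"
  where "(\<Sum>b\<leftarrow>bs. adj (b 0) * b 0) = c + of_real (2 * \<nu>)"
    "\<And>i. i \<in> {1..n} \<Longrightarrow> (\<Sum>b\<leftarrow>bs. adj (b 0) * b i) = adj (R i) * R 0"
    "(\<Sum>i\<in>{1..n}. \<Sum>b\<leftarrow>bs. adj (b i) * b i) = adj (R 0) * R 0"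
proof -
  have c: "sos c" using sos_square[of "R 1"] R[of 1 1] n by simp
  obtain q ps where qh: "adj q = q"
    and aa: "(\<Sum>(a, b)\<leftarrow>ps. adj a * a) = c + of_real (2 * \<nu>)"
    and ab: "(\<Sum>(a, b)\<leftarrow>ps. adj a * b) = 1"
    and bb: "(\<Sum>(a, b)\<leftarrow>ps. adj b * b) = 2 *\<^sub>R q - q * c * q"
    using approximate_inverse[OF c t \<nu>] by blast
  define x where "x i = adj (R i) * R 0" for i
  define S where "S = 1 - (\<Sum>i\<in>{1..n}. R i * q * adj (R i))"
  have Sh: "adj S = S" by (simp add: S_def adj_diff adj_one adj_sum adj_mult adj_adj qh mult.assoc)
  define g where "g = 2 *\<^sub>R q - q * c * q"
  let ?P = "\<Sum>i\<in>{1..n}. R i * q * adj (R i)"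
  have "?P * ?P = (\<Sum>i\<in>{1..n}. \<Sum>j\<in>{1..n}. R i * q * (adj (R i) * R j) * q * adj (R j))"
    by (simp add: sum_product mult.assoc)
  also have "\<dots> = (\<Sum>i\<in>{1..n}. \<Sum>j\<in>{1..n}. if i = j then R i * (q * c * q) * adj (R i) else 0)"
    by (intro sum.cong refl) (simp add: R mult.assoc)
  also have "\<dots> = (\<Sum>i\<in>{1..n}. R i * (q * c * q) * adj (R i))" by simp
  finally have PP: "?P * ?P = (\<Sum>i\<in>{1..n}. R i * (q * c * q) * adj (R i))" .
  have "S * S = 1 - 2 *\<^sub>R ?P + ?P * ?P" by (simp add: S_def algebra_simps scaleR_2)
  also have "\<dots> = 1 - (\<Sum>i\<in>{1..n}. R i * g * adj (R i))"
    unfolding PP g_def by (simp add: right_diff_distrib left_diff_distrib sum_subtractf scaleR_sum_right)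
  finally have SS: "S * S = 1 - (\<Sum>i\<in>{1..n}. R i * g * adj (R i))" .
  have "adj (S * R 0) * (S * R 0) = adj (R 0) * (S * S) * R 0" by (simp add: adj_mult Sh mult.assoc)
  also have "\<dots> = adj (R 0) * R 0 - (\<Sum>i\<in>{1..n}. adj (x i) * g * x i)"
    unfolding SS by (simp add: left_diff_distrib right_diff_distrib sum_distrib_left sum_distrib_right
        x_def adj_mult adj_adj mult.assoc)
  finally have rem: "adj (S * R 0) * (S * R 0) = \<dots>" .
  define row where "row = (\<lambda>(a, b) i. if i = 0 then a else b * x i)"
  \<comment> \<open>Only the sum of the diagonal entries over \<open>i\<close> is prescribed, so the
    remainder may sit at a single index; 1 exists because \<open>1 \<le> n\<close>.\<close>
  define last where "last i = (if i = 1 then S * R 0 else 0)" for i :: nat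
  define bs where "bs = map row ps @ [last]"
  show thesis
  proof (rule that[of bs])
    show "(\<Sum>b\<leftarrow>bs. adj (b 0) * b 0) = c + of_real (2 * \<nu>)"
      using aa by (simp add: bs_def comp_def row_def last_def split_def adj_zero)
    have 0: "(\<Sum>z\<leftarrow>ps. adj (fst z) * (snd z * w)) = (\<Sum>(a, b)\<leftarrow>ps. adj a * b) * w" for w
      by (induction ps) (simp_all add: algebra_simps split_def)
    show "(\<Sum>b\<leftarrow>bs. adj (b 0) * b i) = adj (R i) * R 0" if "i \<in> {1..n}" for i
      using that ab 0[of "x i"]
      by (simp add: bs_def comp_def row_def last_def split_def adj_zero x_def)
    have 2: "(\<Sum>z\<leftarrow>ps. adj (snd z * w) * (snd z * w)) = adj w * (\<Sum>(a, b)\<leftarrow>ps. adj b * b) * w" for w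
      by (induction ps) (simp_all add: algebra_simps split_def adj_mult)
    have "(\<Sum>b\<leftarrow>bs. adj (b i) * b i) = adj (x i) * g * x i + (if i = 1 then adj (S * R 0) * (S * R 0) else 0)"
      if "i \<in> {1..n}" for i
      using that 2[of "x i"]
      by (simp add: bs_def comp_def row_def last_def split_def adj_zero bb[unfolded split_def] g_def)
    then have "(\<Sum>i\<in>{1..n}. \<Sum>b\<leftarrow>bs. adj (b i) * b i)
        = (\<Sum>i\<in>{1..n}. adj (x i) * g * x i + (if i = 1 then adj (S * R 0) * (S * R 0) else 0))"
      by (rule sum.cong[OF refl])
    also have "\<dots> = adj (R 0) * R 0" using n by (simp add: sum.distrib rem)
    finally show "(\<Sum>i\<in>{1..n}. \<Sum>b\<leftarrow>bs. adj (b i) * b i) = adj (R 0) * R 0" .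
  qed
qed

end

text \<open>Matrices over \<open>A\<close> of all sizes live in one unital ring, that of the infinite matrices
  with finitely many nonzero entries in every row and every column.\<close>

typedef (overloaded) 'a rcf_matrix =
  "{f :: nat \<Rightarrow> nat \<Rightarrow> 'a::zero. (\<forall>i. finite {j. f i j \<noteq> 0}) \<and> (\<forall>j. finite {i. f i j \<noteq> 0})}"
  morphisms entry rcf_matrix
  by (rule exI[of _ "\<lambda>i j. 0"]) simp

setup_lifting type_definition_rcf_matrix

lemma finite_row: "finite {j. entry f i j \<noteq> 0}" and finite_column: "finite {i. entry f i j \<noteq> 0}"
  using entry[of f] by auto

lemma rcf_matrix_eqI: "(\<And>i j. entry f i j = entry g i j) \<Longrightarrow> f = g"
  by (metis entry_inject ext)

instantiation rcf_matrix :: (real_algebra_1) real_algebra_1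
begin

lift_definition zero_rcf_matrix :: "'a rcf_matrix" is "\<lambda>i j. 0" by simp

lift_definition one_rcf_matrix :: "'a rcf_matrix" is "\<lambda>i j. if i = j then 1 else 0" by simp

lift_definition plus_rcf_matrix :: "'a rcf_matrix \<Rightarrow> 'a rcf_matrix \<Rightarrow> 'a rcf_matrix"
  is "\<lambda>f g i j. f i j + g i j"
proof (intro conjI allI)
  fix f g :: "nat \<Rightarrow> nat \<Rightarrow> 'a"
  assume f: "(\<forall>i. finite {j. f i j \<noteq> 0}) \<and> (\<forall>j. finite {i. f i j \<noteq> 0})"
    and g: "(\<forall>i. finite {j. g i j \<noteq> 0}) \<and> (\<forall>j. finite {i. g i j \<noteq> 0})"
  show "finite {j. f i j + g i j \<noteq> 0}" for i
    by (rule finite_subset[of _ "{j. f i j \<noteq> 0} \<union> {j. g i j \<noteq> 0}"]) (use f g in auto)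
  show "finite {i. f i j + g i j \<noteq> 0}" for j
    by (rule finite_subset[of _ "{i. f i j \<noteq> 0} \<union> {i. g i j \<noteq> 0}"]) (use f g in auto)
qed

lift_definition uminus_rcf_matrix :: "'a rcf_matrix \<Rightarrow> 'a rcf_matrix" is "\<lambda>f i j. - f i j" by simp

lift_definition scaleR_rcf_matrix :: "real \<Rightarrow> 'a rcf_matrix \<Rightarrow> 'a rcf_matrix" is "\<lambda>r f i j. r *\<^sub>R f i j"
proof (intro conjI allI)
  fix r and f :: "nat \<Rightarrow> nat \<Rightarrow> 'a"
  assume f: "(\<forall>i. finite {j. f i j \<noteq> 0}) \<and> (\<forall>j. finite {i. f i j \<noteq> 0})"
  show "finite {j. r *\<^sub>R f i j \<noteq> 0}" for i
    by (rule finite_subset[of _ "{j. f i j \<noteq> 0}"]) (use f in auto)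
  show "finite {i. r *\<^sub>R f i j \<noteq> 0}" for j
    by (rule finite_subset[of _ "{i. f i j \<noteq> 0}"]) (use f in auto)
qed

definition minus_rcf_matrix :: "'a rcf_matrix \<Rightarrow> 'a rcf_matrix \<Rightarrow> 'a rcf_matrix" where
  "minus_rcf_matrix f g = f + - g"

lift_definition times_rcf_matrix :: "'a rcf_matrix \<Rightarrow> 'a rcf_matrix \<Rightarrow> 'a rcf_matrix"
  is "\<lambda>f g i j. \<Sum>k\<in>{k. f i k \<noteq> 0}. f i k * g k j"
proof (intro conjI allI)
  fix f g :: "nat \<Rightarrow> nat \<Rightarrow> 'a"
  assume f: "(\<forall>i. finite {j. f i j \<noteq> 0}) \<and> (\<forall>j. finite {i. f i j \<noteq> 0})"
    and g: "(\<forall>i. finite {j. g i j \<noteq> 0}) \<and> (\<forall>j. finite {i. g i j \<noteq> 0})"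
  have nz: "\<exists>k. f i k \<noteq> 0 \<and> g k j \<noteq> 0" if nonzero: "(\<Sum>k\<in>{k. f i k \<noteq> 0}. f i k * g k j) \<noteq> 0" for i j
  proof (rule ccontr)
    assume "\<nexists>k. f i k \<noteq> 0 \<and> g k j \<noteq> 0"
    then have "(\<Sum>k\<in>{k. f i k \<noteq> 0}. f i k * g k j) = 0" by (intro sum.neutral) auto
    with nonzero show False by contradiction
  qed
  show "finite {j. (\<Sum>k\<in>{k. f i k \<noteq> 0}. f i k * g k j) \<noteq> 0}" for i
  proof (rule finite_subset)
    show "{j. (\<Sum>k\<in>{k. f i k \<noteq> 0}. f i k * g k j) \<noteq> 0} \<subseteq> (\<Union>k\<in>{k. f i k \<noteq> 0}. {j. g k j \<noteq> 0})"
      using nz by blast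
    show "finite (\<Union>k\<in>{k. f i k \<noteq> 0}. {j. g k j \<noteq> 0})" using f g by blast
  qed
  show "finite {i. (\<Sum>k\<in>{k. f i k \<noteq> 0}. f i k * g k j) \<noteq> 0}" for j
  proof (rule finite_subset)
    show "{i. (\<Sum>k\<in>{k. f i k \<noteq> 0}. f i k * g k j) \<noteq> 0} \<subseteq> (\<Union>k\<in>{k. g k j \<noteq> 0}. {i. f i k \<noteq> 0})"
      using nz by blast
    show "finite (\<Union>k\<in>{k. g k j \<noteq> 0}. {i. f i k \<noteq> 0})" using f g by blast
  qed
qed

lemma entry_mult:
  assumes "finite K" "{k. entry f i k \<noteq> 0} \<subseteq> K"
  shows "entry (f * g) i j = (\<Sum>k\<in>K. entry f i k * entry g k j)"
  unfolding times_rcf_matrix.rep_eq by (rule sum.mono_neutral_left) (use assms in auto)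

lemmas entry_simps =
  zero_rcf_matrix.rep_eq one_rcf_matrix.rep_eq plus_rcf_matrix.rep_eq uminus_rcf_matrix.rep_eq
  scaleR_rcf_matrix.rep_eq

instance
proof
  fix f g h :: "'a rcf_matrix" and r s :: real
  show "f * g * h = f * (g * h)"
  proof (rule rcf_matrix_eqI)
    fix i j
    let ?B = "{k. entry f i k \<noteq> 0}"
    let ?A = "\<Union>k\<in>?B. {l. entry g k l \<noteq> 0}"
    have A: "finite ?A" using finite_row by blast
    have fg: "entry (f * g) i l = (\<Sum>k\<in>?B. entry f i k * entry g k l)" for l
      by (rule entry_mult) (auto simp: finite_row)
    have "{l. entry (f * g) i l \<noteq> 0} \<subseteq> ?A"
    proof
      fix l assume "l \<in> {l. entry (f * g) i l \<noteq> 0}"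
      then have "(\<Sum>k\<in>?B. entry f i k * entry g k l) \<noteq> 0" by (simp only: fg mem_Collect_eq not_False_eq_True)
      then obtain k where "k \<in> ?B" "entry f i k * entry g k l \<noteq> 0" by (rule sum.not_neutral_contains_not_neutral)
      then show "l \<in> ?A" by auto
    qed
    then have "entry (f * g * h) i j = (\<Sum>l\<in>?A. entry (f * g) i l * entry h l j)"
      by (intro entry_mult A)
    also have "\<dots> = (\<Sum>l\<in>?A. \<Sum>k\<in>?B. entry f i k * (entry g k l * entry h l j))"
      by (simp only: fg sum_distrib_right mult.assoc)
    also have "\<dots> = (\<Sum>k\<in>?B. \<Sum>l\<in>?A. entry f i k * (entry g k l * entry h l j))" by (rule sum.swap)
    also have "\<dots> = (\<Sum>k\<in>?B. entry f i k * entry (g * h) k j)"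
    proof (intro sum.cong refl)
      fix k assume "k \<in> ?B"
      then have "entry (g * h) k j = (\<Sum>l\<in>?A. entry g k l * entry h l j)"
        by (intro entry_mult A) auto
      then show "(\<Sum>l\<in>?A. entry f i k * (entry g k l * entry h l j)) = entry f i k * entry (g * h) k j"
        by (simp add: sum_distrib_left)
    qed
    also have "\<dots> = entry (f * (g * h)) i j"
      by (rule entry_mult[symmetric]) (auto simp: finite_row)
    finally show "entry (f * g * h) i j = entry (f * (g * h)) i j" .
  qed
  show "(f + g) * h = f * h + g * h"
  proof (rule rcf_matrix_eqI)
    fix i j
    let ?K = "{k. entry f i k \<noteq> 0} \<union> {k. entry g i k \<noteq> 0}"
    have K: "finite ?K" by (simp add: finite_row)
    have "entry ((f + g) * h) i j = (\<Sum>k\<in>?K. entry (f + g) i k * entry h k j)"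
      by (rule entry_mult[OF K]) (auto simp: entry_simps)
    moreover have "entry (f * h) i j = (\<Sum>k\<in>?K. entry f i k * entry h k j)"
      by (rule entry_mult[OF K]) auto
    moreover have "entry (g * h) i j = (\<Sum>k\<in>?K. entry g i k * entry h k j)"
      by (rule entry_mult[OF K]) auto
    ultimately show "entry ((f + g) * h) i j = entry (f * h + g * h) i j"
      by (simp add: entry_simps distrib_right sum.distrib)
  qed
  show "f * (g + h) = f * g + f * h"
    by (rule rcf_matrix_eqI) (simp add: times_rcf_matrix.rep_eq entry_simps distrib_left sum.distrib)
  show "1 * f = f"
  proof (rule rcf_matrix_eqI)
    show "entry (1 * f) i j = entry f i j" for i j
      by (subst entry_mult[of "{i}"]) (auto simp: entry_simps)
  qed
  show "f * 1 = f"
  proof (rule rcf_matrix_eqI)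
    show "entry (f * 1) i j = entry f i j" for i j
      using finite_row[of f i]
      by (subst entry_mult[of "{k. entry f i k \<noteq> 0}"])
        (auto simp: entry_simps if_distrib[of "\<lambda>u. _ * u"] cong: if_cong)
  qed
  show "f + g + h = f + (g + h)" "f + g = g + f" "0 + f = f" "- f + f = 0" "f - g = f + - g"
    by (rule rcf_matrix_eqI, simp add: entry_simps minus_rcf_matrix_def add_ac)+
  have "entry (0 :: 'a rcf_matrix) 0 0 \<noteq> entry 1 0 0" by (simp add: entry_simps)
  then show "(0 :: 'a rcf_matrix) \<noteq> 1" by metis
  show "r *\<^sub>R (f + g) = r *\<^sub>R f + r *\<^sub>R g" "(r + s) *\<^sub>R f = r *\<^sub>R f + s *\<^sub>R f"
    "r *\<^sub>R s *\<^sub>R f = (r * s) *\<^sub>R f" "1 *\<^sub>R f = f"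
    by (rule rcf_matrix_eqI, simp add: entry_simps algebra_simps)+
  show "(r *\<^sub>R f) * g = r *\<^sub>R (f * g)"
  proof (rule rcf_matrix_eqI)
    fix i j
    have "entry ((r *\<^sub>R f) * g) i j = (\<Sum>k\<in>{k. entry f i k \<noteq> 0}. entry (r *\<^sub>R f) i k * entry g k j)"
      by (rule entry_mult) (auto simp: finite_row entry_simps)
    then show "entry ((r *\<^sub>R f) * g) i j = entry (r *\<^sub>R (f * g)) i j"
      by (simp add: times_rcf_matrix.rep_eq entry_simps scaleR_sum_right)
  qed
  show "f * (r *\<^sub>R g) = r *\<^sub>R (f * g)"
    by (rule rcf_matrix_eqI) (simp add: times_rcf_matrix.rep_eq entry_simps scaleR_sum_right)
qed

end

lemma entry_diff: "entry (f - g) i j = entry f i j - entry g i j"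
  for f g :: "'a::real_algebra_1 rcf_matrix"
  unfolding minus_rcf_matrix_def plus_rcf_matrix.rep_eq uminus_rcf_matrix.rep_eq by simp

lift_definition rcf_adj :: "'a::cstar_algebra rcf_matrix \<Rightarrow> 'a rcf_matrix" is "\<lambda>f i j. star (f j i)"
proof -
  have "star x \<noteq> 0 \<longleftrightarrow> x \<noteq> 0" for x :: 'a by (metis star_star star_zero)
  then show "?thesis f" if "(\<forall>i. finite {j. f i j \<noteq> 0}) \<and> (\<forall>j. finite {i. f i j \<noteq> 0})" for f :: "nat \<Rightarrow> nat \<Rightarrow> 'a"
    using that by simp
qed

interpretation rcf: star_ring "rcf_adj :: 'a::cstar_algebra rcf_matrix \<Rightarrow> 'a rcf_matrix"
proof
  fix f g :: "'a rcf_matrix" and r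
  show "rcf_adj (rcf_adj f) = f" "rcf_adj (f + g) = rcf_adj f + rcf_adj g"
    "rcf_adj (r *\<^sub>R f) = r *\<^sub>R rcf_adj f"
    by (rule rcf_matrix_eqI, simp add: entry_simps rcf_adj.rep_eq star_star star_add star_scaleR)+
  show "rcf_adj (f * g) = rcf_adj g * rcf_adj f"
  proof (rule rcf_matrix_eqI)
    fix i j
    let ?K = "{k. entry f j k \<noteq> 0} \<union> {k. entry g k i \<noteq> 0}"
    have K: "finite ?K" by (simp add: finite_row finite_column)
    have "entry (f * g) j i = (\<Sum>k\<in>?K. entry f j k * entry g k i)"
      by (rule entry_mult[OF K]) auto
    moreover have "entry (rcf_adj g * rcf_adj f) i j = (\<Sum>k\<in>?K. entry (rcf_adj g) i k * entry (rcf_adj f) k j)"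
      by (rule entry_mult[OF K]) (auto simp: rcf_adj.rep_eq)
    ultimately show "entry (rcf_adj (f * g)) i j = entry (rcf_adj g * rcf_adj f) i j"
      by (simp add: rcf_adj.rep_eq star_sum star_mult)
  qed
qed


section \<open>Transfer between Gram matrices and the ring of infinite matrices\<close>

lemma gram_adjoint:
  assumes "gram I x" "\<alpha> \<in> I" "\<beta> \<in> I"
  shows "star (x \<alpha> \<beta>) = x \<beta> \<alpha>"
proof -
  have "star (\<Sum>b\<leftarrow>bs. star (b \<alpha>) * b \<beta>) = (\<Sum>b\<leftarrow>bs. star (b \<beta>) * b \<alpha>)" for bs :: "('i \<Rightarrow> 'b::cstar_algebra) list" and \<alpha> \<beta>
    by (induction bs) (simp_all add: star_add star_mult star_star)
  then show ?thesis using assms by (auto simp: gram_def)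
qed

text \<open>Rectangular, since a Gram family of arbitrary length over \<open>p\<close> columns has
  to become one ring element.\<close>

lift_definition block :: "nat \<Rightarrow> nat \<Rightarrow> (nat \<Rightarrow> nat \<Rightarrow> 'a::zero) \<Rightarrow> 'a rcf_matrix"
  is "\<lambda>m p f i j. if i < m \<and> j < p then f i j else 0"
proof (intro conjI allI)
  fix m p and f :: "nat \<Rightarrow> nat \<Rightarrow> 'a"
  show "finite {j. (if i < m \<and> j < p then f i j else 0) \<noteq> 0}" for i
    by (rule finite_subset[of _ "{..<p}"]) (auto split: if_splits)
  show "finite {i. (if i < m \<and> j < p then f i j else 0) \<noteq> 0}" for j
    by (rule finite_subset[of _ "{..<m}"]) (auto split: if_splits)
qed

lemma adj_block_mult_block:
  "rcf_adj (block L p f) * block L p g = block p p (\<lambda>i j. \<Sum>l<L. star (f l i) * g l j)"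
proof (rule rcf_matrix_eqI)
  fix i j
  have "entry (rcf_adj (block L p f) * block L p g) i j
      = (\<Sum>l<L. entry (rcf_adj (block L p f)) i l * entry (block L p g) l j)"
    by (rule entry_mult) (auto simp: rcf_adj.rep_eq block.rep_eq split: if_splits)
  also have "\<dots> = entry (block p p (\<lambda>i j. \<Sum>l<L. star (f l i) * g l j)) i j"
    by (auto simp: rcf_adj.rep_eq block.rep_eq intro!: sum.neutral)
  finally show "entry (rcf_adj (block L p f) * block L p g) i j
      = entry (block p p (\<lambda>i j. \<Sum>l<L. star (f l i) * g l j)) i j" .
qed

lemma sos_block:
  assumes "gram {..<p} x"
  shows "rcf.sos (block p p x)"
proof -
  obtain bs where bs: "\<And>i j. i < p \<Longrightarrow> j < p \<Longrightarrow> x i j = (\<Sum>b\<leftarrow>bs. star (b i) * b j)"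
    using assms unfolding gram_def by auto
  have "rcf.sos (block p p (\<lambda>i j. \<Sum>b\<leftarrow>bs. star (b i) * b j))"
  proof (induction bs)
    case Nil
    have "block p p (\<lambda>i j. 0) = (0 :: 'a rcf_matrix)"
      by (rule rcf_matrix_eqI) (simp add: block.rep_eq entry_simps)
    then show ?case by (simp add: rcf.sos_zero)
  next
    case (Cons b bs)
    have "block p p (\<lambda>i j. \<Sum>b\<leftarrow>b # bs. star (b i) * b j)
        = rcf_adj (block 1 p (\<lambda>_ i. b i)) * block 1 p (\<lambda>_ i. b i) + block p p (\<lambda>i j. \<Sum>b\<leftarrow>bs. star (b i) * b j)"
      unfolding adj_block_mult_block by (rule rcf_matrix_eqI) (simp add: block.rep_eq entry_simps)
    then show ?case using rcf.sos_add[OF rcf.sos_square Cons.IH] by simp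
  qed
  moreover have "block p p x = block p p (\<lambda>i j. \<Sum>b\<leftarrow>bs. star (b i) * b j)"
    by (rule rcf_matrix_eqI) (simp add: block.rep_eq bs)
  ultimately show ?thesis by simp
qed

text \<open>The rows of a Gram family of \<open>h\<close>, split by block index, form the ring
  elements \<open>R a\<close>. \<open>Q\<close> has the off-diagonal blocks of \<open>h\<close>
  transposed, because the entry \<open>(0, a)\<close> of the matrix it is paired with is a matrix
  unit in column 0.\<close>

lemma gram_schur_complement:
  fixes p n :: nat and h :: "nat \<times> nat \<Rightarrow> nat \<times> nat \<Rightarrow> 'a::cstar_algebra"
  assumes n: "1 \<le> n" and g: "gram ({..<p} \<times> {..n}) h"
    and diag: "\<And>i j a b. i < p \<Longrightarrow> j < p \<Longrightarrow> a \<in> {1..n} \<Longrightarrow> b \<in> {1..n} \<Longrightarrow>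
      h (i, a) (j, b) = (if a = b then h (i, 1) (j, 1) else 0)"
    and \<nu>: "0 < \<nu>"
  obtains Q where "gram ({..<p} \<times> {..n}) Q"
    "\<And>i j. i < p \<Longrightarrow> j < p \<Longrightarrow> Q (i, 0) (j, 0) = h (i, 1) (j, 1) + (if i = j then of_real (2 * \<nu>) else 0)"
    "\<And>i j a. i < p \<Longrightarrow> j < p \<Longrightarrow> a \<in> {1..n} \<Longrightarrow> Q (i, 0) (j, a) = h (i, a) (j, 0)"
    "\<And>i j a. i < p \<Longrightarrow> j < p \<Longrightarrow> a \<in> {1..n} \<Longrightarrow> Q (i, a) (j, 0) = h (i, 0) (j, a)"
    "\<And>i j. i < p \<Longrightarrow> j < p \<Longrightarrow> (\<Sum>a\<in>{1..n}. Q (i, a) (j, a)) = h (i, 0) (j, 0)"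
proof -
  obtain bs where bs: "\<And>\<alpha> \<beta>. \<alpha> \<in> {..<p} \<times> {..n} \<Longrightarrow> \<beta> \<in> {..<p} \<times> {..n} \<Longrightarrow>
      h \<alpha> \<beta> = (\<Sum>b\<leftarrow>bs. star (b \<alpha>) * b \<beta>)"
    using g unfolding gram_def by blast
  define R where "R a = block (length bs) p (\<lambda>l i. (bs ! l) (i, a))" for a
  define c where "c = block p p (\<lambda>i j. h (i, 1) (j, 1))"
  have RR: "rcf_adj (R a) * R b = block p p (\<lambda>i j. h (i, a) (j, b))" if "a \<le> n" "b \<le> n" for a b
    unfolding R_def adj_block_mult_block
    by (rule rcf_matrix_eqI)
      (simp add: block.rep_eq bs that sum_list_sum_nth lessThan_atLeast0)
  have RRc: "rcf_adj (R a) * R b = (if a = b then c else 0)" if "a \<in> {1..n}" "b \<in> {1..n}" for a b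
  proof -
    have "rcf_adj (R a) * R b = block p p (\<lambda>i j. h (i, a) (j, b))" using that by (intro RR) auto
    also have "\<dots> = (if a = b then c else 0)"
      unfolding c_def by (rule rcf_matrix_eqI) (simp add: block.rep_eq entry_simps diag[OF _ _ that])
    finally show ?thesis .
  qed
  have h_adj: "star (h (j, 1) (i, 1)) = h (i, 1) (j, 1)" if "i < p" "j < p" for i j
    using gram_adjoint[OF g, of "(j, 1)" "(i, 1)"] that n by simp
  \<comment> \<open>The factor \<open>-1/2\<close> is there because the lemma bounds
    \<open>x + star x\<close>, which becomes \<open>- h\<close>.\<close>
  obtain t where "0 \<le> t" and t: "gram {..<p} (\<lambda>i j. (if i = j then of_real t else 0)
      + ((- (1/2)) *\<^sub>R h (i, 1) (j, 1) + star ((- (1/2)) *\<^sub>R h (j, 1) (i, 1))))"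
    using gram_archimedean[of "{..<p}" "\<lambda>i j. (- (1/2)) *\<^sub>R h (i, 1) (j, 1)"] by auto
  have half: "(- (1/2)) *\<^sub>R x + (- (1/2)) *\<^sub>R x = - x" for x :: 'a
    by (subst scaleR_add_left[symmetric]) simp
  have "gram {..<p} (\<lambda>i j. (if i = j then of_real t else 0) - h (i, 1) (j, 1))"
    by (rule gram_cong[THEN iffD1, OF _ t]) (simp only: star_scaleR h_adj half lessThan_iff diff_conv_add_uminus)
  then have s1: "rcf.sos (block p p (\<lambda>i j. (if i = j then of_real t else 0) - h (i, 1) (j, 1)))"
    by (rule sos_block)
  \<comment> \<open>The ring unit is the infinite identity, so \<open>of_real t - c\<close> is
    \<open>t\<close> times the identity off the \<open>p\<close> by \<open>p\<close> corner; this
    projection accounts for that part.\<close>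
  define P where "P = (1 :: 'a rcf_matrix) - block p p (\<lambda>i j. if i = j then 1 else 0)"
  have E: "entry P i j = (if i = j \<and> p \<le> i then 1 else 0)" for i j
    by (simp add: P_def entry_diff entry_simps block.rep_eq)
  have "rcf_adj P * P = P"
  proof (rule rcf_matrix_eqI)
    fix i j
    have "entry (rcf_adj P * P) i j = (\<Sum>k\<in>{i}. entry (rcf_adj P) i k * entry P k j)"
      by (rule entry_mult) (auto simp: rcf_adj.rep_eq E split: if_splits)
    then show "entry (rcf_adj P * P) i j = entry P i j" by (auto simp: rcf_adj.rep_eq E)
  qed
  then have "rcf.sos P" using rcf.sos_square[of P] by simp
  \<comment> \<open>The additional 1 makes the bound \<open>t + 1\<close> strictly positive.\<close>
  then have "rcf.sos (block p p (\<lambda>i j. (if i = j then of_real t else 0) - h (i, 1) (j, 1)) + t *\<^sub>R P + of_real 1)"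
    by (intro rcf.sos_add[OF rcf.sos_add[OF s1 rcf.sos_scaleR] rcf.sos_of_real] \<open>0 \<le> t\<close>) simp_all
  also have "block p p (\<lambda>i j. (if i = j then of_real t else 0) - h (i, 1) (j, 1)) + t *\<^sub>R P + of_real 1
      = of_real (t + 1) - c"
    by (rule rcf_matrix_eqI)
      (auto simp: of_real_def entry_diff entry_simps block.rep_eq E c_def scaleR_left.add)
  finally have s2: "rcf.sos (of_real (t + 1) - c)" .
  have "0 < t + 1" using \<open>0 \<le> t\<close> by simp
  obtain bs' :: "(nat \<Rightarrow> 'a rcf_matrix) list" where
    b0: "(\<Sum>b\<leftarrow>bs'. rcf_adj (b 0) * b 0) = c + of_real (2 * \<nu>)"
    and b1: "\<And>i. i \<in> {1..n} \<Longrightarrow> (\<Sum>b\<leftarrow>bs'. rcf_adj (b 0) * b i) = rcf_adj (R i) * R 0"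
    and b2: "(\<Sum>i\<in>{1..n}. \<Sum>b\<leftarrow>bs'. rcf_adj (b i) * b i) = rcf_adj (R 0) * R 0"
    using rcf.approximate_schur_complement[OF n RRc s2 \<open>0 < t + 1\<close> \<nu>] by blast
  define Q where "Q = (\<lambda>(i, a) (j, b). entry (\<Sum>\<beta>\<leftarrow>bs'. rcf_adj (\<beta> a) * \<beta> b) i j)"
  have entry_sum: "entry (\<Sum>s\<in>S. f s) i j = (\<Sum>s\<in>S. entry (f s) i j)" for S :: "nat set" and f :: "nat \<Rightarrow> 'a rcf_matrix" and i j
    by (induction S rule: infinite_finite_induct) (simp_all add: entry_simps)
  have gQ: "gram ({..<p} \<times> {..n}) Q"
    unfolding Q_def
  proof (induction bs')
    case Nil
    show ?case by (rule gram_cong[THEN iffD1, OF _ gram_zero]) (auto simp: entry_simps)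
  next
    case (Cons \<beta> bs')
    let ?K = "\<Union>\<alpha>\<in>{..<p} \<times> {..n}. {k. entry (\<beta> (snd \<alpha>)) k (fst \<alpha>) \<noteq> 0}"
    have K: "finite ?K" using finite_column by blast
    have "gram ({..<p} \<times> {..n}) (\<lambda>\<alpha> \<gamma>. \<Sum>k\<in>?K. star (entry (\<beta> (snd \<alpha>)) k (fst \<alpha>)) * entry (\<beta> (snd \<gamma>)) k (fst \<gamma>))"
      by (intro gram_sum gram_row)
    from gram_add[OF this Cons.IH] show ?case
    proof (rule gram_cong[THEN iffD1, rotated])
      fix \<alpha> \<gamma> :: "nat \<times> nat" assume \<alpha>: "\<alpha> \<in> {..<p} \<times> {..n}"
      obtain i a j b where [simp]: "\<alpha> = (i, a)" "\<gamma> = (j, b)" by (metis surj_pair)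
      have "entry (rcf_adj (\<beta> a) * \<beta> b) i j = (\<Sum>k\<in>?K. entry (rcf_adj (\<beta> a)) i k * entry (\<beta> b) k j)"
      proof (rule entry_mult[OF K])
        show "{k. entry (rcf_adj (\<beta> a)) i k \<noteq> 0} \<subseteq> ?K"
        proof
          fix k assume "k \<in> {k. entry (rcf_adj (\<beta> a)) i k \<noteq> 0}"
          then have "entry (\<beta> a) k i \<noteq> 0" by (auto simp: rcf_adj.rep_eq)
          then have "k \<in> {k. entry (\<beta> (snd \<alpha>)) k (fst \<alpha>) \<noteq> 0}" by simp
          with \<alpha> show "k \<in> ?K" by (rule UN_I)
        qed
      qed
      then show "(\<Sum>k\<in>?K. star (entry (\<beta> (snd \<alpha>)) k (fst \<alpha>)) * entry (\<beta> (snd \<gamma>)) k (fst \<gamma>))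
          + (case \<alpha> of (i, a) \<Rightarrow> \<lambda>(j, b). entry (\<Sum>\<beta>\<leftarrow>bs'. rcf_adj (\<beta> a) * \<beta> b) i j) \<gamma>
          = (case \<alpha> of (i, a) \<Rightarrow> \<lambda>(j, b). entry (\<Sum>\<beta>\<leftarrow>\<beta> # bs'. rcf_adj (\<beta> a) * \<beta> b) i j) \<gamma>"
        by (simp add: rcf_adj.rep_eq entry_simps)
    qed
  qed
  show thesis
  proof (rule that[OF gQ])
    fix i j assume ij: "i < p" "j < p"
    show "Q (i, 0) (j, 0) = h (i, 1) (j, 1) + (if i = j then of_real (2 * \<nu>) else 0)"
      unfolding Q_def split b0 using ij by (simp only: c_def entry_simps block.rep_eq of_real_def) simp
    show "(\<Sum>a\<in>{1..n}. Q (i, a) (j, a)) = h (i, 0) (j, 0)"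
      unfolding Q_def split entry_sum[symmetric] b2 using ij by (simp add: RR block.rep_eq)
  next
    have Q0: "Q (i, 0) (j, a) = h (i, a) (j, 0)" if "i < p" "j < p" "a \<in> {1..n}" for i j a
      unfolding Q_def split b1[OF that(3)] using that by (simp add: RR block.rep_eq)
    fix i j a assume ija: "i < p" "j < p" "a \<in> {1..n}"
    show "Q (i, 0) (j, a) = h (i, a) (j, 0)" using Q0[OF ija] .
    have "Q (i, a) (j, 0) = star (Q (j, 0) (i, a))"
      by (rule gram_adjoint[OF gQ, symmetric]) (use ija in auto)
    also have "\<dots> = star (h (j, a) (i, 0))" using Q0[of j i a] ija by simp
    also have "\<dots> = h (i, 0) (j, a)"
      by (rule gram_adjoint[OF g]) (use ija in auto)
    finally show "Q (i, a) (j, 0) = h (i, 0) (j, a)" .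
  qed
qed

section \<open>Kronecker products of positive semidefinite matrices\<close>

text \<open>The nonnegative axis is closed. This removes the \<open>\<epsilon>\<close> that comes
  with the factorization of a semidefinite matrix and with the maximal cone.\<close>

lemma nonneg_Reals_limit:
  fixes q r :: complex
  assumes "\<And>\<epsilon>. 0 < \<epsilon> \<Longrightarrow> q + of_real \<epsilon> * r \<in> \<real>\<^sub>\<ge>\<^sub>0"
  shows "q \<in> \<real>\<^sub>\<ge>\<^sub>0"
proof -
  have "Im q = 0" using assms[of 1] assms[of 2] by (simp add: complex_nonneg_Reals_iff)
  moreover have "0 \<le> Re q"
  proof (rule ccontr)
    assume "\<not> 0 \<le> Re q"
    define \<epsilon> where "\<epsilon> = - Re q / (2 * (\<bar>Re r\<bar> + 1))"
    have "0 < \<epsilon>" unfolding \<epsilon>_def using \<open>\<not> 0 \<le> Re q\<close> by (intro divide_pos_pos) auto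
    have "\<epsilon> * Re r \<le> \<epsilon> * (\<bar>Re r\<bar> + 1)" using \<open>0 < \<epsilon>\<close> by (intro mult_left_mono) auto
    also have "\<dots> = - Re q / 2" by (simp add: \<epsilon>_def field_simps)
    finally have "Re q + \<epsilon> * Re r < 0" using \<open>\<not> 0 \<le> Re q\<close> by simp
    then show False using assms[OF \<open>0 < \<epsilon>\<close>] by (simp add: complex_nonneg_Reals_iff)
  qed
  ultimately show ?thesis by (simp add: complex_nonneg_Reals_iff)
qed

lemma cnj_mult_nonneg: "cnj z * z \<in> \<real>\<^sub>\<ge>\<^sub>0"
  by (simp add: complex_nonneg_Reals_iff mult.commute[of "cnj z"] complex_mult_cnj)

text \<open>Adding \<open>\<epsilon>\<close> makes the form definite, so orthonormalization replaces
  a spectral decomposition: \<open>A + \<epsilon>\<close> is the Gram matrix of the standard basis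
  vectors, hence of their coordinate vectors in \<open>G\<close>.\<close>

lemma psd_factor:
  assumes fin: "finite I" and A: "psd I A" and \<epsilon>: "0 < \<epsilon>"
  obtains N :: nat and G
  where "\<And>i j. i \<in> I \<Longrightarrow> j \<in> I \<Longrightarrow>
    A i j + (if i = j then of_real \<epsilon> else 0) = (\<Sum>k<N. cnj (G k i) * G k j)"
proof -
  define A' where "A' i j = A i j + (if i = j then of_real \<epsilon> else 0)" for i j
  define S where "S x y = (\<Sum>i\<in>I. \<Sum>j\<in>I. cnj (x i) * A' i j * y j)" for x y
  have "\<exists>(N::nat) v G. (\<forall>k<N. \<forall>l<N. S (v k) (v l) = (if k = l then 1 else 0))
      \<and> (\<forall>i\<in>I. \<forall>j. (\<Sum>k<N. G k i * v k j) = (if i = j then 1 else 0))"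
  proof (rule gram_schmidt[of I S, OF fin])
    show "S (\<lambda>i. x i + y i) z = S x z + S y z" for x y z
      by (simp add: S_def distrib_right sum.distrib)
    show "S (\<lambda>i. c * x i) z = cnj c * S x z" for c x z
      by (simp add: S_def sum_distrib_left mult.assoc)
    show "S y x = cnj (S x y)" for x y
    proof -
      have "cnj (S x y) = (\<Sum>i\<in>I. \<Sum>j\<in>I. cnj (y j) * A' j i * x i)"
        unfolding S_def cnj_sum
      proof (intro sum.cong refl)
        fix i j assume "i \<in> I" "j \<in> I"
        then show "cnj (cnj (x i) * A' i j * y j) = cnj (y j) * A' j i * x i"
          using psd_hermitian[OF fin A, of i j] by (simp add: A'_def)
      qed
      also have "\<dots> = S y x" unfolding S_def by (rule sum.swap)
      finally show ?thesis by simp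
    qed
    show "0 < Re (S x x)" if "x \<noteq> (\<lambda>_. 0)" "\<And>i. i \<notin> I \<Longrightarrow> x i = 0" for x
    proof -
      obtain \<gamma> where \<gamma>: "x \<gamma> \<noteq> 0" using \<open>x \<noteq> (\<lambda>_. 0)\<close> by auto
      have "S x x = (\<Sum>i\<in>I. \<Sum>j\<in>I. cnj (x i) * A i j * x j + (if i = j then of_real \<epsilon> * (cnj (x i) * x i) else 0))"
        unfolding S_def A'_def by (intro sum.cong refl) (simp add: algebra_simps)
      also have "\<dots> = (\<Sum>i\<in>I. \<Sum>j\<in>I. cnj (x i) * A i j * x j) + of_real \<epsilon> * (\<Sum>i\<in>I. cnj (x i) * x i)"
        using fin by (simp add: sum.distrib sum_distrib_left)
      finally have "Re (S x x) = Re (\<Sum>i\<in>I. \<Sum>j\<in>I. cnj (x i) * A i j * x j) + \<epsilon> * Re (\<Sum>i\<in>I. cnj (x i) * x i)"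
        by simp
      moreover have "0 \<le> Re (\<Sum>i\<in>I. \<Sum>j\<in>I. cnj (x i) * A i j * x j)"
        using A[unfolded psd_def, rule_format, of x] unfolding complex_nonneg_Reals_iff by (rule conjunct1)
      moreover have "Re (\<Sum>i\<in>I. cnj (x i) * x i) = (\<Sum>i\<in>I. (cmod (x i))\<^sup>2)"
        by (simp add: cmod_power2) (simp add: power2_eq_square)
      moreover have "(\<Sum>i\<in>I. (cmod (x i))\<^sup>2) > 0"
        using \<gamma> that(2) fin by (intro sum_pos2[of I \<gamma>]) auto
      ultimately show ?thesis using \<epsilon> by (simp add: add_nonneg_pos)
    qed
  qed blast
  then obtain N :: nat and v G where
    orth: "\<And>k l. k < N \<Longrightarrow> l < N \<Longrightarrow> S (v k) (v l) = (if k = l then 1 else 0)"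
    and G: "\<And>i j. i \<in> I \<Longrightarrow> (\<Sum>k<N. G k i * v k j) = (if i = j then 1 else 0)"
    by blast
  show thesis
  proof (rule that[of G N])
    fix i j assume I: "i \<in> I" "j \<in> I"
    let ?e = "\<lambda>k l \<gamma> \<delta>. cnj (G k i * v k \<gamma>) * A' \<gamma> \<delta> * (G l j * v l \<delta>)"
    have "(\<Sum>k<N. cnj (G k i) * G k j) = (\<Sum>k<N. \<Sum>l<N. cnj (G k i) * S (v k) (v l) * G l j)"
      by (simp add: orth if_distrib[of "\<lambda>u. _ * u"] if_distrib[of "\<lambda>u. u * _"] cong: if_cong)
    also have "\<dots> = (\<Sum>k<N. \<Sum>l<N. \<Sum>\<gamma>\<in>I. \<Sum>\<delta>\<in>I. ?e k l \<gamma> \<delta>)"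
      unfolding S_def by (simp add: sum_distrib_left sum_distrib_right mult_ac)
    also have "\<dots> = (\<Sum>k<N. \<Sum>\<gamma>\<in>I. \<Sum>l<N. \<Sum>\<delta>\<in>I. ?e k l \<gamma> \<delta>)"
      by (intro sum.cong refl) (rule sum.swap)
    also have "\<dots> = (\<Sum>\<gamma>\<in>I. \<Sum>k<N. \<Sum>\<delta>\<in>I. \<Sum>l<N. ?e k l \<gamma> \<delta>)"
      by (subst sum.swap, intro sum.cong refl) (rule sum.swap)
    also have "\<dots> = (\<Sum>\<gamma>\<in>I. \<Sum>\<delta>\<in>I. \<Sum>k<N. \<Sum>l<N. ?e k l \<gamma> \<delta>)"
      by (intro sum.cong refl) (rule sum.swap)
    also have "\<dots> = (\<Sum>\<gamma>\<in>I. \<Sum>\<delta>\<in>I. cnj (\<Sum>k<N. G k i * v k \<gamma>) * A' \<gamma> \<delta> * (\<Sum>l<N. G l j * v l \<delta>))"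
      by (intro sum.cong refl, simp only: cnj_sum sum_distrib_left sum_distrib_right, rule sum.swap)
    also have "\<dots> = (\<Sum>\<gamma>\<in>I. \<Sum>\<delta>\<in>I. if \<gamma> = i then (if \<delta> = j then A' \<gamma> \<delta> else 0) else 0)"
      by (intro sum.cong refl) (use I in \<open>auto simp: G\<close>)
    also have "\<dots> = A' i j" using I fin by (subst sum.swap) simp
    finally show "A i j + (if i = j then of_real \<epsilon> else 0) = (\<Sum>k<N. cnj (G k i) * G k j)"
      by (simp add: A'_def)
  qed
qed

text \<open>Factoring \<open>A + \<epsilon>\<close> turns the form into a sum over \<open>k\<close>
  of values of the form of \<open>B\<close>, at the vectors
  \<open>\<Sum>i\<in>I. G k i * \<eta> i j\<close>; then \<open>\<epsilon>\<close> tends to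
  0.\<close>

lemma psd_kronecker:
  assumes fin: "finite I" "finite J" and A: "psd I A" and B: "psd J B"
  shows "(\<Sum>i\<in>I. \<Sum>j\<in>J. \<Sum>i'\<in>I. \<Sum>j'\<in>J. cnj (\<eta> i j) * (A i i' * B j j') * \<eta> i' j') \<in> \<real>\<^sub>\<ge>\<^sub>0"
    (is "?q \<in> _")
proof (rule nonneg_Reals_limit)
  fix \<epsilon> :: real assume \<epsilon>: "0 < \<epsilon>"
  let ?r = "\<Sum>i\<in>I. \<Sum>j\<in>J. \<Sum>j'\<in>J. cnj (\<eta> i j) * B j j' * \<eta> i j'"
  obtain N :: nat and G where G: "\<And>\<alpha> \<beta>. \<alpha> \<in> I \<Longrightarrow> \<beta> \<in> I \<Longrightarrow>
    A \<alpha> \<beta> + (if \<alpha> = \<beta> then of_real \<epsilon> else 0) = (\<Sum>k<N. cnj (G k \<alpha>) * G k \<beta>)"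
    by (rule psd_factor[OF fin(1) A \<epsilon>]) (rule that)
  let ?e = "\<lambda>k i j i' j'. cnj (G k i * \<eta> i j) * B j j' * (G k i' * \<eta> i' j')"
  have "?q + of_real \<epsilon> * ?r = (\<Sum>i\<in>I. \<Sum>j\<in>J. \<Sum>i'\<in>I. \<Sum>j'\<in>J.
      cnj (\<eta> i j) * ((A i i' + (if i = i' then of_real \<epsilon> else 0)) * B j j') * \<eta> i' j')"
  proof -
    have "of_real \<epsilon> * ?r = (\<Sum>i\<in>I. \<Sum>j\<in>J. \<Sum>i'\<in>I. if i = i' then \<Sum>j'\<in>J. of_real \<epsilon> * (cnj (\<eta> i j) * B j j' * \<eta> i j') else 0)"
      using fin by (simp add: sum_distrib_left)
    also have "\<dots> = (\<Sum>i\<in>I. \<Sum>j\<in>J. \<Sum>i'\<in>I. \<Sum>j'\<in>J. cnj (\<eta> i j) * ((if i = i' then of_real \<epsilon> else 0) * B j j') * \<eta> i' j')"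
      by (intro sum.cong refl) (auto simp: mult_ac)
    finally show ?thesis by (simp add: algebra_simps flip: sum.distrib)
  qed
  also have "\<dots> = (\<Sum>i\<in>I. \<Sum>j\<in>J. \<Sum>i'\<in>I. \<Sum>j'\<in>J. \<Sum>k<N. ?e k i j i' j')"
    by (intro sum.cong refl) (simp add: G sum_distrib_left sum_distrib_right mult_ac)
  also have "\<dots> = (\<Sum>i\<in>I. \<Sum>j\<in>J. \<Sum>j'\<in>J. \<Sum>i'\<in>I. \<Sum>k<N. ?e k i j i' j')"
    by (intro sum.cong refl) (rule sum.swap)
  also have "\<dots> = (\<Sum>i\<in>I. \<Sum>j\<in>J. \<Sum>j'\<in>J. \<Sum>k<N. \<Sum>i'\<in>I. ?e k i j i' j')"
    by (intro sum.cong refl) (rule sum.swap)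
  also have "\<dots> = (\<Sum>i\<in>I. \<Sum>j\<in>J. \<Sum>k<N. \<Sum>j'\<in>J. \<Sum>i'\<in>I. ?e k i j i' j')"
    by (intro sum.cong refl) (rule sum.swap)
  also have "\<dots> = (\<Sum>i\<in>I. \<Sum>k<N. \<Sum>j\<in>J. \<Sum>j'\<in>J. \<Sum>i'\<in>I. ?e k i j i' j')"
    by (intro sum.cong refl) (rule sum.swap)
  also have "\<dots> = (\<Sum>k<N. \<Sum>j\<in>J. \<Sum>j'\<in>J. \<Sum>i\<in>I. \<Sum>i'\<in>I. ?e k i j i' j')"
    by (subst sum.swap, intro sum.cong refl, subst sum.swap, intro sum.cong refl, rule sum.swap)
  also have "\<dots> = (\<Sum>k<N. \<Sum>j\<in>J. \<Sum>j'\<in>J. cnj (\<Sum>i\<in>I. G k i * \<eta> i j) * B j j' * (\<Sum>i\<in>I. G k i * \<eta> i j'))"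
    by (intro sum.cong refl, simp only: cnj_sum sum_distrib_left sum_distrib_right, rule sum.swap)
  also have "\<dots> \<in> \<real>\<^sub>\<ge>\<^sub>0"
    by (intro nonneg_Reals_sum B[unfolded psd_def, rule_format])
  finally show "?q + of_real \<epsilon> * ?r \<in> \<real>\<^sub>\<ge>\<^sub>0" .
qed

lemma psd_sum_rank_one:
  assumes "finite I"
  shows "psd I (\<lambda>i j. \<Sum>t\<in>T. cnj (w t i) * w t j)"
  unfolding psd_def
proof
  fix x
  have "(\<Sum>i\<in>I. \<Sum>j\<in>I. cnj (x i) * (\<Sum>t\<in>T. cnj (w t i) * w t j) * x j)
      = (\<Sum>i\<in>I. \<Sum>j\<in>I. \<Sum>t\<in>T. cnj (w t i * x i) * (w t j * x j))"
    by (simp add: sum_distrib_left sum_distrib_right mult_ac)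
  also have "\<dots> = (\<Sum>i\<in>I. \<Sum>t\<in>T. \<Sum>j\<in>I. cnj (w t i * x i) * (w t j * x j))"
    by (intro sum.cong refl) (rule sum.swap)
  also have "\<dots> = (\<Sum>t\<in>T. \<Sum>i\<in>I. \<Sum>j\<in>I. cnj (w t i * x i) * (w t j * x j))" by (rule sum.swap)
  also have "\<dots> = (\<Sum>t\<in>T. cnj (\<Sum>i\<in>I. w t i * x i) * (\<Sum>i\<in>I. w t i * x i))"
    by (simp only: cnj_sum sum_product)
  also have "\<dots> \<in> \<real>\<^sub>\<ge>\<^sub>0" by (intro nonneg_Reals_sum cnj_mult_nonneg)
  finally show "(\<Sum>i\<in>I. \<Sum>j\<in>I. cnj (x i) * (\<Sum>t\<in>T. cnj (w t i) * w t j) * x j) \<in> \<real>\<^sub>\<ge>\<^sub>0" .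
qed

section \<open>The maximal cone is contained in the minimal cone\<close>

lemma tensor_map_linear:
  "tensor_map \<phi> \<psi> (u + v) x y = tensor_map \<phi> \<psi> u x y + tensor_map \<phi> \<psi> v x y"
  "tensor_map \<phi> \<psi> (c *\<^sub>C u) x y = c * tensor_map \<phi> \<psi> u x y"
  "tensor_map \<phi> \<psi> (\<Sum>s\<in>S. f s) x y = (\<Sum>s\<in>S. tensor_map \<phi> \<psi> (f s) x y)"
  by (simp_all add: tensor_map_def split_def scaleC_fun_def scaleC_complex_def fun_sum_apply)

text \<open>Under \<open>\<phi> \<otimes> \<psi>\<close> the factorization in the maximal cone
  becomes a conjugation by \<open>X\<close> of a Kronecker product of two semidefinite scalar
  matrices, and \<open>\<epsilon>\<close> disappears in the limit.\<close>

lemma max_positive_imp_min_positive: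
  fixes S :: "'a::complex_vector opsys" and T :: "'b::complex_vector opsys"
  assumes u: "u \<in> mcone (max_tensor S T) p"
  shows "u \<in> mcone (min_tensor S T) p"
proof -
  have mats: "u \<in> mats p (opsys_tensor S T)" using u by (simp add: max_tensor_def)
  have "psd ({..<p} \<times> ({..<k} \<times> {..<m})) (\<lambda>(i, a) (j, b). tensor_map \<phi> \<psi> (u i j) a b)"
    if \<phi>: "ucp S (matrix_opsys k) \<phi>" and \<psi>: "ucp T (matrix_opsys m) \<psi>" for k m \<phi> \<psi>
    unfolding psd_def
  proof
    fix x :: "nat \<times> nat \<times> nat \<Rightarrow> complex"
    let ?X = "{..<p} \<times> ({..<k} \<times> {..<m})"
    let ?t = "\<lambda>x y. tensor_map \<phi> \<psi> (u (fst x) (fst y)) (snd x) (snd y)"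
    have lin: "linear_on (carrier S) \<phi>" "linear_on (carrier T) \<psi>"
      and unit: "\<phi> (ounit S) = unit_mat k" "\<psi> (ounit T) = unit_mat m"
      and \<phi>_cp: "\<forall>p. \<forall>P\<in>mcone S p. (\<lambda>i j. \<phi> (P i j)) \<in> mcone (matrix_opsys k) p"
      and \<psi>_cp: "\<forall>p. \<forall>P\<in>mcone T p. (\<lambda>i j. \<psi> (P i j)) \<in> mcone (matrix_opsys m) p"
      using \<phi> \<psi> by (simp_all add: ucp_def matrix_opsys_def)
    have "(\<Sum>z\<in>?X. \<Sum>y\<in>?X. cnj (x z) * ?t z y * x y) \<in> \<real>\<^sub>\<ge>\<^sub>0"
    proof (rule nonneg_Reals_limit)
      fix \<epsilon> :: real assume "0 < \<epsilon>"
      then obtain K M P Q X where P: "P \<in> mcone S K" and Q: "Q \<in> mcone T M" and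
        eq: "\<And>i j. i < p \<Longrightarrow> j < p \<Longrightarrow>
          (complex_of_real \<epsilon> * unit_mat p i j) *\<^sub>C opsys_pure S T (ounit S) (ounit T) + u i j =
           (\<Sum>a<K. \<Sum>b<M. \<Sum>c<K. \<Sum>d<M.
             (X i a b * cnj (X j c d)) *\<^sub>C opsys_pure S T (P a c) (Q b d))"
        using u unfolding max_tensor_def by auto
      define A where "A = (\<lambda>(a, s) (c, s'). \<phi> (P a c) s s')"
      define B where "B = (\<lambda>(b, t) (d, t'). \<psi> (Q b d) t t')"
      have A: "psd ({..<K} \<times> {..<k}) A"
        using \<phi>_cp[THEN spec, THEN bspec, OF P] by (simp add: matrix_opsys_def A_def)
      have B: "psd ({..<M} \<times> {..<m}) B"
        using \<psi>_cp[THEN spec, THEN bspec, OF Q] by (simp add: matrix_opsys_def B_def)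
      define e where "e z y = unit_mat p (fst z) (fst y) * (unit_mat k (fst (snd z)) (fst (snd y)) * unit_mat m (snd (snd z)) (snd (snd y)))"
        for z y :: "nat \<times> nat \<times> nat"
      \<comment> \<open>The adjoint of \<open>X\<close> applied to \<open>x\<close>, with the
        indices of the two matrix algebras carried along.\<close>
      define \<eta> where "\<eta> z y = (\<Sum>i<p. cnj (X i (fst z) (fst y)) * x (i, snd z, snd y))" for z y
      let ?sum = "\<Sum>z\<in>?X. \<Sum>y\<in>?X. \<Sum>a<K. \<Sum>b<M. \<Sum>c<K. \<Sum>d<M.
          (cnj (x z) * X (fst z) a b) * (A (a, fst (snd z)) (c, fst (snd y)) * B (b, snd (snd z)) (d, snd (snd y)))
            * (cnj (X (fst y) c d) * x y)"
      let ?F = "{..<K} \<times> {..<k}" and ?G = "{..<M} \<times> {..<m}"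
      have tm: "of_real \<epsilon> * e z y + ?t z y = (\<Sum>a<K. \<Sum>b<M. \<Sum>c<K. \<Sum>d<M.
          (X (fst z) a b * cnj (X (fst y) c d)) * (A (a, fst (snd z)) (c, fst (snd y)) * B (b, snd (snd z)) (d, snd (snd y))))"
        if z: "z \<in> ?X" and y: "y \<in> ?X" for z y
      proof -
        obtain i s t j s' t' where [simp]: "z = (i, s, t)" "y = (j, s', t')" by (metis surj_pair)
        have ij: "i < p" "j < p" using z y by auto
        have "tensor_map \<phi> \<psi> ((complex_of_real \<epsilon> * unit_mat p i j) *\<^sub>C opsys_pure S T (ounit S) (ounit T) + u i j) (s, t) (s', t')
            = (complex_of_real \<epsilon> * unit_mat p i j) * (unit_mat k s s' * unit_mat m t t') + tensor_map \<phi> \<psi> (u i j) (s, t) (s', t')"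
          by (simp only: tensor_map_linear tensor_map_pure_tensor[OF lin] unit)
        then show ?thesis unfolding eq[OF ij]
          by (simp add: tensor_map_linear tensor_map_pure_tensor[OF lin] A_def B_def e_def mult_ac)
      qed
      have "(\<Sum>z\<in>?X. \<Sum>y\<in>?X. cnj (x z) * ?t z y * x y) + of_real \<epsilon> * (\<Sum>z\<in>?X. \<Sum>y\<in>?X. cnj (x z) * e z y * x y)
          = (\<Sum>z\<in>?X. \<Sum>y\<in>?X. cnj (x z) * (of_real \<epsilon> * e z y + ?t z y) * x y)"
        by (simp add: sum_distrib_left algebra_simps flip: sum.distrib)
      also have "\<dots> = ?sum"
        by (intro sum.cong refl) (simp add: tm sum_distrib_left sum_distrib_right mult_ac)
      also have "\<dots> = (\<Sum>f\<in>?F. \<Sum>g\<in>?G. \<Sum>f'\<in>?F. \<Sum>g'\<in>?G.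
          cnj (\<eta> f g) * (A f f' * B g g') * \<eta> f' g')"
      proof -
        let ?term = "\<lambda>(i, s, t) (j, s', t') a b c d. (cnj (x (i, s, t)) * X i a b) * (A (a, s) (c, s') * B (b, t) (d, t'))
            * (cnj (X j c d) * x (j, s', t'))"
        let ?L = "{..<p} \<times> {..<k} \<times> {..<m} \<times> {..<p} \<times> {..<k} \<times> {..<m} \<times> {..<K} \<times> {..<M} \<times> {..<K} \<times> {..<M}"
        let ?R = "{..<K} \<times> {..<k} \<times> {..<M} \<times> {..<m} \<times> {..<K} \<times> {..<k} \<times> {..<M} \<times> {..<m} \<times> {..<p} \<times> {..<p}"
        have "?sum
          = (\<Sum>(i, s, t, j, s', t', a, b, c, d)\<in>?L. ?term (i, s, t) (j, s', t') a b c d)"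
          by (simp add: sum.cartesian_product')
        also have "\<dots> = (\<Sum>(a, s, b, t, c, s', d, t', i, j)\<in>?R. ?term (i, s, t) (j, s', t') a b c d)"
          by (rule sum.reindex_bij_witness[of _ "\<lambda>(a, s, b, t, c, s', d, t', i, j). (i, s, t, j, s', t', a, b, c, d)"
                "\<lambda>(i, s, t, j, s', t', a, b, c, d). (a, s, b, t, c, s', d, t', i, j)"]) auto
        also have "\<dots> = (\<Sum>f\<in>?F. \<Sum>g\<in>?G. \<Sum>f'\<in>?F. \<Sum>g'\<in>?G.
          \<Sum>i<p. \<Sum>j<p. cnj (cnj (X i (fst f) (fst g)) * x (i, snd f, snd g)) * (A f f' * B g g')
            * (cnj (X j (fst f') (fst g')) * x (j, snd f', snd g')))"
          by (simp add: sum.cartesian_product' mult_ac)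
        also have "\<dots> = (\<Sum>f\<in>?F. \<Sum>g\<in>?G. \<Sum>f'\<in>?F. \<Sum>g'\<in>?G.
          cnj (\<eta> f g) * (A f f' * B g g') * \<eta> f' g')"
          by (intro sum.cong refl, simp only: \<eta>_def cnj_sum sum_distrib_left sum_distrib_right, rule sum.swap)
        finally show ?thesis .
      qed
      also have "\<dots> \<in> \<real>\<^sub>\<ge>\<^sub>0" by (rule psd_kronecker[OF _ _ A B]) simp_all
      finally show "(\<Sum>z\<in>?X. \<Sum>y\<in>?X. cnj (x z) * ?t z y * x y)
          + of_real \<epsilon> * (\<Sum>z\<in>?X. \<Sum>y\<in>?X. cnj (x z) * e z y * x y) \<in> \<real>\<^sub>\<ge>\<^sub>0" .
    qed
    then show "(\<Sum>z\<in>?X. \<Sum>y\<in>?X. cnj (x z) * (case z of (i, a) \<Rightarrow> \<lambda>(j, b). tensor_map \<phi> \<psi> (u i j) a b) y * x y) \<in> \<real>\<^sub>\<ge>\<^sub>0"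
      by (simp add: split_def)
  qed
  with mats show ?thesis by (simp add: min_tensor_def)
qed

section \<open>The minimal cone is contained in the maximal cone\<close>

definition E_ball :: "nat \<Rightarrow> complex matrix" where
  "E_ball n = (\<Sum>i=1..n. matrix_unit i i)"

definition E_generators :: "nat \<Rightarrow> complex matrix set" where
  "E_generators n = {matrix_unit 0 0, E_ball n}
     \<union> {matrix_unit i 0 | i. 1 \<le> i \<and> i \<le> n} \<union> {matrix_unit 0 i | i. 1 \<le> i \<and> i \<le> n}"

definition E_space :: "nat \<Rightarrow> complex matrix set" where
  "E_space n = cspan (E_generators n)"

lemma E_opsys_simps:
  "carrier (E_opsys n) = E_space n"
  "ounit (E_opsys n) = unit_mat (n + 1)"
  "mcone (E_opsys n) k = {P \<in> mats k (mats (n + 1) UNIV).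
     psd ({..<k} \<times> {..<n + 1}) (\<lambda>(i, a) (j, b). P i j a b)} \<inter> mats k (E_space n)"
  by (simp_all add: E_opsys_def sub_opsys_def matrix_opsys_def E_space_def E_generators_def E_ball_def)

lemma E_ball_apply: "E_ball n a b = (if a = b \<and> 1 \<le> a \<and> a \<le> n then 1 else 0)"
proof -
  have "E_ball n a b = (\<Sum>i=1..n. if i = a then (if a = b then 1 else 0) else 0)"
    unfolding E_ball_def fun_sum_apply by (intro sum.cong refl) (auto simp: matrix_unit_def)
  then show ?thesis by simp
qed

lemma E_space_generators:
  "matrix_unit 0 0 \<in> E_space n" "E_ball n \<in> E_space n"
  "i \<in> {1..n} \<Longrightarrow> matrix_unit i 0 \<in> E_space n" "i \<in> {1..n} \<Longrightarrow> matrix_unit 0 i \<in> E_space n"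
  unfolding E_space_def E_generators_def by (auto intro!: cvec.span_base)

lemma unit_mat_eq: "unit_mat (n + 1) = matrix_unit 0 0 + E_ball n"
  by (auto simp: fun_eq_iff unit_mat_def matrix_unit_def E_ball_apply)

lemma E_space_subset_mats: "E_space n \<subseteq> mats (n + 1) UNIV"
proof
  fix v assume "v \<in> E_space n"
  then have "v \<in> cspan (E_generators n)"
    by (simp only: E_space_def)
  then show "v \<in> mats (n + 1) UNIV"
  proof (induction rule: cvec.span_induct_alt)
    case base
    show ?case by (simp add: mats_def)
  next
    case (step c x y)
    have "x i j = 0" if "\<not> (i < n + 1 \<and> j < n + 1)" for i j
      using step(1) that by (auto simp: E_generators_def matrix_unit_def E_ball_apply split: if_splits)
    then show ?case using step(2) by (auto simp: mats_def scaleC_fun_def scaleC_complex_def)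
  qed
qed

section \<open>Coordinates on the tensor product\<close>

context
  fixes n :: nat
begin

abbreviation pure :: "complex matrix \<Rightarrow> 'b::complex_vector \<Rightarrow> (complex matrix, 'b) tensor" where
  "pure \<equiv> pure_tensor (E_space n) UNIV"

text \<open>The element with corner \<open>a\<close>, diagonal blocks \<open>b\<close>, first column
  \<open>x\<close> and first row \<open>y\<close>. Row and column are independent here; positivity
  makes them adjoint.\<close>

definition E_tensor :: "'b::complex_vector \<Rightarrow> 'b \<Rightarrow> (nat \<Rightarrow> 'b) \<Rightarrow> (nat \<Rightarrow> 'b) \<Rightarrow> (complex matrix, 'b) tensor" where
  "E_tensor a b x y = pure (matrix_unit 0 0) a + pure (E_ball n) b
     + (\<Sum>i=1..n. pure (matrix_unit i 0) (x i)) + (\<Sum>i=1..n. pure (matrix_unit 0 i) (y i))"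

lemma pure_right:
  assumes "v \<in> E_space n"
  shows "pure v (a + b) = pure v a + pure v (b::'b::complex_vector)" "pure v (c *\<^sub>C a) = c *\<^sub>C pure v a" "pure v (0::'b) = 0"
proof -
  have lin: "linear_on UNIV (pure v :: 'b \<Rightarrow> _)"
    using bilinear_on_pure_tensor[of "E_space n" "UNIV :: 'b set"] assms unfolding bilinear_on_def by (elim conjE bspec)
  then show "pure v (a + b) = pure v a + pure v b" "pure v (c *\<^sub>C a) = c *\<^sub>C pure v a"
    unfolding linear_on_def by simp_all
  have "pure v (0 *\<^sub>C (0::'b)) = 0 *\<^sub>C pure v 0" using lin unfolding linear_on_def by blast
  then show "pure v (0::'b) = 0" by simp
qed

lemma pure_left:
  assumes "v \<in> E_space n" "w \<in> E_space n"
  shows "pure (v + w) a = pure v a + pure w (a::'b::complex_vector)" "pure (c *\<^sub>C v) a = c *\<^sub>C pure v a"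
proof -
  have "\<forall>a\<in>UNIV. linear_on (E_space n) (\<lambda>v. pure v (a::'b))"
    using bilinear_on_pure_tensor[of "E_space n" "UNIV :: 'b set"] unfolding bilinear_on_def by (rule conjunct2)
  then have "linear_on (E_space n) (\<lambda>v. pure v a)" by simp
  then show "pure (v + w) a = pure v a + pure w a" "pure (c *\<^sub>C v) a = c *\<^sub>C pure v a"
    using assms unfolding linear_on_def by simp_all
qed

lemma E_tensor_add:
  "E_tensor a b x y + E_tensor a' b' x' y'
    = E_tensor (a + a') (b + b') (\<lambda>i. x i + x' i) (\<lambda>i. y i + y' i)" (is "_ = ?r")
proof -
  have s: "(\<Sum>i=1..n. pure (matrix_unit i 0) (x i + x' i))
      = (\<Sum>i=1..n. pure (matrix_unit i 0) (x i)) + (\<Sum>i=1..n. pure (matrix_unit i 0) (x' i))"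
    "(\<Sum>i=1..n. pure (matrix_unit 0 i) (y i + y' i))
      = (\<Sum>i=1..n. pure (matrix_unit 0 i) (y i)) + (\<Sum>i=1..n. pure (matrix_unit 0 i) (y' i))"
    by (subst sum.distrib[symmetric], intro sum.cong refl pure_right E_space_generators, assumption)+
  show ?thesis unfolding E_tensor_def s pure_right(1)[OF E_space_generators(1)] pure_right(1)[OF E_space_generators(2)]
    by (simp only: ac_simps)
qed

lemma E_tensor_scale:
  "c *\<^sub>C E_tensor a b x y = E_tensor (c *\<^sub>C a) (c *\<^sub>C b) (\<lambda>i. c *\<^sub>C x i) (\<lambda>i. c *\<^sub>C y i)"
proof -
  have s: "(\<Sum>i=1..n. pure (matrix_unit i 0) (c *\<^sub>C x i)) = c *\<^sub>C (\<Sum>i=1..n. pure (matrix_unit i 0) (x i))"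
    "(\<Sum>i=1..n. pure (matrix_unit 0 i) (c *\<^sub>C y i)) = c *\<^sub>C (\<Sum>i=1..n. pure (matrix_unit 0 i) (y i))"
    by (subst cvec.scale_sum_right, intro sum.cong refl pure_right E_space_generators, assumption)+
  show ?thesis unfolding E_tensor_def s pure_right(2)[OF E_space_generators(1)] pure_right(2)[OF E_space_generators(2)]
    by (simp only: scaleC_add_right)
qed

lemma E_tensor_generator:
  assumes "g \<in> E_generators n"
  shows "\<exists>a b x y. pure g w = E_tensor a b x y"
proof -
  have z: "pure (matrix_unit 0 0) 0 = 0" "pure (E_ball n) 0 = 0"
    by (rule pure_right(3)[OF E_space_generators(1)], rule pure_right(3)[OF E_space_generators(2)])
  have l: "(\<Sum>j=1..n. pure (matrix_unit j 0) (if j = i then w else 0)) = pure (matrix_unit i 0) w"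
    "(\<Sum>j=1..n. pure (matrix_unit 0 j) (if j = i then w else 0)) = pure (matrix_unit 0 i) w"
    if i: "i \<in> {1..n}" for i
  proof -
    have "(\<Sum>j=1..n. pure (matrix_unit j 0) (if j = i then w else 0)) = (\<Sum>j=1..n. if j = i then pure (matrix_unit j 0) w else 0)"
      by (intro sum.cong refl) (simp add: pure_right(3)[OF E_space_generators(3)])
    then show "(\<Sum>j=1..n. pure (matrix_unit j 0) (if j = i then w else 0)) = pure (matrix_unit i 0) w"
      using i by simp
    have "(\<Sum>j=1..n. pure (matrix_unit 0 j) (if j = i then w else 0)) = (\<Sum>j=1..n. if j = i then pure (matrix_unit 0 j) w else 0)"
      by (intro sum.cong refl) (simp add: pure_right(3)[OF E_space_generators(4)])
    then show "(\<Sum>j=1..n. pure (matrix_unit 0 j) (if j = i then w else 0)) = pure (matrix_unit 0 i) w"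
      using i by simp
  qed
  have l0: "(\<Sum>j=1..n. pure (matrix_unit j 0) 0) = 0" "(\<Sum>j=1..n. pure (matrix_unit 0 j) 0) = 0"
    by (intro sum.neutral ballI pure_right(3) E_space_generators, assumption)+
  from assms consider "g = matrix_unit 0 0" | "g = E_ball n" | i where "i \<in> {1..n}" "g = matrix_unit i 0"
    | i where "i \<in> {1..n}" "g = matrix_unit 0 i" unfolding E_generators_def by auto
  then show ?thesis
  proof cases
    case 1
    have "pure g w = E_tensor w 0 (\<lambda>_. 0) (\<lambda>_. 0)" unfolding E_tensor_def l0 z 1 by simp
    then show ?thesis by blast
  next
    case 2
    have "pure g w = E_tensor 0 w (\<lambda>_. 0) (\<lambda>_. 0)" unfolding E_tensor_def l0 z 2 by simp
    then show ?thesis by blast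
  next
    case (3 i)
    have "pure g w = E_tensor 0 0 (\<lambda>j. if j = i then w else 0) (\<lambda>_. 0)"
      unfolding E_tensor_def l0 z l(1)[OF 3(1)] 3(2) by simp
    then show ?thesis by blast
  next
    case (4 i)
    have "pure g w = E_tensor 0 0 (\<lambda>_. 0) (\<lambda>j. if j = i then w else 0)"
      unfolding E_tensor_def l0 z l(2)[OF 4(1)] 4(2) by simp
    then show ?thesis by blast
  qed
qed

lemma E_tensor_exhaust:
  assumes u: "u \<in> tensor_space (E_space n) (UNIV :: 'b::complex_vector set)"
  shows "\<exists>a b x y. u = E_tensor a b x y"
proof -
  let ?R = "{E_tensor a b x y | a b x (y :: nat \<Rightarrow> 'b). True}"
  have add: "s + t \<in> ?R" if "s \<in> ?R" "t \<in> ?R" for s t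
    using that by (auto simp: E_tensor_add) blast
  have scale: "c *\<^sub>C s \<in> ?R" if "s \<in> ?R" for c s
    using that by (auto simp: E_tensor_scale) blast
  have pure_w: "pure v w \<in> ?R" if v: "v \<in> E_space n" for v and w :: 'b
  proof -
    have "v \<in> cspan (E_generators n)"
      using v by (simp only: E_space_def)
    then have "v \<in> E_space n \<and> pure v w \<in> ?R"
    proof (induction rule: cvec.span_induct_alt)
      case base
      have 0: "0 \<in> E_space n" unfolding E_space_def by (rule cvec.span_zero)
      have "pure (0 *\<^sub>C 0) w = 0 *\<^sub>C pure 0 w" by (rule pure_left(2)[OF 0 0])
      then have "pure 0 w = 0 *\<^sub>C pure (matrix_unit 0 0) w" by simp
      also have "\<dots> \<in> ?R" by (rule scale) (use E_tensor_generator[of "matrix_unit 0 0" w] in \<open>auto simp: E_generators_def\<close>)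
      finally show ?case using 0 by blast
    next
      case (step c g v)
      have g: "g \<in> E_space n" unfolding E_space_def by (rule cvec.span_base[OF step(1)])
      have cg: "c *\<^sub>C g \<in> E_space n" using g unfolding E_space_def by (rule cvec.span_scale)
      have v: "v \<in> E_space n" "pure v w \<in> ?R" using step(2) by (rule conjunct1, rule conjunct2)
      have "c *\<^sub>C g + v \<in> E_space n" using cg v(1) unfolding E_space_def by (rule cvec.span_add)
      moreover have "pure (c *\<^sub>C g + v) w = c *\<^sub>C pure g w + pure v w"
        by (simp only: pure_left(1)[OF cg v(1)] pure_left(2)[OF g g])
      moreover have "pure g w \<in> ?R" using E_tensor_generator[OF step(1), of w] by auto
      then have "c *\<^sub>C pure g w + pure v w \<in> ?R" by (intro add[OF scale v(2)])
      ultimately show ?case by (simp only:)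
    qed
    then show ?thesis by (rule conjunct2)
  qed
  have "u \<in> cspan {pure v w | v w. v \<in> E_space n \<and> w \<in> UNIV}"
    using u by (simp only: tensor_space_def)
  then have "u \<in> ?R"
  proof (induction rule: cvec.span_induct_alt)
    case base
    have "0 *\<^sub>C pure (matrix_unit 0 0) (0::'b) \<in> ?R" by (intro scale pure_w E_space_generators)
    then show ?case by (simp only: cvec.scale_zero_left)
  next
    case (step c s t)
    from step(1) obtain v w where s: "s = pure v w" and v: "v \<in> E_space n" by blast
    show ?case unfolding s by (rule add[OF scale[OF pure_w[OF v]] step(2)])
  qed
  then show ?thesis by blast
qed

end

definition E_coefficient :: "'b::zero \<Rightarrow> 'b \<Rightarrow> (nat \<Rightarrow> 'b) \<Rightarrow> (nat \<Rightarrow> 'b) \<Rightarrow> nat \<Rightarrow> nat \<Rightarrow> 'b" where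
  "E_coefficient a b x y s s' = (if s = 0 then (if s' = 0 then a else y s')
     else if s' = 0 then x s else if s = s' then b else 0)"

text \<open>With the inclusion \<open>id\<close> as first map, the minimal condition specializes to
  positivity, under every \<open>\<psi>\<close>, of the matrix over \<open>A\<close> with entries
  \<open>E_coefficient\<close>, as \<open>ucp_positive_imp_gram\<close> requires.\<close>

lemma tensor_map_E_tensor:
  fixes \<psi> :: "'a::cstar_algebra \<Rightarrow> complex matrix"
  assumes \<psi>: "ucp cstar_opsys (matrix_opsys N) \<psi>" and s: "s \<le> n" "s' \<le> n"
  shows "tensor_map id \<psi> (E_tensor n a b x y) (s, t) (s', t') = \<psi> (E_coefficient a b x y s s') t t'"
proof -
  have lin: "linear_on (E_space n) id" "linear_on UNIV \<psi>"
    using \<psi> by (auto simp: linear_on_def ucp_def cstar_opsys_def)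
  have "\<psi> (0 *\<^sub>C 0) = 0 *\<^sub>C \<psi> 0" by (rule ucp_linear(2)[OF \<psi>])
  then have \<psi>0: "\<psi> 0 = 0" by simp
  have 1: "(\<Sum>i=1..n. matrix_unit i 0 s s' * \<psi> (x i) t t') = (if s' = 0 \<and> 1 \<le> s then \<psi> (x s) t t' else 0)"
  proof -
    have "(\<Sum>i=1..n. matrix_unit i 0 s s' * \<psi> (x i) t t') = (\<Sum>i=1..n. if i = s then (if s' = 0 then \<psi> (x s) t t' else 0) else 0)"
      by (intro sum.cong refl) (auto simp: matrix_unit_def)
    then show ?thesis using s by auto
  qed
  have 2: "(\<Sum>i=1..n. matrix_unit 0 i s s' * \<psi> (y i) t t') = (if s = 0 \<and> 1 \<le> s' then \<psi> (y s') t t' else 0)"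
  proof -
    have "(\<Sum>i=1..n. matrix_unit 0 i s s' * \<psi> (y i) t t') = (\<Sum>i=1..n. if i = s' then (if s = 0 then \<psi> (y s') t t' else 0) else 0)"
      by (intro sum.cong refl) (auto simp: matrix_unit_def)
    then show ?thesis using s by auto
  qed
  have "tensor_map id \<psi> (E_tensor n a b x y) (s, t) (s', t')
      = matrix_unit 0 0 s s' * \<psi> a t t' + E_ball n s s' * \<psi> b t t'
        + (\<Sum>i=1..n. matrix_unit i 0 s s' * \<psi> (x i) t t') + (\<Sum>i=1..n. matrix_unit 0 i s s' * \<psi> (y i) t t')"
    unfolding E_tensor_def tensor_map_linear tensor_map_pure_tensor[OF lin] id_apply ..
  also have "\<dots> = \<psi> (E_coefficient a b x y s s') t t'"
    unfolding 1 2 using s by (auto simp: E_coefficient_def matrix_unit_def E_ball_apply \<psi>0)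
  finally show ?thesis .
qed

text \<open>This is the matrix \<open>P\<close> of the introduction; its quadratic form is \<open>\<Sum>\<^sub>t \<bar>\<xi>\<^sub>0\<^sub>t + \<xi>\<^sub>t\<^sub>0\<bar>\<^sup>2\<close>.\<close>

definition E_pos :: "nat \<Rightarrow> complex matrix matrix" where
  "E_pos n c d = (if c = 0 then (if d = 0 then E_ball n else if d \<le> n then matrix_unit d 0 else 0)
     else if c \<le> n then (if d = 0 then matrix_unit 0 c else if c = d then matrix_unit 0 0 else 0) else 0)"

lemma E_pos_mcone: "E_pos n \<in> mcone (E_opsys n) (n + 1)"
proof -
  define w :: "nat \<Rightarrow> nat \<times> nat \<Rightarrow> complex" where
    "w t z = (if z = (0, t) then 1 else 0) + (if z = (t, 0) then 1 else 0)" for t z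
  have 0: "0 \<in> E_space n" unfolding E_space_def by (rule cvec.span_zero)
  have space: "E_pos n \<in> mats (n + 1) (E_space n)"
    unfolding mats_def E_pos_def using 0 by (auto simp: E_space_generators)
  have factor: "E_pos n c d a b = (\<Sum>t\<in>{1..n}. cnj (w t (c, a)) * w t (d, b))"
    if "c \<le> n" "d \<le> n" "a \<le> n" "b \<le> n" for a b c d
  proof -
    have "(\<Sum>t\<in>{1..n}. cnj (w t (c, a)) * w t (d, b))
        = (\<Sum>t\<in>{1..n}. (if t = a then (if c = 0 \<and> d = 0 \<and> b = a then 1 else 0) else 0)
            + (if t = a then (if c = 0 \<and> d = a \<and> b = 0 then 1 else 0) else 0)
            + (if t = c then (if a = 0 \<and> d = 0 \<and> b = c then 1 else 0) else 0)
            + (if t = c then (if a = 0 \<and> d = c \<and> b = 0 then 1 else 0) else 0))"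
      by (intro sum.cong refl) (auto simp: w_def)
    also have "\<dots> = E_pos n c d a b"
      using that by (auto simp: sum.distrib E_pos_def E_ball_apply matrix_unit_def)
    finally show ?thesis by simp
  qed
  have "psd ({..<n + 1} \<times> {..<n + 1}) (\<lambda>x y. \<Sum>t\<in>{1..n}. cnj (w t x) * w t y)"
    by (rule psd_sum_rank_one) simp
  then have "psd ({..<n + 1} \<times> {..<n + 1}) (\<lambda>(i, a) (j, b). E_pos n i j a b)"
    unfolding psd_def
    by (elim all_forward subst[of _ _ "\<lambda>u. u \<in> _", rotated])
      (intro sum.cong refl, auto simp: factor)
  moreover have "E_pos n \<in> mats (n + 1) (mats (n + 1) UNIV)"
    using space E_space_subset_mats[of n] by (auto simp: mats_def)
  ultimately show ?thesis using space by (simp add: E_opsys_simps)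
qed

text \<open>The cone of \<open>cstar_opsys\<close> asks for a square factor of the size of the
  matrix, whereas a Gram family has any number of rows; \<open>m = p (n + 1) + length bs\<close>
  leaves room for both. The pair \<open>(i, a)\<close> is coded as
  \<open>i (n + 1) + a\<close>.\<close>

lemma gram_mcone:
  fixes Q :: "nat \<times> nat \<Rightarrow> nat \<times> nat \<Rightarrow> 'a::cstar_algebra"
  assumes "gram ({..<p} \<times> {..n}) Q"
  obtains m Q' where "Q' \<in> mcone (cstar_opsys :: 'a opsys) m" "p * (n + 1) \<le> m"
    "\<And>i j a b. i < p \<Longrightarrow> j < p \<Longrightarrow> a \<le> n \<Longrightarrow> b \<le> n \<Longrightarrow> Q' (i * (n + 1) + a) (j * (n + 1) + b) = Q (i, a) (j, b)"
proof -
  obtain bs where bs: "\<And>\<alpha> \<beta>. \<alpha> \<in> {..<p} \<times> {..n} \<Longrightarrow> \<beta> \<in> {..<p} \<times> {..n} \<Longrightarrow>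
      Q \<alpha> \<beta> = (\<Sum>b\<leftarrow>bs. star (b \<alpha>) * b \<beta>)"
    using assms unfolding gram_def by blast
  define m where "m = p * (n + 1) + length bs"
  define B where "B l r = (if l < length bs \<and> r < p * (n + 1) then (bs ! l) (r div (n + 1), r mod (n + 1)) else 0)" for l r
  define Q' where "Q' = (\<lambda>i j. \<Sum>l<m. star (B l i) * B l j)"
  have "B \<in> mats m UNIV" by (auto simp: mats_def B_def m_def)
  then have "Q' \<in> mcone (cstar_opsys :: 'a opsys) m"
    unfolding cstar_opsys_def opsys.select_convs mem_Collect_eq Q'_def by (intro bexI[of _ B] refl)
  moreover have "p * (n + 1) \<le> m" by (simp add: m_def)
  moreover have "Q' (i * (n + 1) + a) (j * (n + 1) + b) = Q (i, a) (j, b)"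
    if ij: "i < p" "j < p" and ab: "a \<le> n" "b \<le> n" for i j a b
  proof -
    have idx: "i * (n + 1) + a < p * (n + 1)" if "i < p" "a \<le> n" for i a
    proof -
      have "i * (n + 1) + a < (i + 1) * (n + 1)" using that by simp
      also have "\<dots> \<le> p * (n + 1)" using that by (intro mult_right_mono) auto
      finally show ?thesis .
    qed
    have dm: "(i * (n + 1) + a) div (n + 1) = i" "(i * (n + 1) + a) mod (n + 1) = a" if "a \<le> n" for i a
      using that by (simp_all add: div_mult_self3 del: mult_Suc_right)
    have B: "B l (i * (n + 1) + a) = (if l < length bs then (bs ! l) (i, a) else 0)" if "i < p" "a \<le> n" for i a l
      unfolding B_def dm[OF that(2)] using idx[OF that] by simp
    have "Q' (i * (n + 1) + a) (j * (n + 1) + b) = (\<Sum>l<m. if l < length bs then star ((bs ! l) (i, a)) * (bs ! l) (j, b) else 0)"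
      unfolding Q'_def B[OF ij(1) ab(1)] B[OF ij(2) ab(2)] by (intro sum.cong refl) auto
    also have "\<dots> = (\<Sum>l<length bs. star ((bs ! l) (i, a)) * (bs ! l) (j, b))"
      by (rule sum.mono_neutral_cong_right) (auto simp: m_def)
    also have "\<dots> = Q (i, a) (j, b)"
      using ij ab by (simp add: bs sum_list_sum_nth lessThan_atLeast0)
    finally show ?thesis .
  qed
  ultimately show thesis by (rule that)
qed


lemma ucp_id_E: "ucp (E_opsys n) (matrix_opsys (n + 1)) id"
  unfolding ucp_def using E_space_subset_mats[of n]
  by (auto simp: E_opsys_simps matrix_opsys_def linear_on_def)

text \<open>The budget \<open>e\<close>: passing to a Gram matrix costs \<open>e/2\<close> on the
  whole diagonal. The Schur step with \<open>\<nu> = e/4\<close> adds \<open>2 \<nu> = e/2\<close>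
  only to the block paired with \<open>E_ball n\<close>, so the corner receives a matching
  \<open>e/2\<close> by hand. Both then exceed \<open>u\<close> by \<open>e\<close>, that is by
  \<open>e\<close> times the order unit.\<close>

lemma min_positive_imp_max_positive:
  fixes u :: "(complex matrix, 'a::cstar_algebra) tensor matrix"
  assumes n: "1 \<le> n" and u: "u \<in> mcone (min_tensor (E_opsys n) cstar_opsys) p"
  shows "u \<in> mcone (max_tensor (E_opsys n) cstar_opsys) p"
proof -
  have cstar: "carrier (cstar_opsys :: 'a opsys) = UNIV" "ounit (cstar_opsys :: 'a opsys) = 1"
    by (simp_all add: cstar_opsys_def)
  have mats: "u \<in> mats p (tensor_space (E_space n) UNIV)"
    using u by (simp add: min_tensor_def E_opsys_simps cstar)
  have min: "psd ({..<p} \<times> ({..<n + 1} \<times> {..<N})) (\<lambda>(i, a) (j, b). tensor_map id \<psi> (u i j) a b)"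
    if "ucp cstar_opsys (matrix_opsys N) \<psi>" for N and \<psi> :: "'a \<Rightarrow> complex matrix"
    using u that ucp_id_E[of n] by (simp add: min_tensor_def)
  have "\<forall>i. \<forall>j. \<exists>q. i < p \<longrightarrow> j < p \<longrightarrow> u i j = (case q of (a, b, x, y) \<Rightarrow> E_tensor n a b x y)"
  proof (intro allI)
    fix i j
    show "\<exists>q. i < p \<longrightarrow> j < p \<longrightarrow> u i j = (case q of (a, b, x, y) \<Rightarrow> E_tensor n a b x y)"
    proof (cases "i < p \<and> j < p")
      case True
      then have "u i j \<in> tensor_space (E_space n) UNIV" using mats by (simp add: mats_def)
      then obtain a b x y where "u i j = E_tensor n a b x y" using E_tensor_exhaust by blast
      then show ?thesis by (intro exI[of _ "(a, b, x, y)"]) simp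
    qed simp
  qed
  then obtain q where q: "\<And>i j. i < p \<Longrightarrow> j < p \<Longrightarrow> u i j = (case q i j of (a, b, x, y) \<Rightarrow> E_tensor n a b x y)"
    unfolding choice_iff by (elim exE) simp
  define a where "a i j = fst (q i j)" for i j
  define b where "b i j = fst (snd (q i j))" for i j
  define x where "x i j = fst (snd (snd (q i j)))" for i j
  define y where "y i j = snd (snd (snd (q i j)))" for i j
  have u_eq: "u i j = E_tensor n (a i j) (b i j) (x i j) (y i j)" if "i < p" "j < p" for i j
    using q[OF that] by (simp add: a_def b_def x_def y_def split_def)
  define h where "h = (\<lambda>(i, s) (j, s'). E_coefficient (a i j) (b i j) (x i j) (y i j) s s')"
  have pos: "(\<Sum>\<alpha>\<in>{..<p} \<times> {..n}. \<Sum>\<beta>\<in>{..<p} \<times> {..n}. \<Sum>k<N. \<Sum>l<N. cnj (\<xi> k \<alpha>) * \<psi> (h \<alpha> \<beta>) k l * \<xi> l \<beta>) \<in> \<real>\<^sub>\<ge>\<^sub>0"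
    if \<psi>: "ucp cstar_opsys (matrix_opsys N) \<psi>" for N and \<psi> :: "'a \<Rightarrow> complex matrix" and \<xi>
  proof -
    have "(\<Sum>\<alpha>\<in>{..<p} \<times> {..n}. \<Sum>\<beta>\<in>{..<p} \<times> {..n}. \<Sum>k<N. \<Sum>l<N. cnj (\<xi> k \<alpha>) * \<psi> (h \<alpha> \<beta>) k l * \<xi> l \<beta>)
        = (\<Sum>\<alpha>\<in>{..<p} \<times> {..n}. \<Sum>k<N. \<Sum>\<beta>\<in>{..<p} \<times> {..n}. \<Sum>l<N. cnj (\<xi> k \<alpha>) * \<psi> (h \<alpha> \<beta>) k l * \<xi> l \<beta>)"
      by (intro sum.cong refl) (rule sum.swap)
    also have "\<dots> = (\<Sum>i<p. \<Sum>s\<le>n. \<Sum>k<N. \<Sum>j<p. \<Sum>s'\<le>n. \<Sum>l<N. cnj (\<xi> k (i, s)) * \<psi> (h (i, s) (j, s')) k l * \<xi> l (j, s'))"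
      by (simp only: sum.cartesian_product')
    also have "\<dots> = (\<Sum>i<p. \<Sum>s\<le>n. \<Sum>k<N. \<Sum>j<p. \<Sum>s'\<le>n. \<Sum>l<N.
        cnj (\<xi> k (i, s)) * tensor_map id \<psi> (u i j) (s, k) (s', l) * \<xi> l (j, s'))"
      by (intro sum.cong refl) (simp add: u_eq h_def tensor_map_E_tensor[OF \<psi>])
    also have "\<dots> = (\<Sum>z\<in>{..<p} \<times> ({..<n + 1} \<times> {..<N}). \<Sum>w\<in>{..<p} \<times> ({..<n + 1} \<times> {..<N}).
        cnj ((\<lambda>(i, s, k). \<xi> k (i, s)) z) * (case z of (i, a) \<Rightarrow> \<lambda>(j, b). tensor_map id \<psi> (u i j) a b) w * (\<lambda>(i, s, k). \<xi> k (i, s)) w)"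
      by (simp add: sum.cartesian_product' lessThan_Suc_atMost)
    also have "\<dots> \<in> \<real>\<^sub>\<ge>\<^sub>0" by (rule min[OF \<psi>, unfolded psd_def, rule_format])
    finally show ?thesis .
  qed
  have "\<exists>k m. \<exists>P\<in>mcone (E_opsys n) k. \<exists>Q\<in>mcone (cstar_opsys :: 'a opsys) m. \<exists>X :: nat \<Rightarrow> nat \<Rightarrow> nat \<Rightarrow> complex.
      \<forall>i<p. \<forall>j<p. (complex_of_real e * unit_mat p i j) *\<^sub>C pure n (unit_mat (n + 1)) 1 + u i j =
        (\<Sum>a<k. \<Sum>b<m. \<Sum>c<k. \<Sum>d<m. (X i a b * cnj (X j c d)) *\<^sub>C pure n (P a c) (Q b d))"
    if e: "0 < e" for e
  proof -
    define h' where "h' = (\<lambda>\<alpha> \<beta>. (if \<alpha> = \<beta> then of_real (e/2) else 0) + h \<alpha> \<beta>)"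
    have "0 < e/2" "0 < e/4" using e by simp_all
    have gram_h': "gram ({..<p} \<times> {..n}) h'"
      unfolding h'_def by (rule ucp_positive_imp_gram[OF _ pos \<open>0 < e/2\<close>]) simp
    have diag: "h' (i, c) (j, d) = (if c = d then h' (i, 1) (j, 1) else 0)"
      if "i < p" "j < p" "c \<in> {1..n}" "d \<in> {1..n}" for i j c d
      using that by (simp add: h'_def h_def E_coefficient_def)
    obtain Q where gQ: "gram ({..<p} \<times> {..n}) Q"
      and Q00: "\<And>i j. i < p \<Longrightarrow> j < p \<Longrightarrow> Q (i, 0) (j, 0) = h' (i, 1) (j, 1) + (if i = j then of_real (2 * (e/4)) else 0)"
      and Q01: "\<And>i j c. i < p \<Longrightarrow> j < p \<Longrightarrow> c \<in> {1..n} \<Longrightarrow> Q (i, 0) (j, c) = h' (i, c) (j, 0)"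
      and Q10: "\<And>i j c. i < p \<Longrightarrow> j < p \<Longrightarrow> c \<in> {1..n} \<Longrightarrow> Q (i, c) (j, 0) = h' (i, 0) (j, c)"
      and Q11: "\<And>i j. i < p \<Longrightarrow> j < p \<Longrightarrow> (\<Sum>c\<in>{1..n}. Q (i, c) (j, c)) = h' (i, 0) (j, 0)"
      by (rule gram_schur_complement[OF n gram_h' _ \<open>0 < e/4\<close>], erule (3) diag, rule that)
    \<comment> \<open>Supplies the missing \<open>e/2\<close> of the corner: only the diagonal
      positions \<open>(i, 1)\<close> change, and these are paired with \<open>E_00\<close>.\<close>
    define Q2 where "Q2 = (\<lambda>\<alpha> \<beta>. Q \<alpha> \<beta> + (if \<alpha> = \<beta> then (if snd \<alpha> = 1 then of_real (e/2) else 0) else 0))"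
    have p0: "pos (0::'a)" by (auto simp: pos_def intro: exI[of _ 0])
    have "pos (of_real (e/2) - 0 :: 'a)" by (rule pos_of_real_diff) (use e in simp_all)
    then have p1: "pos (of_real (e/2) :: 'a)" by (simp only: diff_0_right)
    have gQ2: "gram ({..<p} \<times> {..n}) Q2" unfolding Q2_def
      by (rule gram_add[OF gQ gram_diagonal]) (use p0 p1 in \<open>simp_all del: of_real_divide\<close>)
    have half: "of_real (e/2) + of_real (e/2) = (of_real e :: 'a)"
      by (simp only: of_real_add[symmetric]) simp
    define \<delta> where "\<delta> i j = (if i = j then of_real e else 0 :: 'a)" for i j :: nat
    have Q2_00: "Q2 (i, 0) (j, 0) = \<delta> i j + b i j" if "i < p" "j < p" for i j
    proof -
      have "Q2 (i, 0) (j, 0) = (if i = j then of_real (e/2) + of_real (e/2) else 0) + b i j"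
        using that n by (auto simp: Q2_def Q00 h'_def h_def E_coefficient_def)
      then show ?thesis by (simp only: half \<delta>_def)
    qed
    have Q2_01: "Q2 (i, 0) (j, c) = x i j c" if "i < p" "j < p" "c \<in> {1..n}" for i j c
      using that by (simp add: Q2_def Q01 h'_def h_def E_coefficient_def)
    have Q2_10: "Q2 (i, c) (j, 0) = y i j c" if "i < p" "j < p" "c \<in> {1..n}" for i j c
      using that by (simp add: Q2_def Q10 h'_def h_def E_coefficient_def)
    have Q2_11: "(\<Sum>c\<in>{1..n}. Q2 (i, c) (j, c)) = \<delta> i j + a i j" if "i < p" "j < p" for i j
    proof -
      have "(\<Sum>c\<in>{1..n}. Q2 (i, c) (j, c)) = h' (i, 0) (j, 0) + (\<Sum>c\<in>{1..n}. if c = 1 then (if i = j then of_real (e/2) else 0) else 0)"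
        unfolding Q2_def sum.distrib Q11[OF that] by (intro arg_cong2[of _ _ _ _ plus] sum.cong refl) auto
      also have "\<dots> = (if i = j then of_real (e/2) + of_real (e/2) else 0) + a i j"
        using n by (auto simp: h'_def h_def E_coefficient_def)
      finally show ?thesis by (simp only: half \<delta>_def)
    qed
    obtain m Q' where Q': "Q' \<in> mcone (cstar_opsys :: 'a opsys) m" and m: "p * (n + 1) \<le> m"
      and Q'_eq: "\<And>i j c d. i < p \<Longrightarrow> j < p \<Longrightarrow> c \<le> n \<Longrightarrow> d \<le> n \<Longrightarrow>
        Q' (i * (n + 1) + c) (j * (n + 1) + d) = Q2 (i, c) (j, d)"
      by (rule gram_mcone[OF gQ2]) (rule that)
    \<comment> \<open>A 0/1 matrix whose row \<open>i\<close> selects the columns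
      \<open>(c, i (n + 1) + c)\<close>; it reduces the Kronecker product to the sum over
      \<open>c\<close>, \<open>d\<close> of \<open>E_pos n c d\<close> tensored with
      \<open>Q2 (i, c) (j, d)\<close>.\<close>
    define X where "X i c r = (if r = i * (n + 1) + c then 1 else 0 :: complex)" for i c r :: nat
    have idx: "i * (n + 1) + c < m" if "i < p" "c < n + 1" for i c
    proof -
      have "i * (n + 1) + c < (i + 1) * (n + 1)" using that by simp
      also have "\<dots> \<le> p * (n + 1)" using that by (intro mult_right_mono) auto
      finally show ?thesis using m by simp
    qed
    have pure_0: "pure n 0 w = 0" for w :: 'a
    proof -
      have 0: "0 \<in> E_space n" unfolding E_space_def by (rule cvec.span_zero)
      have "pure n (0 *\<^sub>C 0) w = 0 *\<^sub>C pure n 0 w" by (rule pure_left(2)[OF 0 0])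
      then show ?thesis by simp
    qed
    let ?p = "\<lambda>i j c d. pure n (E_pos n c d) (Q2 (i, c) (j, d))"
    let ?q = "\<lambda>j c d r r'. if r' = j * (n + 1) + d then pure n (E_pos n c d) (Q' r r') else 0"
    let ?x = "\<lambda>i j c r d r'. (X i c r * cnj (X j d r')) *\<^sub>C pure n (E_pos n c d) (Q' r r')"
    have main: "(complex_of_real e * unit_mat p i j) *\<^sub>C pure n (unit_mat (n + 1)) 1 + u i j =
        (\<Sum>c<n + 1. \<Sum>r<m. \<Sum>d<n + 1. \<Sum>r'<m. ?x i j c r d r')"
      if ij: "i < p" "j < p" for i j
    proof -
      have "(\<Sum>c<n + 1. \<Sum>r<m. \<Sum>d<n + 1. \<Sum>r'<m. ?x i j c r d r')
          = (\<Sum>c<n + 1. \<Sum>d<n + 1. ?p i j c d)"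
      proof (rule sum.cong[OF refl])
        fix c assume c: "c \<in> {..<n + 1}"
        have "(\<Sum>r<m. \<Sum>d<n + 1. \<Sum>r'<m. ?x i j c r d r')
            = (\<Sum>r<m. if r = i * (n + 1) + c then
                \<Sum>d<n + 1. \<Sum>r'<m. ?q j c d (i * (n + 1) + c) r' else 0)"
        proof (rule sum.cong[OF refl])
          fix r
          have X: "(X i c r * cnj (X j d r')) *\<^sub>C t
              = (if r = i * (n + 1) + c then (if r' = j * (n + 1) + d then t else 0) else 0)"
            for d r' and t :: "(complex matrix, 'a) tensor"
            by (simp add: X_def scaleC_one)
          show "(\<Sum>d<n + 1. \<Sum>r'<m. ?x i j c r d r')
            = (if r = i * (n + 1) + c then
                \<Sum>d<n + 1. \<Sum>r'<m. ?q j c d (i * (n + 1) + c) r' else 0)"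
          proof (cases "r = i * (n + 1) + c")
            case True
            show ?thesis unfolding X by (simp only: True if_True simp_thms)
          next
            case False
            show ?thesis unfolding X by (simp only: False if_False sum.neutral_const)
          qed
        qed
        also have "\<dots> = (\<Sum>d<n + 1. \<Sum>r'<m. ?q j c d (i * (n + 1) + c) r')"
          using idx[OF ij(1), of c] c by (subst sum.delta) auto
        also have "\<dots> = (\<Sum>d<n + 1. ?p i j c d)"
        proof (intro sum.cong refl)
          fix d assume d: "d \<in> {..<n + 1}"
          have "(\<Sum>r'<m. ?q j c d (i * (n + 1) + c) r')
              = pure n (E_pos n c d) (Q' (i * (n + 1) + c) (j * (n + 1) + d))"
            using idx[OF ij(2), of d] d by (subst sum.delta) auto
          also have "Q' (i * (n + 1) + c) (j * (n + 1) + d) = Q2 (i, c) (j, d)"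
            by (rule Q'_eq) (use ij c d in auto)
          finally show "(\<Sum>r'<m. ?q j c d (i * (n + 1) + c) r')
              = ?p i j c d" .
        qed
        finally show "(\<Sum>r<m. \<Sum>d<n + 1. \<Sum>r'<m. ?x i j c r d r')
            = (\<Sum>d<n + 1. ?p i j c d)" .
      qed
      also have "\<dots> = (\<Sum>c\<in>insert 0 {1..n}. \<Sum>d\<in>insert 0 {1..n}. ?p i j c d)"
      proof -
        have "{..<n + 1} = insert 0 {1..n}" by auto
        then show ?thesis by simp
      qed
      also have "\<dots> = (pure n (E_ball n) (Q2 (i, 0) (j, 0)) + (\<Sum>d\<in>{1..n}. pure n (matrix_unit d 0) (Q2 (i, 0) (j, d))))
          + (\<Sum>c\<in>{1..n}. pure n (matrix_unit 0 c) (Q2 (i, c) (j, 0)) + pure n (matrix_unit 0 0) (Q2 (i, c) (j, c)))"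
      proof -
        have s: "(\<Sum>d\<in>{1..n}. ?p i j c d) = pure n (matrix_unit 0 0) (Q2 (i, c) (j, c))"
          if c: "c \<in> {1..n}" for c
        proof -
          have "(\<Sum>d\<in>{1..n}. ?p i j c d)
              = (\<Sum>d\<in>{1..n}. if d = c then pure n (matrix_unit 0 0) (Q2 (i, c) (j, d)) else 0)"
            by (intro sum.cong refl) (use c in \<open>auto simp: E_pos_def pure_0\<close>)
          then show ?thesis using c by simp
        qed
        have ins: "(\<Sum>d\<in>insert 0 {1..n}. f d) = f 0 + (\<Sum>d\<in>{1..n}. f d)" for f :: "nat \<Rightarrow> (complex matrix, 'a) tensor"
          by (rule sum.insert) auto
        have "(\<Sum>d\<in>insert 0 {1..n}. pure n (E_pos n 0 d) (Q2 (i, 0) (j, d)))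
            = pure n (E_ball n) (Q2 (i, 0) (j, 0)) + (\<Sum>d\<in>{1..n}. pure n (matrix_unit d 0) (Q2 (i, 0) (j, d)))"
          unfolding ins by (intro arg_cong2[of _ _ _ _ plus] sum.cong refl) (auto simp: E_pos_def)
        moreover have "(\<Sum>d\<in>insert 0 {1..n}. ?p i j c d)
            = pure n (matrix_unit 0 c) (Q2 (i, c) (j, 0)) + pure n (matrix_unit 0 0) (Q2 (i, c) (j, c))"
          if "c \<in> {1..n}" for c
          unfolding ins s[OF that] using that by (simp add: E_pos_def)
        ultimately show ?thesis unfolding ins[of "\<lambda>c. \<Sum>d\<in>insert 0 {1..n}. ?p i j c d"]
          by (intro arg_cong2[of _ _ _ _ plus] sum.cong refl) simp_all
      qed
      \<comment> \<open>All \<open>c \<ge> 1\<close> share the diagonal entry \<open>E_00\<close> of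
        \<open>E_pos n\<close>, so their blocks \<open>Q2 (i, c) (j, c)\<close> enter through their
        sum alone.\<close>
      also have "\<dots> = E_tensor n (\<Sum>c\<in>{1..n}. Q2 (i, c) (j, c)) (Q2 (i, 0) (j, 0)) (\<lambda>c. Q2 (i, 0) (j, c)) (\<lambda>c. Q2 (i, c) (j, 0))"
      proof -
        have "pure n (matrix_unit 0 0) (\<Sum>c\<in>C. f c) = (\<Sum>c\<in>C. pure n (matrix_unit 0 0) (f c))" for C :: "nat set" and f :: "nat \<Rightarrow> 'a"
          by (induction C rule: infinite_finite_induct)
            (simp_all add: pure_right(1)[OF E_space_generators(1)] pure_right(3)[OF E_space_generators(1)])
        then show ?thesis unfolding E_tensor_def sum.distrib by (simp only: ac_simps)
      qed
      also have "\<dots> = E_tensor n (\<delta> i j + a i j) (\<delta> i j + b i j) (x i j) (y i j)"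
        unfolding Q2_00[OF ij] Q2_11[OF ij] E_tensor_def
        by (intro arg_cong2[of _ _ _ _ plus] sum.cong refl) (simp_all add: Q2_01[OF ij] Q2_10[OF ij])
      also have "\<dots> = E_tensor n (\<delta> i j) (\<delta> i j) (\<lambda>_. 0) (\<lambda>_. 0) + u i j"
        unfolding u_eq[OF ij] E_tensor_add by (simp only: add_0)
      also have "E_tensor n (\<delta> i j) (\<delta> i j) (\<lambda>_. 0) (\<lambda>_. 0) = (complex_of_real e * unit_mat p i j) *\<^sub>C pure n (unit_mat (n + 1)) 1"
      proof -
        have z: "(\<Sum>c=1..n. pure n (matrix_unit c 0) (0::'a)) = 0" "(\<Sum>c=1..n. pure n (matrix_unit 0 c) (0::'a)) = 0"
          by (intro sum.neutral ballI pure_right(3) E_space_generators, assumption)+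
        have \<delta>: "\<delta> i j = (complex_of_real e * unit_mat p i j) *\<^sub>C 1"
          using ij by (simp add: \<delta>_def unit_mat_def scaleC_of_real) (simp add: of_real_def)
        have "E_tensor n (\<delta> i j) (\<delta> i j) (\<lambda>_. 0) (\<lambda>_. 0) = pure n (matrix_unit 0 0) (\<delta> i j) + pure n (E_ball n) (\<delta> i j)"
          unfolding E_tensor_def z by simp
        also have "\<dots> = (complex_of_real e * unit_mat p i j) *\<^sub>C (pure n (matrix_unit 0 0) 1 + pure n (E_ball n) 1)"
          unfolding \<delta> pure_right(2)[OF E_space_generators(1)] pure_right(2)[OF E_space_generators(2)]
          by (simp only: scaleC_add_right)
        also have "pure n (matrix_unit 0 0) (1::'a) + pure n (E_ball n) 1 = pure n (unit_mat (n + 1)) 1"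
          unfolding unit_mat_eq by (rule pure_left(1)[symmetric, OF E_space_generators(1,2)])
        finally show ?thesis .
      qed
      finally show ?thesis by (rule sym)
    qed
    show ?thesis
      by (intro exI[of _ "n + 1"] exI[of _ m] bexI[OF _ E_pos_mcone] bexI[OF _ Q'] exI[of _ X] allI impI main)
  qed
  with mats show ?thesis by (simp add: max_tensor_def E_opsys_simps cstar)
qed

theorem proposition3p3:
  fixes n :: nat
  assumes "2 \<le> n"
  shows "complete_order_iso
           (min_tensor (E_opsys n) (cstar_opsys :: 'a::cstar_algebra opsys))
           (max_tensor (E_opsys n) (cstar_opsys :: 'a::cstar_algebra opsys))
           id"
proof -
  have "1 \<le> n" using assms by simp
  from min_positive_imp_max_positive[OF this] max_positive_imp_min_positive
  have "u \<in> mcone (min_tensor (E_opsys n) (cstar_opsys :: 'a opsys)) p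
      \<longleftrightarrow> u \<in> mcone (max_tensor (E_opsys n) cstar_opsys) p" for p u
    by (intro iffI)
  \<comment> \<open>Carrier and unit of the two tensor products agree by definition, which leaves
    the cones.\<close>
  then show ?thesis
    by (simp add: complete_order_iso_def linear_on_def) (simp add: min_tensor_def max_tensor_def)
qed

end
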